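(* Let $[A],[C]\in\hat V$ be main separated and, in the case of type $\mathfrak C_n$, assume additionally $\operatorname{supp}(A),\operatorname{supp}(C)\subseteq P^\circ$. If $\operatorname{Hom}_{\mathbb CU}(\mathbb C\mathcal O_A,\mathbb C\mathcal O_C)\ne(0)$, then there exists $[B]\in\mathcal O_C$ such that $\Psi_A$ and $\Psi_B$ coincide on $\operatorname{Stab}_U(A,B)$, and we have: (i) $\operatorname{verge}(A)=\operatorname{verge}(B)$ and hence $\mathcal V(A)=\mathcal V(B)$. (ii) $U_{I(A)}=U_{I(B)}$. (iii) There exists $g\in U_{I(A)}$ such that $g.[B]=[A]$. (iv) $\mathbb C\widetilde{\mathcal O}_A=\mathbb C\widetilde{\mathcal O}_B$ and $g.\widetilde{[B]}=\widetilde{[A]}$ (with $g$ as in (iii)). (v) $\mathbb C\mathcal O_A\cong\mathbb C\mathcal O_B$ as $\mathbb CU$-modules. Thus, the corresponding main separated $U$-orbit modules (for $[A],[C]$ as in the first sentence) are either isomorphic or afford orthogonal characters.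
   Context: Let $q$ be a power of an odd prime $p$, $n$ a positive integer, and fix a Lie type $\mathfrak B_n$, $\mathfrak C_n$ or $\mathfrak D_n$. Put $N=2n+1$ in type $\mathfrak B_n$, $N=2n$ in types $\mathfrak C_n,\mathfrak D_n$; $\tilde n=n+1$ in type $\mathfrak B_n$, $\tilde n=n$ otherwise; $\bar i=N+1-i$ for $1\le i\le N$. Let $T=\{(i,j):1\le i<j\le N\}$, $P^\circ=\{(i,j):1\le i<j<\bar i\}$, $\Gamma=\{(i,\bar i):1\le i<\bar i\}$; $P=P^\circ$ in types $\mathfrak B_n,\mathfrak D_n$ and $P=P^\circ\cup\Gamma$ in type $\mathfrak C_n$. $V$ is the space of $N\times N$-matrices over $\mathbb F_q$ whose support $\operatorname{supp}$ lies in $P$, $\widetilde V$ the space of those with support in $T$; $\pi$ and $\pi_T$ are the maps from $N\times N$-matrices onto $V$ resp. $\widetilde V$ replacing entries outside $P$ resp. $T$ by zero. $\widetilde U$ is the group of upper unitriangular $N\times N$-matrices over $\mathbb F_q$; $e_{ij}$ are the matrix units. For $(i,j)\in P$, $\alpha\in\mathbb F_q$ define $x_{ij}(\alpha)$: in type $\mathfrak D_n$, and in type $\mathfrak B_n$ if $j\ne n+1$: $1+\alpha e_{ij}-\alpha e_{\bar j\,\bar i}$; in type $\mathfrak B_n$, $j=n+1$: $1+\alpha e_{i,n+1}-\alpha e_{n+1,\bar i}-\frac12\alpha^2e_{i\bar i}$; in type $\mathfrak C_n$: $1+\alpha e_{ij}-\alpha e_{\bar j\,\bar i}$ if $j\le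 n$, $1+\alpha e_{ij}+\alpha e_{\bar j\,\bar i}$ if $n<j<\bar i$, and $1+\alpha e_{i\bar i}$ if $j=\bar i$. $X_{ij}=\{x_{ij}(\alpha):\alpha\in\mathbb F_q\}$ and $U\le\widetilde U$ is the group generated by all $X_{ij}$, $(i,j)\in P$. Fix a nontrivial linear character $\theta:(\mathbb F_q,+)\to\mathbb C^*$ and put $\kappa(A,B)=\operatorname{tr}(A^tB)$. For $A\in V$ let $[A]$ be the linear character $B\mapsto\theta(\kappa(-A,B))$ of $(V,+)$; $\hat V=\{[A]:A\in V\}$. For $g\in\widetilde U$ ($g^{-t}$ the inverse transpose) put $[A].g=[\pi(Ag^{-t})]$, $g.[A]=[\pi(g^{-t}A)]$ and $[A]g=\theta(\kappa(-A,\pi(g^{-1})))\,[A].g$; the last formula makes $\mathbb C\hat V$ a right $\mathbb C\widetilde U$-module. $\mathcal O_A=\{[A].u:u\in U\}$, and the orbit module $\mathbb C\mathcal O_A$ is its span, a right $\mathbb CU$-module. $\operatorname{Stab}_U[A]=\{u\in U:[A].u=[A]\}$, $\operatorname{Stab}_U(A,B)=\operatorname{Stab}_U[A]\cap\operatorname{Stab}_U[B]$, and $\Psi_A:\operatorname{Stab}_U[A]\to\mathbb C^*$ is the linear character with $[A]u=\Psi_A(u)[A]$. For $A\in\widetilde V$ let $\widetilde{[A]}$ be the linear character $B\mapsto\theta(\kappa(-A,B))$ of $(\widetilde V,+)$; put $\widetilde{[A]}.g=\widetilde{[\pi_T(Ag^{-t})]}$ and $g.\widetilde{[A]}=\widetilde{[\pi_T(g^{-t}A)]}$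 for $g\in\widetilde U$; $\widetilde{\mathcal O}_A=\{\widetilde{[A]}.g:g\in\widetilde U\}$, with $\mathbb C$-span $\mathbb C\widetilde{\mathcal O}_A$. For $A\in V$, $\operatorname{main}(A)$ is the set of $(i,j)\in P$ such that $A_{ij}$ is the rightmost nonzero entry of row $i$; $\operatorname{r.main}(A)=\{(i,j)\in\operatorname{main}(A):j>\tilde n\}$; $\operatorname{verge}(A)=\sum_{(i,j)\in\operatorname{main}(A)}A_{ij}e_{ij}$; $\mathcal V(A)=\{[B]\in\hat V:\operatorname{verge}(B)=\operatorname{verge}(A)\}$. For $(i,j)\in P$ set $\mathcal A(i,j)=\{(\bar j,a)\in P^\circ\}$, $\mathcal L(i,j)=\{(a,j)\in P^\circ:a>i\}$. $\operatorname{Limb}^\circ(A)=\bigcup_{(i,j)\in\operatorname{main}(A)}\mathcal A(i,j)\cup\mathcal L(i,j)$; $\operatorname{Limb}(A)=\operatorname{Limb}^\circ(A)$ in types $\mathfrak B_n,\mathfrak D_n$ and $\operatorname{Limb}(A)=\operatorname{Limb}^\circ(A)\cup\{(\bar j,j)\in\Gamma:\exists i,\ (i,j)\in\operatorname{r.main}(A)\cap P^\circ\}$ in type $\mathfrak C_n$. $[A]$ is main separated if $\operatorname{Limb}(A)\cap\operatorname{main}(A)=\emptyset$. $I(A)=\{(i,j)\in T:\exists\,(i,a),(j,b)\in\operatorname{main}(A)\text{ with }a<b\}\subseteq P$, and $U_{I(A)}$ is the subgroup of $U$ generated by all $X_{ij}$, $(i,j)\in I(A)$. *)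

theory Defs
  imports
    Complex_Main
    "HOL-Library.Poly_Mapping"
    "HOL-Library.Cardinality"
    "HOL-Computational_Algebra.Primes"
    "HOL-Algebra.Generated_Groups"
    "Jordan_Normal_Form.Matrix"
begin

section \<open>Index sets\<close>

datatype lie_type = Lie_B | Lie_C | Lie_D

definition mdim :: "lie_type \<Rightarrow> nat \<Rightarrow> nat" where
  "mdim ty n = (if ty = Lie_B then 2 * n + 1 else 2 * n)"

definition ntilde :: "lie_type \<Rightarrow> nat \<Rightarrow> nat" where
  "ntilde ty n = (if ty = Lie_B then n + 1 else n)"

definition bar :: "lie_type \<Rightarrow> nat \<Rightarrow> nat \<Rightarrow> nat" where
  "bar ty n i = mdim ty n + 1 - i"

definition pos_T :: "nat \<Rightarrow> (nat \<times> nat) set" where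
  "pos_T N = {(i, j). 1 \<le> i \<and> i < j \<and> j \<le> N}"

definition pos_P0 :: "lie_type \<Rightarrow> nat \<Rightarrow> (nat \<times> nat) set" where
  "pos_P0 ty n = {(i, j). 1 \<le> i \<and> i < j \<and> j < bar ty n i}"

definition pos_Gamma :: "lie_type \<Rightarrow> nat \<Rightarrow> (nat \<times> nat) set" where
  "pos_Gamma ty n = {(i, bar ty n i) | i. 1 \<le> i \<and> i < bar ty n i}"

definition pos_P :: "lie_type \<Rightarrow> nat \<Rightarrow> (nat \<times> nat) set" where
  "pos_P ty n = (if ty = Lie_C then pos_P0 ty n \<union> pos_Gamma ty n else pos_P0 ty n)"

section \<open>Matrices\<close>

text \<open>Positions (i, j) are 1-based throughout, whereas the matrix type of the library is
  0-based; the function \<open>entry\<close> and the index shifts below mediate between the two.\<close>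

definition entry :: "'a mat \<Rightarrow> nat \<Rightarrow> nat \<Rightarrow> 'a" where
  "entry A i j = A $$ (i - 1, j - 1)"

definition supp :: "'a::zero mat \<Rightarrow> (nat \<times> nat) set" where
  "supp A = {(i, j). i \<in> {1..dim_row A} \<and> j \<in> {1..dim_col A} \<and> entry A i j \<noteq> 0}"

definition mats_on :: "nat \<Rightarrow> (nat \<times> nat) set \<Rightarrow> 'a::zero mat set" where
  "mats_on N S = {A \<in> carrier_mat N N. supp A \<subseteq> S}"

definition proj :: "(nat \<times> nat) set \<Rightarrow> 'a::zero mat \<Rightarrow> 'a mat" where
  "proj S A = mat (dim_row A) (dim_col A)
     (\<lambda>(r, c). if (r + 1, c + 1) \<in> S then A $$ (r, c) else 0)"

definition spV :: "lie_type \<Rightarrow> nat \<Rightarrow> 'a::zero mat set" where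
  "spV ty n = mats_on (mdim ty n) (pos_P ty n)"

definition matrix_unit :: "nat \<Rightarrow> nat \<Rightarrow> nat \<Rightarrow> 'a::{zero, one} mat" where
  "matrix_unit N i j = mat N N (\<lambda>(r, c). if r + 1 = i \<and> c + 1 = j then 1 else 0)"

definition kappa :: "'a::semiring_0 mat \<Rightarrow> 'a mat \<Rightarrow> 'a" where
  "kappa A B = (let M = transpose_mat A * B in \<Sum>i<dim_row M. M $$ (i, i))"

section \<open>Groups\<close>

definition unitri :: "nat \<Rightarrow> 'a::field mat monoid" where
  "unitri N = \<lparr> carrier = {g \<in> carrier_mat N N. upper_triangular g \<and> (\<forall>i<N. g $$ (i, i) = 1)},
                mult = (*), one = 1\<^sub>m N \<rparr>"

definition inv_transp :: "nat \<Rightarrow> 'a::field mat \<Rightarrow> 'a mat" where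
  "inv_transp N g = transpose_mat (inv\<^bsub>unitri N\<^esub> g)"

definition root_elt :: "lie_type \<Rightarrow> nat \<Rightarrow> nat \<Rightarrow> nat \<Rightarrow> 'a::field \<Rightarrow> 'a mat" where
  "root_elt ty n i j \<alpha> =
    (let N = mdim ty n; e = matrix_unit N; i' = bar ty n i; j' = bar ty n j in
     case ty of
       Lie_D \<Rightarrow> 1\<^sub>m N + \<alpha> \<cdot>\<^sub>m e i j - \<alpha> \<cdot>\<^sub>m e j' i'
     | Lie_B \<Rightarrow>
         (if j \<noteq> n + 1 then 1\<^sub>m N + \<alpha> \<cdot>\<^sub>m e i j - \<alpha> \<cdot>\<^sub>m e j' i'
          else 1\<^sub>m N + \<alpha> \<cdot>\<^sub>m e i (n + 1) - \<alpha> \<cdot>\<^sub>m e (n + 1) i' - (1 / 2 * \<alpha>\<^sup>2) \<cdot>\<^sub>m e i i')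
     | Lie_C \<Rightarrow>
         (if j \<le> n then 1\<^sub>m N + \<alpha> \<cdot>\<^sub>m e i j - \<alpha> \<cdot>\<^sub>m e j' i'
          else if j < i' then 1\<^sub>m N + \<alpha> \<cdot>\<^sub>m e i j + \<alpha> \<cdot>\<^sub>m e j' i'
          else 1\<^sub>m N + \<alpha> \<cdot>\<^sub>m e i i'))"

definition gen_subgroup :: "lie_type \<Rightarrow> nat \<Rightarrow> (nat \<times> nat) set \<Rightarrow> 'a::field mat set" where
  "gen_subgroup ty n S = generate (unitri (mdim ty n)) (\<Union>(i, j)\<in>S. range (root_elt ty n i j))"

definition grpU :: "lie_type \<Rightarrow> nat \<Rightarrow> 'a::field mat set" where
  "grpU ty n = gen_subgroup ty n (pos_P ty n)"

section \<open>Characters of the spaces of matrices with prescribed support\<close>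

text \<open>A linear character of \<open>mats_on N S\<close> is a function that is \<open>undefined\<close> off \<open>mats_on N S\<close>.
  The constructions depending on S are used for the space V, with S the set \<open>pos_P ty n\<close>,
  and for the space of all strictly upper triangular matrices, with S the set \<open>pos_T N\<close>.\<close>

definition nontrivial_add_char :: "('a::ring \<Rightarrow> complex) \<Rightarrow> bool" where
  "nontrivial_add_char \<theta> \<longleftrightarrow>
     (\<forall>x. \<theta> x \<noteq> 0) \<and> (\<forall>x y. \<theta> (x + y) = \<theta> x * \<theta> y) \<and> (\<exists>x. \<theta> x \<noteq> 1)"

definition lin_char ::
    "('a::ring \<Rightarrow> complex) \<Rightarrow> nat \<Rightarrow> (nat \<times> nat) set \<Rightarrow> 'a mat \<Rightarrow> 'a mat \<Rightarrow> complex" where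
  "lin_char \<theta> N S A = (\<lambda>B\<in>mats_on N S. \<theta> (kappa (- A) B))"

definition char_dot_right ::
    "('a::field \<Rightarrow> complex) \<Rightarrow> nat \<Rightarrow> (nat \<times> nat) set \<Rightarrow> 'a mat \<Rightarrow> 'a mat \<Rightarrow> 'a mat \<Rightarrow> complex" where
  "char_dot_right \<theta> N S A g = lin_char \<theta> N S (proj S (A * inv_transp N g))"

definition char_dot_left ::
    "('a::field \<Rightarrow> complex) \<Rightarrow> nat \<Rightarrow> (nat \<times> nat) set \<Rightarrow> 'a mat \<Rightarrow> 'a mat \<Rightarrow> 'a mat \<Rightarrow> complex" where
  "char_dot_left \<theta> N S g A = lin_char \<theta> N S (proj S (inv_transp N g * A))"

abbreviation charV ::
    "('a::ring \<Rightarrow> complex) \<Rightarrow> lie_type \<Rightarrow> nat \<Rightarrow> 'a mat \<Rightarrow> 'a mat \<Rightarrow> complex" where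
  "charV \<theta> ty n \<equiv> lin_char \<theta> (mdim ty n) (pos_P ty n)"

abbreviation charV_right ::
    "('a::field \<Rightarrow> complex) \<Rightarrow> lie_type \<Rightarrow> nat \<Rightarrow> 'a mat \<Rightarrow> 'a mat \<Rightarrow> 'a mat \<Rightarrow> complex" where
  "charV_right \<theta> ty n \<equiv> char_dot_right \<theta> (mdim ty n) (pos_P ty n)"

abbreviation charV_left ::
    "('a::field \<Rightarrow> complex) \<Rightarrow> lie_type \<Rightarrow> nat \<Rightarrow> 'a mat \<Rightarrow> 'a mat \<Rightarrow> 'a mat \<Rightarrow> complex" where
  "charV_left \<theta> ty n \<equiv> char_dot_left \<theta> (mdim ty n) (pos_P ty n)"

abbreviation charT ::
    "('a::ring \<Rightarrow> complex) \<Rightarrow> lie_type \<Rightarrow> nat \<Rightarrow> 'a mat \<Rightarrow> 'a mat \<Rightarrow> complex" where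
  "charT \<theta> ty n \<equiv> lin_char \<theta> (mdim ty n) (pos_T (mdim ty n))"

abbreviation charT_left ::
    "('a::field \<Rightarrow> complex) \<Rightarrow> lie_type \<Rightarrow> nat \<Rightarrow> 'a mat \<Rightarrow> 'a mat \<Rightarrow> 'a mat \<Rightarrow> complex" where
  "charT_left \<theta> ty n \<equiv> char_dot_left \<theta> (mdim ty n) (pos_T (mdim ty n))"

definition orbitV ::
    "('a::field \<Rightarrow> complex) \<Rightarrow> lie_type \<Rightarrow> nat \<Rightarrow> 'a mat \<Rightarrow> ('a mat \<Rightarrow> complex) set" where
  "orbitV \<theta> ty n A = charV_right \<theta> ty n A ` grpU ty n"

definition orbitT ::
    "('a::field \<Rightarrow> complex) \<Rightarrow> lie_type \<Rightarrow> nat \<Rightarrow> 'a mat \<Rightarrow> ('a mat \<Rightarrow> complex) set" where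
  "orbitT \<theta> ty n A =
     char_dot_right \<theta> (mdim ty n) (pos_T (mdim ty n)) A ` carrier (unitri (mdim ty n))"

section \<open>Orbit modules\<close>

text \<open>Formal complex linear combinations are finitely supported functions; the basis vector
  belonging to x is \<open>Poly_Mapping.single x 1\<close>.\<close>

definition cscale :: "complex \<Rightarrow> ('b \<Rightarrow>\<^sub>0 complex) \<Rightarrow> ('b \<Rightarrow>\<^sub>0 complex)" where
  "cscale c v = Poly_Mapping.map (\<lambda>z. c * z) v"

definition cspan_of :: "'b set \<Rightarrow> ('b \<Rightarrow>\<^sub>0 complex) set" where
  "cspan_of X = {v. Poly_Mapping.keys v \<subseteq> X}"

abbreviation orbit_module ::
    "('a::field \<Rightarrow> complex) \<Rightarrow> lie_type \<Rightarrow> nat \<Rightarrow> 'a mat \<Rightarrow> (('a mat \<Rightarrow> complex) \<Rightarrow>\<^sub>0 complex) set" where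
  "orbit_module \<theta> ty n A \<equiv> cspan_of (orbitV \<theta> ty n A)"

abbreviation orbit_moduleT ::
    "('a::field \<Rightarrow> complex) \<Rightarrow> lie_type \<Rightarrow> nat \<Rightarrow> 'a mat \<Rightarrow> (('a mat \<Rightarrow> complex) \<Rightarrow>\<^sub>0 complex) set" where
  "orbit_moduleT \<theta> ty n A \<equiv> cspan_of (orbitT \<theta> ty n A)"

text \<open>The right action of a group element is the linear extension of
  \<open>[A] g = \<theta>(\<kappa>(-A, \<pi>(g\<^sup>-\<^sup>1))) [A].g\<close>; the sum runs over all basis vectors \<open>[A]\<close>, A in V.\<close>

definition act ::
    "('a::field \<Rightarrow> complex) \<Rightarrow> lie_type \<Rightarrow> nat \<Rightarrow>
     (('a mat \<Rightarrow> complex) \<Rightarrow>\<^sub>0 complex) \<Rightarrow> 'a mat \<Rightarrow> (('a mat \<Rightarrow> complex) \<Rightarrow>\<^sub>0 complex)" where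
  "act \<theta> ty n v g =
     (\<Sum>A\<in>spV ty n. Poly_Mapping.single (charV_right \<theta> ty n A g)
        (Poly_Mapping.lookup v (charV \<theta> ty n A)
          * \<theta> (kappa (- A) (proj (pos_P ty n) (inv\<^bsub>unitri (mdim ty n)\<^esub> g)))))"

text \<open>Elements of the group algebra of U are formal linear combinations of elements of U.\<close>

definition alg_act ::
    "('a::field \<Rightarrow> complex) \<Rightarrow> lie_type \<Rightarrow> nat \<Rightarrow>
     (('a mat \<Rightarrow> complex) \<Rightarrow>\<^sub>0 complex) \<Rightarrow> ('a mat \<Rightarrow>\<^sub>0 complex) \<Rightarrow>
     (('a mat \<Rightarrow> complex) \<Rightarrow>\<^sub>0 complex)" where
  "alg_act \<theta> ty n v x =
     (\<Sum>u\<in>Poly_Mapping.keys x. cscale (Poly_Mapping.lookup x u) (act \<theta> ty n v u))"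

definition Hom_CU ::
    "('a::field \<Rightarrow> complex) \<Rightarrow> lie_type \<Rightarrow> nat \<Rightarrow>
     (('a mat \<Rightarrow> complex) \<Rightarrow>\<^sub>0 complex) set \<Rightarrow> (('a mat \<Rightarrow> complex) \<Rightarrow>\<^sub>0 complex) set \<Rightarrow>
     ((('a mat \<Rightarrow> complex) \<Rightarrow>\<^sub>0 complex) \<Rightarrow> (('a mat \<Rightarrow> complex) \<Rightarrow>\<^sub>0 complex)) set" where
  "Hom_CU \<theta> ty n M M' =
     {f \<in> M \<rightarrow>\<^sub>E M'.
        (\<forall>v\<in>M. \<forall>w\<in>M. f (v + w) = f v + f w) \<and>
        (\<forall>v\<in>M. \<forall>x\<in>cspan_of (grpU ty n). f (alg_act \<theta> ty n v x) = alg_act \<theta> ty n (f v) x)}"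

definition iso_CU ::
    "('a::field \<Rightarrow> complex) \<Rightarrow> lie_type \<Rightarrow> nat \<Rightarrow>
     (('a mat \<Rightarrow> complex) \<Rightarrow>\<^sub>0 complex) set \<Rightarrow> (('a mat \<Rightarrow> complex) \<Rightarrow>\<^sub>0 complex) set \<Rightarrow> bool" where
  "iso_CU \<theta> ty n M M' \<longleftrightarrow> (\<exists>f\<in>Hom_CU \<theta> ty n M M'. bij_betw f M M')"

text \<open>The trace of the action of u, computed in the basis given by the orbit.\<close>

definition orbit_character :: "('a::field \<Rightarrow> complex) \<Rightarrow> lie_type \<Rightarrow> nat \<Rightarrow> 'a mat \<Rightarrow> 'a mat \<Rightarrow> complex"
  where "orbit_character \<theta> ty n A u =
     (\<Sum>\<chi>\<in>orbitV \<theta> ty n A. Poly_Mapping.lookup (act \<theta> ty n (Poly_Mapping.single \<chi> 1) u) \<chi>)"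

definition char_inner :: "'g set \<Rightarrow> ('g \<Rightarrow> complex) \<Rightarrow> ('g \<Rightarrow> complex) \<Rightarrow> complex" where
  "char_inner G \<phi> \<psi> = (\<Sum>u\<in>G. \<phi> u * cnj (\<psi> u)) / of_nat (card G)"

definition stab ::
    "('a::field \<Rightarrow> complex) \<Rightarrow> lie_type \<Rightarrow> nat \<Rightarrow> 'a mat \<Rightarrow> 'a mat set" where
  "stab \<theta> ty n A = {u \<in> grpU ty n. charV_right \<theta> ty n A u = charV \<theta> ty n A}"

definition stab2 ::
    "('a::field \<Rightarrow> complex) \<Rightarrow> lie_type \<Rightarrow> nat \<Rightarrow> 'a mat \<Rightarrow> 'a mat \<Rightarrow> 'a mat set" where
  "stab2 \<theta> ty n A B = stab \<theta> ty n A \<inter> stab \<theta> ty n B"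

definition Psi ::
    "('a::field \<Rightarrow> complex) \<Rightarrow> lie_type \<Rightarrow> nat \<Rightarrow> 'a mat \<Rightarrow> 'a mat \<Rightarrow> complex" where
  "Psi \<theta> ty n A = (\<lambda>u\<in>stab \<theta> ty n A.
     THE c. act \<theta> ty n (Poly_Mapping.single (charV \<theta> ty n A) 1) u
          = cscale c (Poly_Mapping.single (charV \<theta> ty n A) 1))"

section \<open>Main conditions, verge and limbs\<close>

definition main :: "lie_type \<Rightarrow> nat \<Rightarrow> 'a::zero mat \<Rightarrow> (nat \<times> nat) set" where
  "main ty n A = {(i, j) \<in> pos_P ty n. entry A i j \<noteq> 0 \<and> (\<forall>k. j < k \<and> k \<le> mdim ty n \<longrightarrow> entry A i k = 0)}"

definition rmain :: "lie_type \<Rightarrow> nat \<Rightarrow> 'a::zero mat \<Rightarrow> (nat \<times> nat) set" where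
  "rmain ty n A = {(i, j) \<in> main ty n A. ntilde ty n < j}"

text \<open>The sum of the \<open>A\<^sub>i\<^sub>j e\<^sub>i\<^sub>j\<close> over the main conditions is A with all other entries deleted.\<close>

definition verge :: "lie_type \<Rightarrow> nat \<Rightarrow> 'a::zero mat \<Rightarrow> 'a mat" where
  "verge ty n A = proj (main ty n A) A"

definition verge_class ::
    "('a::ring \<Rightarrow> complex) \<Rightarrow> lie_type \<Rightarrow> nat \<Rightarrow> 'a mat \<Rightarrow> ('a mat \<Rightarrow> complex) set" where
  "verge_class \<theta> ty n A = {charV \<theta> ty n B | B. B \<in> spV ty n \<and> verge ty n B = verge ty n A}"

definition arm :: "lie_type \<Rightarrow> nat \<Rightarrow> nat \<Rightarrow> nat \<Rightarrow> (nat \<times> nat) set" where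
  "arm ty n i j = {(bar ty n j, a) | a. (bar ty n j, a) \<in> pos_P0 ty n}"

definition leg :: "lie_type \<Rightarrow> nat \<Rightarrow> nat \<Rightarrow> nat \<Rightarrow> (nat \<times> nat) set" where
  "leg ty n i j = {(a, j) | a. (a, j) \<in> pos_P0 ty n \<and> a > i}"

definition limb0 :: "lie_type \<Rightarrow> nat \<Rightarrow> 'a::zero mat \<Rightarrow> (nat \<times> nat) set" where
  "limb0 ty n A = (\<Union>(i, j)\<in>main ty n A. arm ty n i j \<union> leg ty n i j)"

definition limb :: "lie_type \<Rightarrow> nat \<Rightarrow> 'a::zero mat \<Rightarrow> (nat \<times> nat) set" where
  "limb ty n A =
     (if ty = Lie_C
      then limb0 ty n A \<union>
        {(bar ty n j, j) | j. (bar ty n j, j) \<in> pos_Gamma ty n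
                              \<and> (\<exists>i. (i, j) \<in> rmain ty n A \<inter> pos_P0 ty n)}
      else limb0 ty n A)"

definition main_separated :: "lie_type \<Rightarrow> nat \<Rightarrow> 'a::zero mat \<Rightarrow> bool" where
  "main_separated ty n A \<longleftrightarrow> limb ty n A \<inter> main ty n A = {}"

definition posI :: "lie_type \<Rightarrow> nat \<Rightarrow> 'a::zero mat \<Rightarrow> (nat \<times> nat) set" where
  "posI ty n A = {(i, j) \<in> pos_T (mdim ty n).
     \<exists>a b. (i, a) \<in> main ty n A \<and> (j, b) \<in> main ty n A \<and> a < b}"

definition U_I :: "lie_type \<Rightarrow> nat \<Rightarrow> 'a::field mat \<Rightarrow> 'a mat set" where
  "U_I ty n A = gen_subgroup ty n (posI ty n A)"

end

theory Submission
  imports Defs "Jordan_Normal_Form.Determinant" "HOL-Number_Theory.Residues"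
begin

text \<open>Write X^* for the transpose of X along the antidiagonal, with signs in type C, and call X - X^* the skew
  part of X. Then ^* is an anti-automorphism, and U is the group of all unitriangular h with
  h h^* = 1 (\<open>isometries_subset_grpU\<close> is the inclusion that matters).

  The line spanned by [A] generates the orbit module of A, and the stabiliser of [A] acts on it by Psi_A.
  So a nonzero homomorphism, as well as a nonzero inner product of the characters, produces a B in the orbit
  of C such that Psi_A and Psi_B coincide on the common stabiliser (\<open>Hom_nonzero_agree\<close>,
  \<open>inner_nonzero_agree\<close>). Everything else is deduced from this coincidence.

  It can be made linear. The element with inverse 1 + Y fixes [A] if and only if A Y^t vanishes above the
  diagonal, and Psi_A depends only on the trace of A Y^t. Both are unaffected by the terms of higher order of a
  Cayley transform Y = 2 X + 2 X^2 + ..., so tr(A^t X) = tr(B^t X) for all strictly upper triangular X with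
  X^* = -X for which A X^t and B X^t vanish above the diagonal (\<open>agree_linearised\<close>). By duality there are
  lower unitriangular C1, C2 such that C1 A and C2 B have the same skew part above the diagonal
  (\<open>agree_skew_parts\<close>).

  Let D be the verge of A. Main separation says that D is monomial and that its nonzero rows are never mirror to
  its nonzero columns. So A = D L with L lower unitriangular, and the columns of C1 that meet rows of D can be merged
  with columns of L^* into one lower unitriangular G with

    skew part of C1 A = G (D - D^*) G^*   and   A = D G^*

  (\<open>skew_part_normal_form\<close>). Here D - D^* is again monomial, and a monomial matrix is determined by its
  class under lower triangular row and column operations, even if only the entries above the
  diagonal are compared (\<open>monomial_unique\<close>). Hence A and B have the same verge. Comparing the matrices G for A
  and B shows that B agrees above the diagonal with q A, where q is lower unitriangular with off-diagonal support
  the transpose of a subset of I(A) (\<open>verge_and_rows\<close>); every such q is the effect of an element of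
  U_I(A) (\<open>pattern_left_action\<close>).

  Row operations commute with the right action, so [A] and [B] have the same stabiliser. There Psi_A and Psi_B
  coincide, and the two orbit modules are induced from the same linear character
  (\<open>agree_same_datum\<close>, \<open>same_datum_iso\<close>).

  Rows and columns are numbered from 0 below; the index mirror to i is N - 1 - i.\<close>

section \<open>Triangular matrices\<close>

\<comment> \<open>Products stay folded; their entries are expanded by \<open>times_entry\<close>, as sums of field elements.\<close>
declare index_mult_mat(1) [simp del]

lemma times_entry:
  assumes "X \<in> carrier_mat N N" "Y \<in> carrier_mat N N" "i < N" "j < N"
  shows "(X * Y) $$ (i, j) = (\<Sum>k<N. X $$ (i, k) * Y $$ (k, j))"
  using assms by (auto simp: index_mult_mat scalar_prod_def lessThan_atLeast0)

lemma finite_carrier_mat: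
  "finite (carrier_mat N N :: 'a::finite mat set)"
proof -
  have "(carrier_mat N N :: 'a mat set) \<subseteq>
      mat N N ` (PiE ({..<N} \<times> {..<N}) (\<lambda>_. UNIV))"
  proof
    fix X :: "'a mat" assume X: "X \<in> carrier_mat N N"
    have "X = mat N N (restrict (\<lambda>p. X $$ p) ({..<N} \<times> {..<N}))"
      using X by (intro eq_matI) simp_all
    then show "X \<in> mat N N ` (PiE ({..<N} \<times> {..<N}) (\<lambda>_. UNIV))"
      by (rule image_eqI[where f = "mat N N"]) simp
  qed
  then show ?thesis by (rule finite_subset) (simp add: finite_PiE)
qed

lemma unitri_iff:
  "g \<in> carrier (unitri N) \<longleftrightarrow> g \<in> carrier_mat N N \<and> (\<forall>i<N. g $$ (i, i) = 1)
     \<and> (\<forall>i j. j < i \<longrightarrow> i < N \<longrightarrow> g $$ (i, j) = 0)"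
  by (auto simp: unitri_def upper_triangular_def)

lemma unitri_simps [simp]:
  "mult (unitri N) = (*)" "one (unitri N) = 1\<^sub>m N"
  by (auto simp: unitri_def)

lemma unitri_mat: "g \<in> carrier (unitri N) \<Longrightarrow> g \<in> carrier_mat N N"
  by (simp add: unitri_iff)

lemma unitri_times:
  fixes g h :: "'a::field mat"
  assumes "g \<in> carrier (unitri N)" "h \<in> carrier (unitri N)"
  shows "g * h \<in> carrier (unitri N)"
proof -
  have c: "g \<in> carrier_mat N N" "h \<in> carrier_mat N N" using assms by (auto simp: unitri_iff)
  have "(g * h) $$ (i, i) = 1" if "i < N" for i
  proof -
    have "g $$ (i, k) * h $$ (k, i) = (if k = i then 1 else 0)" if "k < N" for k
      using assms \<open>i < N\<close> that by (cases k i rule: linorder_cases) (auto simp: unitri_iff)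
    then show ?thesis using c that by (simp add: times_entry[where N = N] sum.delta)
  qed
  moreover have "(g * h) $$ (i, j) = 0" if "j < i" "i < N" for i j
  proof -
    have "g $$ (i, k) * h $$ (k, j) = 0" if "k < N" for k
      using assms \<open>j < i\<close> \<open>i < N\<close> that by (cases "k < i") (auto simp: unitri_iff)
    then have "(\<Sum>k<N. g $$ (i, k) * h $$ (k, j)) = 0"
      by (intro sum.neutral ballI) (simp only: lessThan_iff)
    then show ?thesis using c that by (simp add: times_entry[where N = N])
  qed
  ultimately show ?thesis using c by (auto simp: unitri_iff)
qed

text \<open>An invertible g permutes the finite set of unitriangular matrices by left
  multiplication, so 1 = g h for some unitriangular h.\<close>

lemma unitri_group: "group (unitri N :: 'a::{field, finite} mat monoid)"
proof (rule groupI)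
  fix g :: "'a mat" assume g: "g \<in> carrier (unitri N)"
  then have gc: "g \<in> carrier_mat N N" by (rule unitri_mat)
  have "upper_triangular g" using g by (simp add: unitri_def)
  moreover have "diag_mat g = map (\<lambda>_. 1) [0..<N]"
    using g gc by (auto simp: unitri_iff diag_mat_def)
  then have "prod_list (diag_mat g) = 1" by (simp add: map_replicate_const)
  ultimately have "det g \<noteq> 0" using det_upper_triangular[OF _ gc] by simp
  then obtain g' where g': "g' \<in> carrier_mat N N" "g' * g = 1\<^sub>m N" "g * g' = 1\<^sub>m N"
    using det_non_zero_imp_unit[OF gc] by (auto simp: Units_def ring_mat_def)
  let ?S = "carrier (unitri N) :: 'a mat set"
  have "inj_on ((*) g) ?S"
  proof (rule inj_onI)
    fix x y assume xy: "x \<in> ?S" "y \<in> ?S" "g * x = g * y"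
    have "x = g' * (g * x)" using g' gc unitri_mat[OF xy(1)]
      by (simp flip: assoc_mult_mat[of _ N N _ N _ N])
    also have "\<dots> = y" using g' gc unitri_mat[OF xy(2)] xy(3)
      by (simp flip: assoc_mult_mat[of _ N N _ N _ N])
    finally show "x = y" .
  qed
  moreover have "(*) g ` ?S \<subseteq> ?S" using g unitri_times by auto
  moreover have "finite ?S"
    by (rule finite_subset[OF _ finite_carrier_mat[of N]]) (auto simp: unitri_iff)
  ultimately have "(*) g ` ?S = ?S" by (simp add: endo_inj_surj)
  moreover have "1\<^sub>m N \<in> ?S" by (auto simp: unitri_iff)
  ultimately obtain h where h: "h \<in> ?S" "1\<^sub>m N = g * h" by blast
  then have "h * g = 1\<^sub>m N"
    using gc mat_mult_left_right_inverse[of g N h] unitri_mat[of h N] by auto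
  then show "\<exists>y\<in>carrier (unitri N). y \<otimes>\<^bsub>unitri N\<^esub> g = \<one>\<^bsub>unitri N\<^esub>"
    using h by auto
next
  fix x y z :: "'a mat"
  assume "x \<in> carrier (unitri N)" "y \<in> carrier (unitri N)" "z \<in> carrier (unitri N)"
  then show "x \<otimes>\<^bsub>unitri N\<^esub> y \<otimes>\<^bsub>unitri N\<^esub> z = x \<otimes>\<^bsub>unitri N\<^esub> (y \<otimes>\<^bsub>unitri N\<^esub> z)"
    using assoc_mult_mat[of x N N y N z N] by (auto simp: unitri_iff)
qed (auto simp: unitri_times unitri_mat intro: left_mult_one_mat, auto simp: unitri_iff)

lemmas unitri_inv_closed = group.inv_closed[OF unitri_group]
lemmas unitri_l_inv = group.l_inv[OF unitri_group, simplified]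
lemmas unitri_r_inv = group.r_inv[OF unitri_group, simplified]
lemmas unitri_inv_mult = group.inv_mult_group[OF unitri_group, simplified]
lemmas unitri_inv_inv = group.inv_inv[OF unitri_group]
lemmas unitri_inv_one = monoid.inv_one[OF group.is_monoid[OF unitri_group], simplified]

definition lower_unitri :: "nat \<Rightarrow> 'a::field mat set" where
  "lower_unitri N = {L. transpose_mat L \<in> carrier (unitri N)}"

lemma lower_unitri_iff:
  "L \<in> lower_unitri N \<longleftrightarrow> L \<in> carrier_mat N N \<and> (\<forall>i<N. L $$ (i, i) = 1)
     \<and> (\<forall>i j. i < j \<longrightarrow> j < N \<longrightarrow> L $$ (i, j) = 0)"
  unfolding lower_unitri_def unitri_iff mem_Collect_eq transpose_carrier_mat
  by (rule conj_cong[OF refl]) auto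

lemma lower_unitri_mat: "L \<in> lower_unitri N \<Longrightarrow> L \<in> carrier_mat N N"
  by (simp add: lower_unitri_iff)

lemma lower_unitri_nonzeroD: "L \<in> lower_unitri N \<Longrightarrow> L $$ (i, j) \<noteq> 0 \<Longrightarrow> j < N \<Longrightarrow> j \<le> i"
  by (auto simp: lower_unitri_iff not_le[symmetric])

lemma lower_unitri_transpose:
  "g \<in> carrier (unitri N) \<Longrightarrow> transpose_mat g \<in> lower_unitri N"
  by (simp add: lower_unitri_def)

lemma lower_unitri_times:
  assumes "K \<in> lower_unitri N" "L \<in> lower_unitri N"
  shows "K * L \<in> lower_unitri N"
  using assms unitri_times[of "transpose_mat L" N "transpose_mat K"]
    lower_unitri_mat[OF assms(1)] lower_unitri_mat[OF assms(2)]
  by (simp add: lower_unitri_def transpose_mult[of K N N L N])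

lemma lower_unitri_inverse:
  fixes L :: "'a::{field, finite} mat"
  assumes "L \<in> lower_unitri N"
  obtains M where "M \<in> lower_unitri N" "L * M = 1\<^sub>m N" "M * L = 1\<^sub>m N"
proof -
  let ?g = "transpose_mat L"
  have g: "?g \<in> carrier (unitri N)" using assms by (simp add: lower_unitri_def)
  define h where "h = inv\<^bsub>unitri N\<^esub> ?g"
  have h: "h \<in> carrier (unitri N)" "h * ?g = 1\<^sub>m N" "?g * h = 1\<^sub>m N"
    using unitri_inv_closed[OF g] unitri_l_inv[OF g] unitri_r_inv[OF g] by (auto simp: h_def)
  have c: "L \<in> carrier_mat N N" "h \<in> carrier_mat N N"
    using lower_unitri_mat[OF assms] unitri_mat[OF h(1)] by auto
  have "L * transpose_mat h = transpose_mat (h * ?g)"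
    using c by (simp add: transpose_mult[of h N N "transpose_mat L" N])
  moreover have "transpose_mat h * L = transpose_mat (?g * h)"
    using c by (simp add: transpose_mult[of "transpose_mat L" N N h N])
  ultimately show ?thesis using that[of "transpose_mat h"] h lower_unitri_transpose by auto
qed

text \<open>Congruence modulo lower triangular matrices; it survives multiplication by lower
  triangular matrices on both sides.\<close>

definition upper_eq :: "nat \<Rightarrow> 'a mat \<Rightarrow> 'a mat \<Rightarrow> bool" where
  "upper_eq N X Y \<longleftrightarrow> (\<forall>i j. i < j \<longrightarrow> j < N \<longrightarrow> X $$ (i, j) = Y $$ (i, j))"

lemma upper_eq_sym: "upper_eq N X Y \<Longrightarrow> upper_eq N Y X"
  by (simp add: upper_eq_def)

lemma upper_eq_times_left:
  assumes "upper_eq N X Y" "L \<in> lower_unitri N" "X \<in> carrier_mat N N" "Y \<in> carrier_mat N N"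
  shows "upper_eq N (L * X) (L * Y)"
  unfolding upper_eq_def
proof (intro allI impI)
  fix i j assume ij: "i < j" "j < N"
  have "L $$ (i, k) * X $$ (k, j) = L $$ (i, k) * Y $$ (k, j)" if "k < N" for k
    using assms(1,2) ij that by (cases "k \<le> i") (auto simp: upper_eq_def lower_unitri_iff)
  then have "(\<Sum>k<N. L $$ (i, k) * X $$ (k, j)) = (\<Sum>k<N. L $$ (i, k) * Y $$ (k, j))"
    by (intro sum.cong refl) (simp only: lessThan_iff)
  then show "(L * X) $$ (i, j) = (L * Y) $$ (i, j)"
    using ij assms lower_unitri_mat[OF assms(2)] by (simp add: times_entry[where N = N])
qed

lemma upper_eq_times_right:
  assumes "upper_eq N X Y" "L \<in> lower_unitri N" "X \<in> carrier_mat N N" "Y \<in> carrier_mat N N"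
  shows "upper_eq N (X * L) (Y * L)"
  unfolding upper_eq_def
proof (intro allI impI)
  fix i j assume ij: "i < j" "j < N"
  have "X $$ (i, k) * L $$ (k, j) = Y $$ (i, k) * L $$ (k, j)" if "k < N" for k
    using assms(1,2) ij that by (cases "k < j") (auto simp: upper_eq_def lower_unitri_iff)
  then have "(\<Sum>k<N. X $$ (i, k) * L $$ (k, j)) = (\<Sum>k<N. Y $$ (i, k) * L $$ (k, j))"
    by (intro sum.cong refl) (simp only: lessThan_iff)
  then show "(X * L) $$ (i, j) = (Y * L) $$ (i, j)"
    using ij assms lower_unitri_mat[OF assms(2)] by (simp add: times_entry[where N = N])
qed

section \<open>The group U as an isometry group\<close>

lemma pos_P_Suc:
  "(Suc r, Suc c) \<in> pos_P ty n \<longleftrightarrow>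
     r < c \<and> (r + c + 2 \<le> mdim ty n \<or> ty = Lie_C \<and> r + c + 1 = mdim ty n)"
  by (auto simp: pos_P_def pos_P0_def pos_Gamma_def bar_def)

lemma pos_P0_Suc:
  "(Suc r, Suc c) \<in> pos_P0 ty n \<longleftrightarrow> r < c \<and> r + c + 2 \<le> mdim ty n"
  by (auto simp: pos_P0_def bar_def)

lemma pos_T_Suc: "(Suc r, Suc c) \<in> pos_T N \<longleftrightarrow> r < c \<and> c < N"
  by (auto simp: pos_T_def)

definition form_sign :: "lie_type \<Rightarrow> nat \<Rightarrow> nat \<Rightarrow> 'a::field" where
  "form_sign ty n i = (if ty = Lie_C \<and> n \<le> i then - 1 else 1)"

lemma form_sign_square [simp]: "form_sign ty n i * form_sign ty n i = 1"
  by (simp add: form_sign_def)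

lemma form_sign_left_square [simp]: "form_sign ty n i * (form_sign ty n i * x) = x"
  by (simp flip: mult.assoc)

lemma form_sign_mirror:
  assumes "i < mdim ty n"
  shows "form_sign ty n (mdim ty n - Suc i)
    = (if ty = Lie_C then - form_sign ty n i else form_sign ty n i)"
  using assms by (auto simp: form_sign_def mdim_def)

text \<open>The adjoint of X for the bilinear form preserved by the classical group.\<close>

definition flip :: "lie_type \<Rightarrow> nat \<Rightarrow> 'a::field mat \<Rightarrow> 'a mat" where
  "flip ty n X = (let N = mdim ty n in mat N N
     (\<lambda>(i, j). form_sign ty n i * form_sign ty n j * X $$ (N - Suc j, N - Suc i)))"

lemma flip_carrier [simp]: "flip ty n X \<in> carrier_mat (mdim ty n) (mdim ty n)"
  by (simp add: flip_def Let_def)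

lemma flip_dim [simp]: "dim_row (flip ty n X) = mdim ty n" "dim_col (flip ty n X) = mdim ty n"
  by (simp_all add: flip_def Let_def)

lemma flip_entry:
  "i < mdim ty n \<Longrightarrow> j < mdim ty n \<Longrightarrow> flip ty n X $$ (i, j) =
     form_sign ty n i * form_sign ty n j * X $$ (mdim ty n - Suc j, mdim ty n - Suc i)"
  by (simp add: flip_def Let_def)

lemma flip_flip:
  assumes "X \<in> carrier_mat (mdim ty n) (mdim ty n)"
  shows "flip ty n (flip ty n X) = X"
  using assms by (auto intro!: eq_matI simp: flip_entry form_sign_mirror)

lemma flip_times:
  assumes "X \<in> carrier_mat (mdim ty n) (mdim ty n)" "Y \<in> carrier_mat (mdim ty n) (mdim ty n)"
  shows "flip ty n (X * Y) = flip ty n Y * flip ty n X"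
proof (rule eq_matI, goal_cases)
  case (1 i j)
  then have ij: "i < mdim ty n" "j < mdim ty n" by (auto simp: flip_def Let_def)
  let ?N = "mdim ty n" and ?s = "form_sign ty n"
  have "(flip ty n Y * flip ty n X) $$ (i, j) =
      (\<Sum>k<?N. ?s i * ?s j * (X $$ (?N - Suc j, ?N - Suc k) * Y $$ (?N - Suc k, ?N - Suc i)))"
    using ij by (auto simp: times_entry[where N = ?N] flip_entry mult_ac intro!: sum.cong)
  also have "\<dots> = ?s i * ?s j * (\<Sum>k<?N. X $$ (?N - Suc j, k) * Y $$ (k, ?N - Suc i))"
    unfolding sum_distrib_left
    by (rule sum.nat_diff_reindex[where g = "\<lambda>k. ?s i * ?s j * (X $$ (?N - Suc j, k) * Y $$ (k, ?N - Suc i))"])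
  also have "\<dots> = flip ty n (X * Y) $$ (i, j)"
    using ij assms by (simp add: times_entry[where N = ?N] flip_entry)
  finally show ?case by simp
qed (auto simp: flip_def Let_def)

lemma flip_one: "flip ty n (1\<^sub>m (mdim ty n)) = 1\<^sub>m (mdim ty n)"
  by (auto intro!: eq_matI simp: flip_def Let_def)

lemma flip_minus:
  assumes "X \<in> carrier_mat (mdim ty n) (mdim ty n)" "Y \<in> carrier_mat (mdim ty n) (mdim ty n)"
  shows "flip ty n (X - Y) = flip ty n X - flip ty n Y"
  using assms by (auto intro!: eq_matI simp: flip_def Let_def algebra_simps)

lemma flip_lower_unitri:
  assumes "L \<in> lower_unitri (mdim ty n)"
  shows "flip ty n L \<in> lower_unitri (mdim ty n)"
  using assms by (auto simp: lower_unitri_iff flip_entry)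

text \<open>Since the flip is the adjoint, these matrices preserve the form.\<close>

definition isometries :: "lie_type \<Rightarrow> nat \<Rightarrow> 'a::field mat set" where
  "isometries ty n = {h \<in> carrier (unitri (mdim ty n)). h * flip ty n h = 1\<^sub>m (mdim ty n)}"

lemma matrix_unit_carrier [simp]: "matrix_unit N i j \<in> carrier_mat N N"
  by (simp add: matrix_unit_def)

lemma matrix_unit_dim [simp]:
  "dim_row (matrix_unit N i j) = N" "dim_col (matrix_unit N i j) = N"
  by (simp_all add: matrix_unit_def)

lemma matrix_unit_entry:
  "a < N \<Longrightarrow> b < N \<Longrightarrow> matrix_unit N (Suc r) (Suc c) $$ (a, b) = of_bool (a = r \<and> b = c)"
  by (simp add: matrix_unit_def)

lemma times_matrix_unit_entry:
  fixes h :: "'a::field mat"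
  assumes "h \<in> carrier_mat N N" "a < N" "b < N" "r < N"
  shows "(h * matrix_unit N (Suc r) (Suc c)) $$ (a, b) = h $$ (a, r) * of_bool (b = c)"
proof -
  have "(h * matrix_unit N (Suc r) (Suc c)) $$ (a, b) =
      (\<Sum>k<N. if k = r then h $$ (a, k) * of_bool (b = c) else 0)"
    using assms by (auto simp: times_entry[where N = N] matrix_unit_entry intro!: sum.cong)
  then show ?thesis using assms by (simp add: sum.delta)
qed

lemma flip_matrix_unit:
  assumes "r < mdim ty n" "c < mdim ty n"
  shows "flip ty n (matrix_unit (mdim ty n) (Suc r) (Suc c)) =
    (form_sign ty n r * form_sign ty n c) \<cdot>\<^sub>m
      matrix_unit (mdim ty n) (Suc (mdim ty n - Suc c)) (Suc (mdim ty n - Suc r))"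
proof (rule eq_matI, goal_cases)
  case (1 a b)
  then have ab: "a < mdim ty n" "b < mdim ty n" by auto
  have "mdim ty n - Suc b = r \<longleftrightarrow> b = mdim ty n - Suc r"
    "mdim ty n - Suc a = c \<longleftrightarrow> a = mdim ty n - Suc c" using ab assms by auto
  then show ?case using ab assms
    by (auto simp: flip_entry matrix_unit_entry form_sign_mirror)
qed (auto simp: flip_def Let_def matrix_unit_def)

text \<open>The root element for (i, j) has the entries \<open>- root_low\<close> at (j', i') and \<open>- root_quad\<close> at (i, i'), where i' and j'
  are mirror to i and j. The first is absent if (j', i') = (i, j); the second occurs for the middle column in type B.\<close>

definition root_low :: "lie_type \<Rightarrow> nat \<Rightarrow> nat \<Rightarrow> nat \<Rightarrow> 'a::field \<Rightarrow> 'a" where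
  "root_low ty n r c \<alpha> =
     (if r + c + 1 < mdim ty n then form_sign ty n r * form_sign ty n c * \<alpha> else 0)"

definition root_quad :: "lie_type \<Rightarrow> nat \<Rightarrow> nat \<Rightarrow> 'a::field \<Rightarrow> 'a" where
  "root_quad ty n c \<alpha> = (if ty = Lie_B \<and> c = n then \<alpha>\<^sup>2 / 2 else 0)"

lemma root_elt_carrier [simp]:
  "root_elt ty n i j \<alpha> \<in> carrier_mat (mdim ty n) (mdim ty n)"
  by (cases ty) (auto simp: root_elt_def Let_def intro!: minus_carrier_mat)

lemma root_elt_dim [simp]:
  "dim_row (root_elt ty n i j \<alpha>) = mdim ty n" "dim_col (root_elt ty n i j \<alpha>) = mdim ty n"
  using root_elt_carrier[of ty n i j \<alpha>] by (simp_all only: carrier_matD)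

lemma root_elt_entry:
  assumes "(Suc r, Suc c) \<in> pos_P ty n" "a < mdim ty n" "b < mdim ty n"
  shows "root_elt ty n (Suc r) (Suc c) \<alpha> $$ (a, b) = of_bool (a = b) + \<alpha> * of_bool (a = r \<and> b = c)
    - root_low ty n r c \<alpha> * of_bool (a = mdim ty n - Suc c \<and> b = mdim ty n - Suc r)
    - root_quad ty n c \<alpha> * of_bool (a = r \<and> b = mdim ty n - Suc r)"
proof -
  let ?N = "mdim ty n"
  have rc: "r < c" "r + c + 2 \<le> ?N \<or> ty = Lie_C \<and> r + c + 1 = ?N"
    using assms(1) by (auto simp: pos_P_Suc)
  define r' c' where mirror: "r' = ?N - Suc r" "c' = ?N - Suc c"
  have bar: "bar ty n (Suc r) = Suc r'" "bar ty n (Suc c) = Suc c'"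
    using rc by (auto simp: bar_def mirror)
  have r: "r < n" and high: "ty \<noteq> Lie_C \<or> c < n \<Longrightarrow> r + c + 1 < ?N"
    and mid: "ty = Lie_B \<Longrightarrow> c = n \<Longrightarrow> c' = n"
    using rc by (auto simp: mdim_def mirror split: if_splits)
  have corner: "\<not> r + c + 1 < ?N \<Longrightarrow> r' = c" "r + c + 1 < ?N \<longleftrightarrow> c < r'"
    using rc by (auto simp: mirror)
  have one: "1\<^sub>m N $$ (a, b) = (of_bool (a = b) :: 'a)" if "a < N" "b < N" for N using that by simp
  note defs = one form_sign_def root_low_def root_quad_def matrix_unit_entry
  let ?claim = "root_elt ty n (Suc r) (Suc c) \<alpha> $$ (a, b) = of_bool (a = b) + \<alpha> * of_bool (a = r \<and> b = c)
    - root_low ty n r c \<alpha> * of_bool (a = c' \<and> b = r') - root_quad ty n c \<alpha> * of_bool (a = r \<and> b = r')"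
  show ?thesis
    unfolding mirror[symmetric]
  proof (cases ty)
    case Lie_B
    have low: "r + c + 1 < ?N" using high Lie_B by simp
    show ?claim
    proof (cases "c = n")
      case True
      then show ?thesis using low bar mid Lie_B assms(2,3)
        by (simp add: root_elt_def Let_def defs del: index_one_mat)
    next
      case False
      then show ?thesis using low bar Lie_B assms(2,3)
        by (simp add: root_elt_def Let_def defs del: index_one_mat)
    qed
  next
    case Lie_D
    have low: "r + c + 1 < ?N" using high Lie_D by simp
    then show ?claim
      using bar Lie_D assms(2,3)
      by (simp add: root_elt_def Let_def defs del: index_one_mat)
  next
    case Lie_C
    consider "c < n" | "n \<le> c" "r + c + 1 < ?N" | "n \<le> c" "\<not> r + c + 1 < ?N" by linarith
    then show ?claim
    proof cases
      case 1
      then show ?thesis using Lie_C high r bar assms(2,3)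
        by (simp add: root_elt_def Let_def defs del: index_one_mat)
    next
      case 2
      then have "c < r'" using corner(2) by simp
      then show ?thesis using Lie_C 2 r bar assms(2,3)
        by (simp add: root_elt_def Let_def defs del: index_one_mat)
    next
      case 3
      then have "r' = c" using corner(1) by simp
      then show ?thesis using Lie_C 3 r bar assms(2,3)
        by (simp add: root_elt_def Let_def defs del: index_one_mat)
    qed
  qed
qed

lemma root_elt_eq:
  assumes "(Suc r, Suc c) \<in> pos_P ty n"
  shows "root_elt ty n (Suc r) (Suc c) \<alpha> = 1\<^sub>m (mdim ty n)
    + \<alpha> \<cdot>\<^sub>m matrix_unit (mdim ty n) (Suc r) (Suc c)
    - root_low ty n r c \<alpha> \<cdot>\<^sub>m matrix_unit (mdim ty n) (Suc (mdim ty n - Suc c)) (Suc (mdim ty n - Suc r))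
    - root_quad ty n c \<alpha> \<cdot>\<^sub>m matrix_unit (mdim ty n) (Suc r) (Suc (mdim ty n - Suc r))"
  by (rule eq_matI) (simp_all add: root_elt_entry[OF assms] matrix_unit_entry)

lemma root_elt_unitri:
  assumes "(i, j) \<in> pos_P ty n"
  shows "root_elt ty n i j \<alpha> \<in> carrier (unitri (mdim ty n))"
proof -
  obtain r c where rc: "i = Suc r" "j = Suc c"
    using assms by (cases i; cases j) (auto simp: pos_P_def pos_P0_def pos_Gamma_def split: if_splits)
  have "r < c" "r + c + 1 \<le> mdim ty n" using assms by (auto simp: rc pos_P_Suc)
  then show ?thesis using assms unfolding unitri_iff rc
    by (auto simp: root_elt_entry)
qed

lemma times_root_elt_entry:
  assumes "(Suc r, Suc c) \<in> pos_P ty n" "h \<in> carrier_mat (mdim ty n) (mdim ty n)"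
    "a < mdim ty n" "b < mdim ty n"
  shows "(h * root_elt ty n (Suc r) (Suc c) \<alpha>) $$ (a, b) =
    h $$ (a, b) + \<alpha> * (h $$ (a, r) * of_bool (b = c))
    - root_low ty n r c \<alpha> * (h $$ (a, mdim ty n - Suc c) * of_bool (b = mdim ty n - Suc r))
    - root_quad ty n c \<alpha> * (h $$ (a, r) * of_bool (b = mdim ty n - Suc r))"
proof -
  let ?N = "mdim ty n"
  let ?E = "matrix_unit ?N :: nat \<Rightarrow> nat \<Rightarrow> 'a mat"
  let ?e1 = "?E (Suc r) (Suc c)" and ?e2 = "?E (Suc (?N - Suc c)) (Suc (?N - Suc r))"
    and ?e3 = "?E (Suc r) (Suc (?N - Suc r))"
  have rc: "r < ?N" "?N - Suc c < ?N" using assms(1) by (auto simp: pos_P_Suc)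
  have "h * root_elt ty n (Suc r) (Suc c) \<alpha> = h + \<alpha> \<cdot>\<^sub>m (h * ?e1)
      - root_low ty n r c \<alpha> \<cdot>\<^sub>m (h * ?e2) - root_quad ty n c \<alpha> \<cdot>\<^sub>m (h * ?e3)"
    unfolding root_elt_eq[OF assms(1)] using assms(2)
    by (simp add: mult_minus_distrib_mat[of _ ?N ?N _ ?N] mult_add_distrib_mat[of _ ?N ?N _ ?N]
        mult_smult_distrib[of _ ?N ?N _ ?N] minus_carrier_mat)
  then show ?thesis using assms(2-4) rc
    by (simp add: times_matrix_unit_entry)
qed

lemma flip_root_elt:
  assumes "(Suc r, Suc c) \<in> pos_P ty n"
  shows "flip ty n (root_elt ty n (Suc r) (Suc c) \<alpha>) = root_elt ty n (Suc r) (Suc c) (- \<alpha>)"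
proof (rule eq_matI, goal_cases)
  case (1 a b)
  let ?N = "mdim ty n"
  have ab: "a < ?N" "b < ?N"
    using 1 by simp_all
  have rc: "r < c" "r + c + 2 \<le> ?N \<or> ty = Lie_C \<and> r + c + 1 = ?N"
    using assms by (auto simp: pos_P_Suc)
  have mirror: "?N - Suc b = c \<longleftrightarrow> b = ?N - Suc c" "?N - Suc a = r \<longleftrightarrow> a = ?N - Suc r"
    "?N - Suc a = c \<longleftrightarrow> a = ?N - Suc c" "?N - Suc b = r \<longleftrightarrow> b = ?N - Suc r"
    "?N - Suc a = ?N - Suc b \<longleftrightarrow> a = b" "?N - Suc b = ?N - Suc a \<longleftrightarrow> a = b"
    "?N - Suc b = ?N - Suc c \<longleftrightarrow> b = c"
    "?N - Suc a = ?N - Suc r \<longleftrightarrow> a = r"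
    using ab rc by auto
  have flip: "flip ty n (root_elt ty n (Suc r) (Suc c) \<alpha>) $$ (a, b) =
      form_sign ty n a * form_sign ty n b * (of_bool (a = b) + \<alpha> * of_bool (a = ?N - Suc c \<and> b = ?N - Suc r)
        - root_low ty n r c \<alpha> * of_bool (a = r \<and> b = c)
        - root_quad ty n c \<alpha> * of_bool (a = r \<and> b = ?N - Suc r))"
    using ab by (simp add: flip_entry root_elt_entry[OF assms] mirror conj_commute)
  consider "r + c + 1 < ?N" | "ty = Lie_C" "r + c + 1 = ?N" using rc by force
  then show ?case
  proof cases
    case 1
    have mirror_signs: "form_sign ty n (?N - Suc c) * form_sign ty n (?N - Suc r)
        = (form_sign ty n r * form_sign ty n c :: 'a)"
      using rc by (auto simp: form_sign_mirror)
    have diag: "form_sign ty n a * form_sign ty n b * of_bool (a = b) = (of_bool (a = b) :: 'a)"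
      by simp
    have up: "form_sign ty n a * form_sign ty n b * (root_low ty n r c \<alpha> * of_bool (a = r \<and> b = c))
        = \<alpha> * of_bool (a = r \<and> b = c)"
      using 1 by (auto simp: root_low_def mult_ac)
    have low: "form_sign ty n a * form_sign ty n b * (\<alpha> * of_bool (a = ?N - Suc c \<and> b = ?N - Suc r))
        = root_low ty n r c \<alpha> * of_bool (a = ?N - Suc c \<and> b = ?N - Suc r)"
      using 1 by (auto simp: root_low_def mirror_signs)
    have quad: "form_sign ty n a * form_sign ty n b * (root_quad ty n c \<alpha> * q) = root_quad ty n c \<alpha> * q" for q
      by (simp add: root_quad_def form_sign_def)
    have neg: "root_low ty n r c (- \<alpha>) = - root_low ty n r c \<alpha>" "root_quad ty n c (- \<alpha>) = root_quad ty n c \<alpha>"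
      by (simp_all add: root_low_def root_quad_def)
    show ?thesis
      unfolding flip root_elt_entry[OF assms ab] right_diff_distrib distrib_left diag up low quad neg
      by simp
  next
    case 2
    then have *: "?N - Suc c = r" "?N - Suc r = c" by auto
    have "form_sign ty n r * form_sign ty n c = (- 1 :: 'a)"
      using 2 rc by (auto simp: form_sign_def mdim_def)
    then have up: "form_sign ty n a * form_sign ty n b * (\<alpha> * of_bool (a = r \<and> b = c))
        = - \<alpha> * of_bool (a = r \<and> b = c)"
      by auto
    have diag: "form_sign ty n a * form_sign ty n b * of_bool (a = b) = (of_bool (a = b) :: 'a)"
      by simp
    have zero: "root_low ty n r c \<beta> = 0" "root_quad ty n c \<beta> = 0" for \<beta> :: 'a
      using 2 by (simp_all add: root_low_def root_quad_def)
    show ?thesis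
      unfolding flip root_elt_entry[OF assms ab] right_diff_distrib distrib_left diag zero * up
      by simp
  qed
qed simp_all

lemma root_elt_inverse:
  assumes "(Suc r, Suc c) \<in> pos_P ty n" and two: "(2::'a::field) \<noteq> 0"
  shows "root_elt ty n (Suc r) (Suc c) \<alpha> * root_elt ty n (Suc r) (Suc c) (- \<alpha> :: 'a) = 1\<^sub>m (mdim ty n)"
proof (rule eq_matI, goal_cases)
  case (1 a b)
  let ?N = "mdim ty n"
  have ab: "a < ?N" "b < ?N" using 1 by simp_all
  have rc: "r < c" "r + c + 2 \<le> ?N \<or> ty = Lie_C \<and> r + c + 1 = ?N"
    using assms(1) by (auto simp: pos_P_Suc)
  then have rc': "r < ?N" "?N - Suc c < ?N" "r \<noteq> ?N - Suc r" "?N - Suc c \<noteq> ?N - Suc r" "r \<noteq> c" by auto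
  have mid: "?N - Suc c = c \<longleftrightarrow> ty = Lie_B \<and> c = n"
    using rc by (cases ty) (auto simp: mdim_def; presburger)+
  have low: "root_low ty n r c (- \<alpha>) = - root_low ty n r c \<alpha>"
    and quad: "root_quad ty n c (- \<alpha>) = root_quad ty n c \<alpha>"
    by (simp_all add: root_low_def root_quad_def)
  have cancel: "root_low ty n r c \<alpha> * (\<alpha> * of_bool (ty = Lie_B \<and> c = n)) = 2 * root_quad ty n c \<alpha>"
    using rc two by (auto simp: root_low_def root_quad_def form_sign_def power2_eq_square)
  have col_r: "root_elt ty n (Suc r) (Suc c) \<alpha> $$ (a, r) = of_bool (a = r)"
    using rc' by (simp add: root_elt_entry[OF assms(1) ab(1) rc'(1)])
  have col_c: "root_elt ty n (Suc r) (Suc c) \<alpha> $$ (a, ?N - Suc c) =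
      of_bool (a = ?N - Suc c) + \<alpha> * (of_bool (ty = Lie_B \<and> c = n) * of_bool (a = r))"
    using rc' mid by (auto simp: root_elt_entry[OF assms(1) ab(1) rc'(2)])
  have "(root_elt ty n (Suc r) (Suc c) \<alpha> * root_elt ty n (Suc r) (Suc c) (- \<alpha>)) $$ (a, b) =
      of_bool (a = b) + (root_low ty n r c \<alpha> * (\<alpha> * of_bool (ty = Lie_B \<and> c = n))
        - 2 * root_quad ty n c \<alpha>) * (of_bool (a = r) * of_bool (b = ?N - Suc r))"
    unfolding times_root_elt_entry[OF assms(1) root_elt_carrier ab] low quad col_r col_c
      root_elt_entry[OF assms(1) ab] of_bool_conj
    by (simp add: algebra_simps)
  then show ?case using ab by (simp add: cancel)
qed simp_all


lemma root_elt_isometry: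
  assumes "(i, j) \<in> pos_P ty n" and two: "(2::'a::field) \<noteq> 0"
  shows "(root_elt ty n i j \<alpha> :: 'a mat) \<in> isometries ty n"
proof -
  obtain r c where "i = Suc r" "j = Suc c"
    using assms by (cases i; cases j) (auto simp: pos_P_def pos_P0_def pos_Gamma_def split: if_splits)
  then show ?thesis using assms
    by (simp add: isometries_def root_elt_unitri flip_root_elt root_elt_inverse)
qed

lemma isometries_times:
  assumes "g \<in> isometries ty n" "h \<in> isometries ty n"
  shows "g * h \<in> isometries ty n"
proof -
  let ?N = "mdim ty n"
  have c: "g \<in> carrier_mat ?N ?N" "h \<in> carrier_mat ?N ?N"
    using assms by (auto simp: isometries_def intro: unitri_mat)
  have "h * (flip ty n h * flip ty n g) = h * flip ty n h * flip ty n g"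
    using c by (intro assoc_mult_mat[symmetric]) auto
  also have "\<dots> = flip ty n g" using assms(2) by (simp add: isometries_def)
  finally have "g * h * flip ty n (g * h) = g * flip ty n g"
    using c assoc_mult_mat[OF c mult_carrier_mat[OF flip_carrier flip_carrier]] by (simp add: flip_times)
  then show ?thesis using assms c by (simp add: isometries_def unitri_times)
qed

lemma subgroup_gen_subgroup:
  assumes "S \<subseteq> pos_P ty n"
  shows "subgroup (gen_subgroup ty n S :: 'a::{field, finite} mat set) (unitri (mdim ty n))"
  unfolding gen_subgroup_def
  by (rule group.generate_is_subgroup[OF unitri_group]) (use assms root_elt_unitri in blast)

lemma root_elt_in_gen: "(i, j) \<in> S \<Longrightarrow> root_elt ty n i j \<alpha> \<in> gen_subgroup ty n S"
  unfolding gen_subgroup_def by (rule generate.incl) blast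

lemma subgroup_grpU: "subgroup (grpU ty n :: 'a::{field, finite} mat set) (unitri (mdim ty n))"
  unfolding grpU_def by (rule subgroup_gen_subgroup) simp

lemmas grpU_times = subgroup.m_closed[OF subgroup_grpU, simplified]
lemmas grpU_inv = subgroup.m_inv_closed[OF subgroup_grpU]
lemmas grpU_one = subgroup.one_closed[OF subgroup_grpU, simplified]
lemmas grpU_unitri = subgroup.mem_carrier[OF subgroup_grpU]

text \<open>The inverse of h is its flip, so trivial rows of h, which are trivial rows of the inverse too, become trivial
  columns of h at the mirror indices.\<close>

lemma isometry_trivial_columns:
  assumes h: "h \<in> isometries ty n"
    and rows: "\<And>a b. a < m \<Longrightarrow> b < mdim ty n \<Longrightarrow> h $$ (a, b) = of_bool (a = b)"
    and "a < mdim ty n" "b < mdim ty n" "mdim ty n \<le> b + m"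
  shows "h $$ (a, b) = of_bool (a = b)"
proof -
  let ?N = "mdim ty n" and ?s = "form_sign ty n :: nat \<Rightarrow> 'a"
  let ?a = "?N - Suc b" and ?b = "?N - Suc a"
  have hc: "h \<in> carrier_mat ?N ?N" using h by (auto simp: isometries_def intro: unitri_mat)
  have ab: "?a < m" "?a < ?N" "?b < ?N" using assms(3-5) by auto
  have "of_bool (?a = ?b) = (h * flip ty n h) $$ (?a, ?b)"
    using h ab by (simp add: isometries_def)
  also have "\<dots> = (\<Sum>k<?N. if k = ?a then flip ty n h $$ (k, ?b) else 0)"
    unfolding times_entry[OF hc flip_carrier ab(2,3)]
    by (rule sum.cong) (use rows ab in auto)
  also have "\<dots> = flip ty n h $$ (?a, ?b)" using ab by (simp add: sum.delta)
  also have "\<dots> = ?s ?a * ?s ?b * h $$ (a, b)" using ab assms(3,4) by (simp add: flip_entry)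
  finally have eq: "of_bool (?a = ?b) = ?s ?a * ?s ?b * h $$ (a, b)" .
  have "?s ?a * ?s ?b * of_bool (?a = ?b) = h $$ (a, b)" unfolding eq by (simp add: mult_ac)
  moreover have "?a = ?b \<longleftrightarrow> a = b" using assms(3,4) by auto
  ultimately show ?thesis by auto
qed

text \<open>The entry of h h^* at this position is twice the entry of h.\<close>

lemma isometry_antidiagonal:
  fixes h :: "'a::field mat"
  assumes h: "h \<in> isometries ty n" and "ty \<noteq> Lie_C" and two: "(2::'a) \<noteq> 0"
    and m: "m + m + 1 < mdim ty n"
    and row: "\<And>b. b < mdim ty n \<Longrightarrow> b \<noteq> m \<Longrightarrow> b \<noteq> mdim ty n - Suc m \<Longrightarrow> h $$ (m, b) = 0"
  shows "h $$ (m, mdim ty n - Suc m) = 0"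
proof -
  let ?N = "mdim ty n"
  let ?m = "?N - Suc m"
  have hc: "h \<in> carrier_mat ?N ?N" and diag: "h $$ (m, m) = 1"
    using h m by (auto simp: isometries_def unitri_iff)
  have mm: "m < ?N" "?m < ?N" "m \<noteq> ?m" "?N - Suc ?m = m" using m by auto
  have s: "form_sign ty n x = (1 :: 'a)" for x using assms(2) by (simp add: form_sign_def)
  have "0 = (h * flip ty n h) $$ (m, ?m)"
    using h mm by (simp add: isometries_def)
  also have "\<dots> = (\<Sum>k<?N. (if k = m then h $$ (m, ?m) else 0) + (if k = ?m then h $$ (m, ?m) else 0))"
    unfolding times_entry[OF hc flip_carrier mm(1,2)]
  proof (intro sum.cong refl, goal_cases)
    case (1 k)
    then show ?case using mm diag row[of k] by (auto simp: flip_entry s)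
  qed
  also have "\<dots> = 2 * h $$ (m, ?m)" using mm by (simp add: sum.distrib sum.delta)
  finally show ?thesis using two by simp
qed

text \<open>Row m is cleared from left to right; d counts the columns that remain to be cleared.\<close>

lemma isometry_clear_row:
  fixes h :: "'a::{field, finite} mat"
  assumes two: "(2::'a) \<noteq> 0" and m: "m + m + 1 < mdim ty n"
    and IH: "\<And>h. h \<in> isometries ty n \<Longrightarrow>
      (\<And>a b. a < Suc m \<Longrightarrow> b < mdim ty n \<Longrightarrow> h $$ (a, b) = of_bool (a = b)) \<Longrightarrow> (h :: 'a mat) \<in> grpU ty n"
    and "h \<in> isometries ty n"
    and "\<And>a b. a < m \<Longrightarrow> b < mdim ty n \<Longrightarrow> h $$ (a, b) = of_bool (a = b)"
    and "\<And>b. m < b \<Longrightarrow> b < mdim ty n - d \<Longrightarrow> h $$ (m, b) = 0"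
  shows "h \<in> grpU ty n"
  using assms(4-)
proof (induction d arbitrary: h)
  case (0 h)
  show ?case
  proof (rule IH)
    fix a b assume ab: "a < Suc m" "b < mdim ty n"
    have "h $$ (m, b) = of_bool (m = b)"
      using ab m 0(1,3) by (cases m b rule: linorder_cases) (auto simp: isometries_def unitri_iff)
    then show "h $$ (a, b) = of_bool (a = b)" using ab 0(2) by (cases "a = m") auto
  qed (rule 0)
next
  case (Suc d h)
  let ?N = "mdim ty n"
  define c where "c = ?N - Suc d"
  have hU: "h \<in> carrier (unitri ?N)" and hc: "h \<in> carrier_mat ?N ?N"
    using Suc.prems(1) by (auto simp: isometries_def intro: unitri_mat)
  show ?case
  proof (cases "m < c \<and> d < ?N \<and> h $$ (m, c) \<noteq> 0")
    case False
    show ?thesis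
    proof (rule Suc.IH[OF Suc.prems(1,2)])
      fix b assume b: "m < b" "b < ?N - d"
      then consider "b < ?N - Suc d" | "b = c" "d < ?N" by (force simp: c_def)
      then show "h $$ (m, b) = 0" using Suc.prems(3) False b by cases auto
    qed
  next
    case True
    then have cN: "c < ?N" "m < ?N" "m < c" by (auto simp: c_def)
    have "\<not> ?N \<le> c + m"
      using isometry_trivial_columns[OF Suc.prems(1,2) cN(2,1)] True by auto
    moreover have "ty = Lie_C" if "c + m + 1 = ?N"
    proof (rule ccontr)
      assume "ty \<noteq> Lie_C"
      moreover have c: "c = ?N - Suc m" using that by simp
      moreover have "h $$ (m, b) = 0" if b: "b < ?N" "b \<noteq> m" "b \<noteq> ?N - Suc m" for b
      proof -
        consider "b < m" | "m < b" "b < c" | "?N \<le> b + m" using b c by linarith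
        then show ?thesis
        proof cases
          case 1 then show ?thesis using hU cN by (auto simp: unitri_iff)
        next
          case 2 then show ?thesis using Suc.prems(3) by (simp add: c_def)
        next
          case 3 then show ?thesis
            using isometry_trivial_columns[OF Suc.prems(1,2) cN(2) b(1)] b(2) by auto
        qed
      qed
      ultimately show False
        using isometry_antidiagonal[OF Suc.prems(1) _ two m] True by auto
    qed
    ultimately have P: "(Suc m, Suc c) \<in> pos_P ty n" using cN by (auto simp: pos_P_Suc)
    define x where "x = (root_elt ty n (Suc m) (Suc c) (- h $$ (m, c)) :: 'a mat)"
    have xU: "x \<in> grpU ty n" unfolding x_def grpU_def using P by (rule root_elt_in_gen)
    have entry: "(h * x) $$ (a, b) = h $$ (a, b) - h $$ (m, c) * (h $$ (a, m) * of_bool (b = c))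
        - root_low ty n m c (- h $$ (m, c)) * (h $$ (a, ?N - Suc c) * of_bool (b = ?N - Suc m))
        - root_quad ty n c (- h $$ (m, c)) * (h $$ (a, m) * of_bool (b = ?N - Suc m))"
      if "a < ?N" "b < ?N" for a b
      unfolding x_def times_root_elt_entry[OF P hc that] by simp
    have "c + m < ?N" using \<open>\<not> ?N \<le> c + m\<close> by simp
    have "h * x \<in> grpU ty n"
    proof (rule Suc.IH)
      show "h * x \<in> isometries ty n"
        unfolding x_def by (intro isometries_times Suc.prems root_elt_isometry P two)
    next
      fix a b assume ab: "a < m" "b < ?N"
      have "h $$ (a, m) = 0" "h $$ (a, ?N - Suc c) = 0"
        using ab Suc.prems(2) cN \<open>c + m < ?N\<close> by auto
      then show "(h * x) $$ (a, b) = of_bool (a = b)"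
        using ab Suc.prems(2)[OF ab] cN by (simp add: entry)
    next
      fix b assume b: "m < b" "b < ?N - d"
      have diag: "h $$ (m, m) = 1" using hU cN by (simp add: unitri_iff)
      have "b \<le> c" using b by (auto simp: c_def)
      then have "b < ?N - Suc m \<or> ty = Lie_C \<and> b = c \<and> c = ?N - Suc m"
        using P cN by (auto simp: pos_P_Suc)
      moreover have "root_low ty n m c \<beta> = 0" "root_quad ty n c \<beta> = 0"
        if "ty = Lie_C" "c = ?N - Suc m" for \<beta> :: 'a
        using that cN by (auto simp: root_low_def root_quad_def)
      moreover have "h $$ (m, b) = 0" if "b \<noteq> c"
        using Suc.prems(3)[OF b(1)] that \<open>b \<le> c\<close> by (auto simp: c_def)
      ultimately show "(h * x) $$ (m, b) = 0"
        using diag b cN by (auto simp: entry)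
    qed
    then have "h * x * inv\<^bsub>unitri ?N\<^esub> x \<in> grpU ty n" by (rule grpU_times[OF _ grpU_inv[OF xU]])
    moreover have "h * x * inv\<^bsub>unitri ?N\<^esub> x = h * (x * inv\<^bsub>unitri ?N\<^esub> x)"
      using grpU_unitri[OF xU] hc
      by (intro assoc_mult_mat) (auto intro: unitri_mat unitri_inv_closed)
    then have "h * x * inv\<^bsub>unitri ?N\<^esub> x = h"
      using hc by (simp only: unitri_r_inv[OF grpU_unitri[OF xU]] right_mult_one_mat)
    ultimately show ?thesis by simp
  qed
qed

text \<open>Column operations by root elements clear an isometry row by row; the isometry condition
  takes care of the entries outside P.\<close>

lemma isometries_subset_grpU:
  assumes two: "(2::'a::{field, finite}) \<noteq> 0"
  shows "(isometries ty n :: 'a mat set) \<subseteq> grpU ty n"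
proof -
  let ?N = "mdim ty n"
  have *: "h \<in> grpU ty n" if "h \<in> isometries ty n"
    "\<And>a b. a < ?N - d \<Longrightarrow> b < ?N \<Longrightarrow> h $$ (a, b) = of_bool (a = b)" for h :: "'a mat" and d
    using that
  proof (induction d arbitrary: h)
    case (0 h)
    then have "h = 1\<^sub>m ?N"
      by (intro eq_matI) (auto simp: isometries_def unitri_iff)
    then show ?case using grpU_one by simp
  next
    case (Suc d h)
    define m where "m = ?N - Suc d"
    have hU: "h \<in> carrier (unitri ?N)" using Suc.prems(1) by (simp add: isometries_def)
    show ?case
    proof (cases "d < ?N \<and> m + m + 1 < ?N")
      case True
      then have S: "Suc m = ?N - d" by (auto simp: m_def)
      show ?thesis
        by (rule isometry_clear_row[where m = m and d = "?N"])
          (use True S two Suc m_def in auto)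
    next
      case False
      show ?thesis
      proof (rule Suc.IH[OF Suc.prems(1)])
        fix a b assume ab: "a < ?N - d" "b < ?N"
        show "h $$ (a, b) = of_bool (a = b)"
        proof (cases "a < m")
          case True then show ?thesis using Suc.prems(2) ab by (simp add: m_def)
        next
          case *: False
          then have "a = m" "d < ?N" using ab by (auto simp: m_def)
          then have "b \<le> a \<or> ?N \<le> b + m" using False by auto
          then show ?thesis
          proof
            assume "b \<le> a" then show ?thesis using hU ab by (auto simp: unitri_iff order_le_less)
          next
            assume "?N \<le> b + m"
            then show ?thesis using isometry_trivial_columns[OF Suc.prems(1), of m a b]
              Suc.prems(2) ab by (simp add: m_def)
          qed
        qed
      qed
    qed
  qed
  \<comment> \<open>for d = N no row is assumed trivial\<close>
  show ?thesis by (rule subsetI, rule *[where d = ?N]) auto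
qed

section \<open>Characters, the monomial action and its cocycle\<close>

lemma two_nonzero:
  assumes "odd p" "CARD('a::{field, finite}) = p ^ k"
  shows "(2 :: 'a) \<noteq> 0"
proof
  assume "(2 :: 'a) = 0"
  then have "of_nat 2 = (0 :: 'a)" by simp
  then have "CHAR('a) dvd 2" by (simp only: of_nat_eq_0_iff_char_dvd)
  moreover have "CHAR('a) \<noteq> 1" by simp
  ultimately have "CHAR('a) = 2" using two_is_prime_nat prime_nat_iff by blast
  moreover have "CHAR('a) dvd p ^ k" using CHAR_dvd_CARD[where 'a = 'a] assms(2) by simp
  ultimately show False using assms(1) by simp
qed

lemma mats_on_iff:
  "A \<in> mats_on N S \<longleftrightarrow> A \<in> carrier_mat N N
     \<and> (\<forall>i<N. \<forall>j<N. (Suc i, Suc j) \<notin> S \<longrightarrow> A $$ (i, j) = 0)"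
proof -
  have "supp A \<subseteq> S \<longleftrightarrow> (\<forall>i<N. \<forall>j<N. (Suc i, Suc j) \<notin> S \<longrightarrow> A $$ (i, j) = 0)"
    if "A \<in> carrier_mat N N"
  proof
    assume S: "supp A \<subseteq> S"
    show "\<forall>i<N. \<forall>j<N. (Suc i, Suc j) \<notin> S \<longrightarrow> A $$ (i, j) = 0"
    proof (intro allI impI)
      fix i j assume ij: "i < N" "j < N" "(Suc i, Suc j) \<notin> S"
      then have "(Suc i, Suc j) \<notin> supp A" using S by blast
      then show "A $$ (i, j) = 0" using that ij by (auto simp: supp_def entry_def)
    qed
  next
    assume S: "\<forall>i<N. \<forall>j<N. (Suc i, Suc j) \<notin> S \<longrightarrow> A $$ (i, j) = 0"
    show "supp A \<subseteq> S"
    proof (rule subsetI, clarify)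
      fix i j assume "(i, j) \<in> supp A"
      then show "(i, j) \<in> S" using S[rule_format, of "i - 1" "j - 1"] that
        by (cases i; cases j) (auto simp: supp_def entry_def)
    qed
  qed
  then show ?thesis unfolding mats_on_def by blast
qed

lemma proj_dim [simp]: "dim_row (proj S X) = dim_row X" "dim_col (proj S X) = dim_col X"
  by (simp_all add: proj_def)

lemma proj_carrier: "X \<in> carrier_mat N N \<Longrightarrow> proj S X \<in> carrier_mat N N"
  by (auto simp: proj_def)

lemma proj_entry:
  "X \<in> carrier_mat N N \<Longrightarrow> i < N \<Longrightarrow> j < N \<Longrightarrow>
     proj S X $$ (i, j) = (if (Suc i, Suc j) \<in> S then X $$ (i, j) else 0)"
  by (auto simp: proj_def)

lemma proj_in_mats_on: "X \<in> carrier_mat N N \<Longrightarrow> proj S X \<in> mats_on N S"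
  by (auto simp: mats_on_iff proj_entry proj_carrier)

lemma proj_id: "A \<in> mats_on N S \<Longrightarrow> proj S A = A"
  by (rule eq_matI) (auto simp: mats_on_iff proj_entry)

lemma kappa_sum:
  assumes "A \<in> carrier_mat N N" "B \<in> carrier_mat N N"
  shows "kappa A B = (\<Sum>i<N. \<Sum>j<N. A $$ (i, j) * B $$ (i, j))"
proof -
  have "kappa A B = (\<Sum>j<N. \<Sum>i<N. A $$ (i, j) * B $$ (i, j))"
    using assms by (simp add: kappa_def Let_def times_entry[where N = N])
  also have "\<dots> = (\<Sum>i<N. \<Sum>j<N. A $$ (i, j) * B $$ (i, j))" by (rule sum.swap)
  finally show ?thesis .
qed

lemma kappa_uminus:
  fixes A :: "'a::field mat"
  shows "A \<in> carrier_mat N N \<Longrightarrow> B \<in> carrier_mat N N \<Longrightarrow> kappa (- A) B = - kappa A B"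
  by (simp add: kappa_sum[where N = N] sum_negf)

lemma kappa_times_right:
  fixes A :: "'a::field mat"
  assumes "A \<in> carrier_mat N N" "X \<in> carrier_mat N N" "Y \<in> carrier_mat N N"
  shows "kappa A (X * Y) = kappa (A * transpose_mat Y) X"
proof -
  have "kappa A (X * Y) = (\<Sum>i<N. \<Sum>j<N. \<Sum>k<N. A $$ (i, j) * Y $$ (k, j) * X $$ (i, k))"
    using assms by (simp add: kappa_sum[where N = N] times_entry[where N = N] sum_distrib_left mult_ac)
  also have "\<dots> = (\<Sum>i<N. \<Sum>k<N. \<Sum>j<N. A $$ (i, j) * Y $$ (k, j) * X $$ (i, k))"
    by (rule sum.cong[OF refl], rule sum.swap)
  also have "\<dots> = kappa (A * transpose_mat Y) X"
    using assms by (simp add: kappa_sum[where N = N] times_entry[where N = N] sum_distrib_right)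
  finally show ?thesis .
qed

lemma kappa_proj:
  assumes "A \<in> mats_on N S" "X \<in> carrier_mat N N"
  shows "kappa A (proj S X) = kappa A X"
proof -
  have "A $$ (i, j) * proj S X $$ (i, j) = A $$ (i, j) * X $$ (i, j)" if "i < N" "j < N" for i j
    using assms that by (auto simp: proj_entry mats_on_iff)
  then show ?thesis using assms
    by (simp add: kappa_sum[where N = N] mats_on_iff proj_carrier cong: sum.cong_simp)
qed

lemma pos_P_upper: "(Suc r, Suc c) \<in> pos_P ty n \<Longrightarrow> r < c"
  by (auto simp: pos_P_Suc)

lemma spV_upper: "A \<in> spV ty n \<Longrightarrow> i < mdim ty n \<Longrightarrow> j < mdim ty n \<Longrightarrow> j \<le> i \<Longrightarrow> A $$ (i, j) = 0"
  by (auto simp: spV_def mats_on_iff pos_P_Suc)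

lemma spV_mat: "A \<in> spV ty n \<Longrightarrow> A \<in> carrier_mat (mdim ty n) (mdim ty n)"
  by (simp add: spV_def mats_on_iff)

lemma finite_spV: "finite (spV ty n :: 'a::{zero, finite} mat set)"
  by (rule finite_subset[OF _ finite_carrier_mat]) (auto intro: spV_mat)

text \<open>The diagonal of g contributes the trace of X, and the part of g above the diagonal meets only the entries
  shared by X and Z.\<close>

lemma kappa_unitri:
  fixes X Z g :: "'a::field mat"
  assumes "X \<in> carrier_mat (mdim ty n) (mdim ty n)" "Z \<in> spV ty n"
    "upper_eq (mdim ty n) X Z" "g \<in> carrier (unitri (mdim ty n))"
  shows "kappa X g = kappa X (1\<^sub>m (mdim ty n)) + kappa Z g"
proof -
  let ?N = "mdim ty n"
  have "X $$ (i, j) * g $$ (i, j) = X $$ (i, j) * 1\<^sub>m ?N $$ (i, j) + Z $$ (i, j) * g $$ (i, j)"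
    if "i < ?N" "j < ?N" for i j
    using assms that spV_upper[OF assms(2) that]
    by (cases i j rule: linorder_cases) (auto simp: unitri_iff upper_eq_def)
  then have "(\<Sum>i<?N. \<Sum>j<?N. X $$ (i, j) * g $$ (i, j)) =
      (\<Sum>i<?N. \<Sum>j<?N. X $$ (i, j) * 1\<^sub>m ?N $$ (i, j) + Z $$ (i, j) * g $$ (i, j))"
    by (intro sum.cong refl) (simp only: lessThan_iff)
  then show ?thesis using assms
    by (simp only: kappa_sum[where N = ?N] one_carrier_mat spV_mat unitri_mat sum.distrib)
qed

lemma proj_upper_cong:
  assumes "upper_eq (mdim ty n) X Y" "X \<in> carrier_mat (mdim ty n) (mdim ty n)"
    "Y \<in> carrier_mat (mdim ty n) (mdim ty n)"
  shows "proj (pos_P ty n) X = proj (pos_P ty n) Y"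
  by (rule eq_matI) (use assms in \<open>auto simp: proj_entry upper_eq_def dest: pos_P_upper\<close>)

lemma proj_T_cong:
  assumes "upper_eq N X Y" "X \<in> carrier_mat N N" "Y \<in> carrier_mat N N"
  shows "proj (pos_T N) X = proj (pos_T N) Y"
  by (rule eq_matI) (use assms in \<open>auto simp: proj_entry upper_eq_def pos_T_Suc\<close>)

text \<open>Each row of P is an initial segment of the strictly upper part of that row.  Column operations
  going from right to left therefore do not move a matrix of V out of V, apart from its lower
  triangular part.\<close>

lemma spV_times_lower:
  fixes A L :: "'a::field mat"
  assumes "A \<in> spV ty n" "L \<in> lower_unitri (mdim ty n)"
  shows "upper_eq (mdim ty n) (A * L) (proj (pos_P ty n) (A * L))"
  unfolding upper_eq_def
proof (intro allI impI)
  let ?N = "mdim ty n"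
  fix i j assume ij: "i < j" "j < ?N"
  have c: "A \<in> carrier_mat ?N ?N" "L \<in> carrier_mat ?N ?N"
    using assms by (auto intro: spV_mat lower_unitri_mat)
  have zero: "A $$ (i, k) * L $$ (k, j) = 0" if "k < ?N" "(Suc i, Suc j) \<notin> pos_P ty n" for k
  proof (cases "k < j")
    case False
    then have "(Suc i, Suc k) \<notin> pos_P ty n" using that ij by (auto simp: pos_P_Suc)
    then show ?thesis using assms(1) that ij by (auto simp: spV_def mats_on_iff)
  qed (use assms(2) ij in \<open>simp add: lower_unitri_iff\<close>)
  have "(\<Sum>k<?N. A $$ (i, k) * L $$ (k, j)) = 0" if "(Suc i, Suc j) \<notin> pos_P ty n"
    by (intro sum.neutral ballI, rule zero) (use that in simp_all)
  then show "(A * L) $$ (i, j) = proj (pos_P ty n) (A * L) $$ (i, j)"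
    using ij c by (simp add: proj_entry[OF mult_carrier_mat[OF c]] times_entry[where N = ?N])
qed

text \<open>Oddness of the characteristic makes the Cayley transform available; the nontrivial additive character makes
  matrices in V distinguishable by their characters.\<close>

locale orbit_modules =
  fixes ty :: lie_type and n :: nat and \<theta> :: "'a::{field, finite} \<Rightarrow> complex"
  assumes theta: "nontrivial_add_char \<theta>" and two: "(2 :: 'a) \<noteq> 0"
begin

abbreviation "N \<equiv> mdim ty n"
abbreviation "P \<equiv> pos_P ty n"
abbreviation "V \<equiv> spV ty n :: 'a mat set"
abbreviation "U \<equiv> grpU ty n :: 'a mat set"
abbreviation "UT \<equiv> carrier (unitri N) :: 'a mat set"
abbreviation minv :: "'a mat \<Rightarrow> 'a mat" where "minv g \<equiv> inv\<^bsub>unitri N\<^esub> g"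

lemma theta_add: "\<theta> (x + y) = \<theta> x * \<theta> y" and theta_nonzero [simp]: "\<theta> x \<noteq> 0"
  using theta by (auto simp: nontrivial_add_char_def)

lemma theta_diff: "\<theta> (x - y) = \<theta> x * \<theta> (- y)"
  using theta_add[of x "- y"] by simp

lemma theta_zero: "\<theta> 0 = 1"
  using theta_add[of 0 0] theta_nonzero[of 0] by simp

lemma theta_uminus: "\<theta> (- x) = inverse (\<theta> x)"
  using theta_add[of x "- x"] by (simp add: theta_zero field_simps)

lemma theta_trivial_imp_zero:
  assumes "\<And>t. \<theta> (t * a) = 1" shows "a = 0"
proof (rule ccontr)
  assume "a \<noteq> 0"
  then have "\<theta> x = 1" for x using assms[of "x / a"] by simp
  then show False using theta by (auto simp: nontrivial_add_char_def)
qed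

lemma cnj_theta: "cnj (\<theta> x) = inverse (\<theta> x)"
proof -
  have "\<theta> (of_nat m * x) = \<theta> x ^ m" for m
    by (induction m) (simp_all add: theta_zero theta_add distrib_right)
  moreover have "of_nat CARD('a) = (0 :: 'a)"
    using CHAR_dvd_CARD[where 'a = 'a] by (simp only: of_nat_eq_0_iff_char_dvd)
  ultimately have "\<theta> x ^ CARD('a) = 1" by (metis mult_zero_left theta_zero)
  then have "norm (\<theta> x) = 1" using power_eq_1_iff by fastforce
  then have "\<theta> x * cnj (\<theta> x) = 1" by (simp flip: complex_norm_square)
  then show ?thesis by (rule inverse_unique[symmetric])
qed

lemma minv_closed: "g \<in> UT \<Longrightarrow> minv g \<in> UT"
  by (rule unitri_inv_closed)

lemma inv_transp_lower: "g \<in> UT \<Longrightarrow> inv_transp N g \<in> lower_unitri N"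
  by (simp add: inv_transp_def lower_unitri_transpose minv_closed)

lemma inv_transp_mat: "g \<in> UT \<Longrightarrow> inv_transp N g \<in> carrier_mat N N"
  by (intro lower_unitri_mat inv_transp_lower)

lemma inv_transp_times:
  assumes "g \<in> UT" "h \<in> UT"
  shows "inv_transp N (g * h) = inv_transp N g * inv_transp N h"
  using assms unitri_mat[OF minv_closed[OF assms(1)]] unitri_mat[OF minv_closed[OF assms(2)]]
  by (simp add: inv_transp_def unitri_inv_mult transpose_mult[where n = N])

lemma lin_char_inj:
  assumes "A \<in> mats_on M S" "B \<in> mats_on M S" "lin_char \<theta> M S A = lin_char \<theta> M S B"
  shows "A = B"
proof (rule eq_matI)
  fix i j assume "i < dim_row B" "j < dim_col B"
  then have ij: "i < M" "j < M" using assms(2) by (auto simp: mats_on_iff)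
  show "A $$ (i, j) = B $$ (i, j)"
  proof (cases "(Suc i, Suc j) \<in> S")
    case True
    have "\<theta> (t * (A $$ (i, j) - B $$ (i, j))) = 1" for t
    proof -
      define E where "E = mat M M (\<lambda>p. if p = (i, j) then - t else 0)"
      have Ec: "E \<in> carrier_mat M M" by (simp add: E_def)
      have E: "E \<in> mats_on M S" using True by (auto simp: mats_on_iff E_def)
      have kappa: "kappa (- X) E = t * X $$ (i, j)" if "X \<in> mats_on M S" for X
      proof -
        have X: "X \<in> carrier_mat M M" using that by (simp add: mats_on_iff)
        have "kappa X E = (\<Sum>r<M. \<Sum>c<M. if c = j then (if r = i then - t * X $$ (r, c) else 0) else 0)"
          unfolding kappa_sum[OF X Ec] by (intro sum.cong refl) (auto simp: E_def)
        then have "kappa X E = - t * X $$ (i, j)" using ij by (simp add: sum.delta)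
        then show ?thesis by (simp add: kappa_uminus[OF X Ec])
      qed
      have "lin_char \<theta> M S A E = lin_char \<theta> M S B E" by (simp add: assms(3))
      then have "\<theta> (t * A $$ (i, j)) = \<theta> (t * B $$ (i, j))"
        using E kappa[OF assms(1)] kappa[OF assms(2)] by (simp add: lin_char_def)
      then show ?thesis
        using theta_add[of "t * B $$ (i, j)" "t * (A $$ (i, j) - B $$ (i, j))"]
        by (simp add: algebra_simps)
    qed
    then show ?thesis using theta_trivial_imp_zero[of "A $$ (i, j) - B $$ (i, j)"] by simp
  next
    case False
    then show ?thesis using assms(1,2) ij by (auto simp: mats_on_iff)
  qed
qed (use assms(1,2) in \<open>auto simp: mats_on_iff\<close>)

lemma charV_eq_iff: "A \<in> V \<Longrightarrow> B \<in> V \<Longrightarrow> charV \<theta> ty n A = charV \<theta> ty n B \<longleftrightarrow> A = B"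
  using lin_char_inj unfolding spV_def by blast

text \<open>The permutation part of the right action, on matrices instead of their characters.\<close>

definition dot :: "'a mat \<Rightarrow> 'a mat \<Rightarrow> 'a mat" where
  "dot A g = proj P (A * inv_transp N g)"

lemma charV_right_dot: "charV_right \<theta> ty n A g = charV \<theta> ty n (dot A g)"
  by (simp add: char_dot_right_def dot_def)

lemma dot_closed:
  assumes "A \<in> V" "g \<in> UT" shows "dot A g \<in> V"
  unfolding spV_def dot_def
  by (rule proj_in_mats_on) (use assms in \<open>auto intro: spV_mat inv_transp_mat mult_carrier_mat\<close>)

lemma dot_upper_eq:
  assumes "A \<in> V" "g \<in> UT"
  shows "upper_eq N (A * inv_transp N g) (dot A g)"
  unfolding dot_def using assms inv_transp_lower by (intro spV_times_lower)

lemma dot_times: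
  assumes "A \<in> V" "g \<in> UT" "h \<in> UT"
  shows "dot A (g * h) = dot (dot A g) h"
proof -
  let ?g = "inv_transp N g" and ?h = "inv_transp N h"
  have c: "A \<in> carrier_mat N N" "?g \<in> carrier_mat N N" "?h \<in> carrier_mat N N"
    "dot A g \<in> carrier_mat N N"
    using assms by (auto intro: spV_mat inv_transp_mat dot_closed)
  have "dot A (g * h) = proj P (A * ?g * ?h)"
    using c assms by (simp add: dot_def inv_transp_times assoc_mult_mat[where n\<^sub>4 = N])
  also have "\<dots> = proj P (dot A g * ?h)"
    by (rule proj_upper_cong[OF upper_eq_times_right[OF dot_upper_eq]])
      (use assms c in \<open>auto intro: inv_transp_lower mult_carrier_mat\<close>)
  finally show ?thesis by (simp add: dot_def)
qed

lemma dot_one: "A \<in> V \<Longrightarrow> dot A (1\<^sub>m N) = A"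
  using proj_id[of A N P] spV_mat[of A ty n]
  by (simp add: dot_def inv_transp_def unitri_inv_one spV_def)

lemma dot_inv:
  assumes "A \<in> V" "g \<in> UT"
  shows "dot (dot A g) (minv g) = A" "dot (dot A (minv g)) g = A"
  using assms by (simp_all flip: dot_times add: minv_closed unitri_r_inv unitri_l_inv dot_one)

text \<open>The scalar part of the right action: [A] g is \<open>co A g\<close> times [A].g. On the stabiliser of [A] this is
  Psi_A.\<close>

definition co :: "'a mat \<Rightarrow> 'a mat \<Rightarrow> complex" where
  "co A g = \<theta> (- kappa A (minv g))"

lemma co_nonzero [simp]: "co A g \<noteq> 0"
  by (simp add: co_def)

text \<open>This cocycle identity turns the formula for [A] g into a right action. The inverse of g h is a product, and
  moving its right factor to the other side of the trace form turns A into A g^-t, whose trace is the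
  value at g.\<close>

lemma co_times:
  assumes "A \<in> V" "g \<in> UT" "h \<in> UT"
  shows "co A (g * h) = co A g * co (dot A g) h"
proof -
  let ?g = "minv g" and ?h = "minv h"
  have c: "A \<in> carrier_mat N N" "?g \<in> carrier_mat N N" "?h \<in> carrier_mat N N"
    using assms by (auto intro: spV_mat unitri_mat minv_closed)
  let ?X = "A * transpose_mat ?g"
  have "kappa A (minv (g * h)) = kappa ?X ?h"
    using assms c by (simp add: unitri_inv_mult kappa_times_right[where N = N])
  also have "\<dots> = kappa ?X (1\<^sub>m N) + kappa (dot A g) ?h"
    using assms c dot_upper_eq[OF assms(1,2)]
    by (intro kappa_unitri) (auto simp: inv_transp_def minv_closed intro: dot_closed)
  also have "kappa ?X (1\<^sub>m N) = kappa A ?g"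
    using c kappa_times_right[OF c(1) one_carrier_mat c(2)] by simp
  finally show ?thesis by (simp add: co_def theta_diff)
qed

lemma co_one: "A \<in> V \<Longrightarrow> co A (1\<^sub>m N) = 1"
  using co_times[of A "1\<^sub>m N" "1\<^sub>m N"] by (simp add: dot_one unitri_iff)

lemma theta_kappa:
  assumes "A \<in> V" "g \<in> UT"
  shows "\<theta> (kappa (- A) (proj P (minv g))) = co A g"
  using assms kappa_proj[of A N P "minv g"] unitri_mat[OF minv_closed[OF assms(2)]] spV_mat[OF assms(1)]
  by (simp add: kappa_uminus[where N = N] proj_carrier spV_def co_def)

lemma act_single:
  assumes "A \<in> V" "g \<in> UT"
  shows "act \<theta> ty n (Poly_Mapping.single (charV \<theta> ty n A) z) g
    = Poly_Mapping.single (charV \<theta> ty n (dot A g)) (z * co A g)"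
proof -
  have "act \<theta> ty n (Poly_Mapping.single (charV \<theta> ty n A) z) g =
      (\<Sum>B\<in>V. if B = A then Poly_Mapping.single (charV \<theta> ty n (dot A g)) (z * co A g) else 0)"
    unfolding act_def
    by (intro sum.cong refl)
      (auto simp: charV_right_dot lookup_single when_def charV_eq_iff assms theta_kappa)
  then show ?thesis using assms(1) by (simp add: finite_spV)
qed

lemma act_add: "act \<theta> ty n (v + w) g = act \<theta> ty n v g + act \<theta> ty n w g"
  by (simp add: act_def lookup_add distrib_right single_add sum.distrib)

lemma act_zero: "act \<theta> ty n 0 g = 0"
  by (simp add: act_def)

end

section \<open>Linearisation of the stabiliser condition\<close>

text \<open>Induction on the set of functionals: on the kernel of one of them the others suffice, and a vector outside this
  kernel fixes the missing coefficient. Vectors enter only through the operation x + a y, written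
  \<open>comb a x y\<close>.\<close>

lemma functional_combination:
  fixes \<phi> :: "'s \<Rightarrow> 'v \<Rightarrow> 'a::field"
  assumes "finite F"
    and "\<And>a x y. x \<in> W \<Longrightarrow> y \<in> W \<Longrightarrow> comb a x y \<in> W"
    and "\<And>s a x y. s \<in> F \<Longrightarrow> x \<in> W \<Longrightarrow> y \<in> W \<Longrightarrow> \<phi> s (comb a x y) = \<phi> s x + a * \<phi> s y"
    and "\<And>a x y. x \<in> W \<Longrightarrow> y \<in> W \<Longrightarrow> f (comb a x y) = f x + a * f y"
    and "\<And>x. x \<in> W \<Longrightarrow> (\<And>s. s \<in> F \<Longrightarrow> \<phi> s x = 0) \<Longrightarrow> f x = 0"
  shows "\<exists>c. \<forall>x\<in>W. f x = (\<Sum>s\<in>F. c s * \<phi> s x)"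
  using assms
proof (induction F arbitrary: W rule: finite_induct)
  case empty
  then show ?case by simp
next
  case (insert s F)
  let ?W = "{x \<in> W. \<phi> s x = 0}"
  have "\<exists>c. \<forall>x\<in>?W. f x = (\<Sum>s\<in>F. c s * \<phi> s x)"
  proof (rule insert.IH)
    fix x assume "x \<in> ?W" "\<And>s'. s' \<in> F \<Longrightarrow> \<phi> s' x = 0"
    then show "f x = 0" using insert.prems(4)[of x] by blast
  qed (use insert.prems(1-3) in simp_all)
  then obtain c where c: "\<And>x. x \<in> ?W \<Longrightarrow> f x = (\<Sum>s\<in>F. c s * \<phi> s x)" by blast
  define g where "g = (\<lambda>x. f x - (\<Sum>s\<in>F. c s * \<phi> s x))"
  have g_lin: "g (comb a x y) = g x + a * g y" if "x \<in> W" "y \<in> W" for a x y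
  proof -
    have "(\<Sum>s\<in>F. c s * \<phi> s (comb a x y)) = (\<Sum>s\<in>F. c s * \<phi> s x + a * (c s * \<phi> s y))"
      using insert.prems(2) that by (intro sum.cong refl) (simp add: algebra_simps)
    then show ?thesis using insert.prems(3)[OF that]
      by (simp add: g_def sum.distrib sum_distrib_left algebra_simps)
  qed
  show ?case
  proof (cases "\<forall>x\<in>W. \<phi> s x = 0")
    case True
    have "f x = (\<Sum>s'\<in>insert s F. (c(s := 0)) s' * \<phi> s' x)" if "x \<in> W" for x
      using True c that insert.hyps by (auto intro!: sum.cong)
    then show ?thesis by blast
  next
    case False
    then obtain w where w: "w \<in> W" "\<phi> s w \<noteq> 0" by blast
    have "f x = (\<Sum>s'\<in>insert s F. (c(s := g w / \<phi> s w)) s' * \<phi> s' x)" if "x \<in> W" for x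
    proof -
      let ?y = "comb (- (\<phi> s x / \<phi> s w)) x w"
      have "?y \<in> ?W" using insert.prems(1,2) that w by simp
      then have "g ?y = 0" using c unfolding g_def by simp
      then have "g x = g w / \<phi> s w * \<phi> s x" using g_lin[OF that w(1)] by simp
      moreover have "(\<Sum>s'\<in>F. (c(s := g w / \<phi> s w)) s' * \<phi> s' x) = (\<Sum>s'\<in>F. c s' * \<phi> s' x)"
        using insert.hyps by (intro sum.cong) auto
      ultimately show ?thesis using insert.hyps by (simp add: g_def algebra_simps)
    qed
    then show ?thesis by blast
  qed
qed

lemma flip_unitri:
  assumes "g \<in> carrier (unitri (mdim ty n))"
  shows "flip ty n g \<in> carrier (unitri (mdim ty n))"
  using assms by (auto simp: unitri_iff flip_entry)

text \<open>The Lie algebra of the group of isometries.\<close>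

definition skew_upper :: "lie_type \<Rightarrow> nat \<Rightarrow> 'a::field mat set" where
  "skew_upper ty n = {X \<in> carrier_mat (mdim ty n) (mdim ty n).
     (\<forall>i<mdim ty n. \<forall>j\<le>i. X $$ (i, j) = 0) \<and> flip ty n X = - X}"

lemma skew_upper_comb:
  assumes "X \<in> skew_upper ty n" "Y \<in> skew_upper ty n"
  shows "X + a \<cdot>\<^sub>m Y \<in> skew_upper ty n"
proof -
  let ?N = "mdim ty n" and ?s = "form_sign ty n :: nat \<Rightarrow> 'a"
  have c: "X \<in> carrier_mat ?N ?N" "Y \<in> carrier_mat ?N ?N" using assms by (auto simp: skew_upper_def)
  have flip: "?s i * ?s j * Z $$ (?N - Suc j, ?N - Suc i) = - Z $$ (i, j)"
    if "Z \<in> skew_upper ty n" "i < ?N" "j < ?N" for Z i j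
  proof -
    have "flip ty n Z $$ (i, j) = (- Z) $$ (i, j)" using that by (simp add: skew_upper_def)
    then show ?thesis using that by (auto simp: flip_entry skew_upper_def)
  qed
  have "flip ty n (X + a \<cdot>\<^sub>m Y) = - (X + a \<cdot>\<^sub>m Y)"
  proof (rule eq_matI, goal_cases)
    case (1 i j)
    then have ij: "i < ?N" "j < ?N" using c by auto
    have "flip ty n (X + a \<cdot>\<^sub>m Y) $$ (i, j) =
        ?s i * ?s j * X $$ (?N - Suc j, ?N - Suc i) + a * (?s i * ?s j * Y $$ (?N - Suc j, ?N - Suc i))"
      using ij c by (simp add: flip_entry algebra_simps)
    also have "\<dots> = (- (X + a \<cdot>\<^sub>m Y)) $$ (i, j)"
      using ij c by (simp add: flip[OF assms(1) ij] flip[OF assms(2) ij])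
    finally show ?case .
  qed (use c in auto)
  then show ?thesis using assms by (auto simp: skew_upper_def)
qed

lemma zero_skew_upper: "0\<^sub>m (mdim ty n) (mdim ty n) \<in> skew_upper ty n"
proof -
  have "flip ty n (0\<^sub>m (mdim ty n) (mdim ty n)) = - 0\<^sub>m (mdim ty n) (mdim ty n)"
    by (rule eq_matI) (auto simp: flip_entry)
  then show ?thesis by (auto simp: skew_upper_def)
qed

lemma skew_upper_smult: "X \<in> skew_upper ty n \<Longrightarrow> a \<cdot>\<^sub>m X \<in> skew_upper ty n"
  using skew_upper_comb[OF zero_skew_upper, of X ty n a]
  by (auto simp: skew_upper_def)

text \<open>Take the Cayley transform (1 + X) (1 - X)^-1 for 1 + Y. The adjoint exchanges the commuting factors
  1 + X and 1 - X, hence inverts their quotient. The recursion for Y transfers linear conditions from X to Y.\<close>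

lemma cayley:
  fixes X :: "'a::{field, finite} mat"
  assumes X: "X \<in> skew_upper ty n"
  obtains Y where "Y \<in> carrier_mat (mdim ty n) (mdim ty n)"
    "1\<^sub>m (mdim ty n) + Y \<in> isometries ty n" "Y = 2 \<cdot>\<^sub>m X + Y * X"
proof -
  let ?N = "mdim ty n" and ?G = "unitri (mdim ty n) :: 'a mat monoid"
  interpret G: group ?G by (rule unitri_group)
  have c: "X \<in> carrier_mat ?N ?N" and flip: "flip ty n X = - X" using X by (auto simp: skew_upper_def)
  define a b where "a = 1\<^sub>m ?N - X" and "b = 1\<^sub>m ?N + X"
  have ab: "a \<in> carrier ?G" "b \<in> carrier ?G"
    using X by (auto simp: a_def b_def unitri_iff skew_upper_def)
  have abc: "a \<in> carrier_mat ?N ?N" "b \<in> carrier_mat ?N ?N" using ab by (auto intro: unitri_mat)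
  have flip_ab: "flip ty n a = b" "flip ty n b = a"
  proof -
    have "flip ty n a = 1\<^sub>m ?N - - X" unfolding a_def using c by (simp add: flip_minus flip_one flip)
    also have "\<dots> = b" unfolding b_def by (rule eq_matI) (use c in auto)
    finally show "flip ty n a = b" .
    then show "flip ty n b = a" using flip_flip[OF abc(1)] by simp
  qed
  have comm: "a * b = b * a"
    unfolding a_def b_def using c
    by (simp add: add_mult_distrib_mat[of _ ?N ?N _ _ ?N] minus_mult_distrib_mat[of _ ?N ?N _ _ ?N]
        mult_add_distrib_mat[of _ ?N ?N _ ?N] mult_minus_distrib_mat[of _ ?N ?N _ ?N] minus_carrier_mat)
      (rule eq_matI, auto)
  define h where "h = b * inv\<^bsub>?G\<^esub> a"
  have hG: "h \<in> carrier ?G" using ab unfolding h_def by (intro unitri_times G.inv_closed)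
  have hc: "h \<in> carrier_mat ?N ?N" by (rule unitri_mat[OF hG])
  have ic: "inv\<^bsub>?G\<^esub> a \<in> carrier_mat ?N ?N" using ab by (intro unitri_mat G.inv_closed)
  have "flip ty n (inv\<^bsub>?G\<^esub> a) * b = flip ty n (a * inv\<^bsub>?G\<^esub> a)"
    using abc ic by (simp add: flip_times flip_ab)
  also have "\<dots> = 1\<^sub>m ?N" using unitri_r_inv[OF ab(1)] by (simp add: flip_one)
  finally have "inv\<^bsub>?G\<^esub> b = flip ty n (inv\<^bsub>?G\<^esub> a)"
    using ab by (intro G.inv_equality) (auto intro: flip_unitri)
  then have "flip ty n h = inv\<^bsub>?G\<^esub> b * a"
    using abc ic by (simp add: h_def flip_times flip_ab)
  then have "h * flip ty n h = b \<otimes>\<^bsub>?G\<^esub> inv\<^bsub>?G\<^esub> a \<otimes>\<^bsub>?G\<^esub> (inv\<^bsub>?G\<^esub> b \<otimes>\<^bsub>?G\<^esub> a)" by (simp add: h_def)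
  also have "\<dots> = b \<otimes>\<^bsub>?G\<^esub> inv\<^bsub>?G\<^esub> (b \<otimes>\<^bsub>?G\<^esub> a) \<otimes>\<^bsub>?G\<^esub> a"
    using ab by (simp only: G.inv_mult_group G.m_assoc G.inv_closed G.m_closed)
  also have "\<dots> = b \<otimes>\<^bsub>?G\<^esub> inv\<^bsub>?G\<^esub> (a \<otimes>\<^bsub>?G\<^esub> b) \<otimes>\<^bsub>?G\<^esub> a" using comm by simp
  also have "\<dots> = \<one>\<^bsub>?G\<^esub>"
  proof -
    have "b \<otimes>\<^bsub>?G\<^esub> inv\<^bsub>?G\<^esub> (a \<otimes>\<^bsub>?G\<^esub> b) \<otimes>\<^bsub>?G\<^esub> a
        = (b \<otimes>\<^bsub>?G\<^esub> inv\<^bsub>?G\<^esub> b) \<otimes>\<^bsub>?G\<^esub> (inv\<^bsub>?G\<^esub> a \<otimes>\<^bsub>?G\<^esub> a)"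
      using ab by (simp only: G.inv_mult_group G.m_assoc G.inv_closed G.m_closed)
    then show ?thesis using ab by (simp only: G.r_inv G.l_inv G.one_closed G.l_one)
  qed
  finally have iso: "h \<in> isometries ty n" using hG by (simp add: isometries_def)
  have "h * a = b * (inv\<^bsub>?G\<^esub> a * a)"
    unfolding h_def using abc ic by (intro assoc_mult_mat) auto
  also have "\<dots> = b" using abc unitri_l_inv[OF ab(1)] by simp
  finally have "h - h * X = 1\<^sub>m ?N + X"
    unfolding a_def b_def using hc c by (simp add: mult_minus_distrib_mat[of _ ?N ?N _ ?N])
  then have e: "h $$ (i, j) - (h * X) $$ (i, j) = (1\<^sub>m ?N + X) $$ (i, j)" if "i < ?N" "j < ?N" for i j
    using that hc c by (simp flip: index_minus_mat(1))
  define Y where "Y = h - 1\<^sub>m ?N"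
  have Yc: "Y \<in> carrier_mat ?N ?N" using hc by (simp add: Y_def minus_carrier_mat)
  have YX: "Y * X = h * X - X"
    unfolding Y_def using hc c by (simp add: minus_mult_distrib_mat[of _ ?N ?N _ _ ?N])
  have "Y = 2 \<cdot>\<^sub>m X + Y * X"
    unfolding YX
  proof (rule eq_matI, goal_cases)
    case (1 i j)
    then have ij: "i < ?N" "j < ?N" using hc c by auto
    then show ?case using e[OF ij] hc c unfolding Y_def by (simp add: algebra_simps)
  qed (use Yc hc c in auto)
  moreover have "1\<^sub>m ?N + Y = h" unfolding Y_def by (rule eq_matI) (use hc in auto)
  ultimately show ?thesis using that[OF Yc] iso by simp
qed

context orbit_modules
begin

text \<open>In matrix terms: Psi_A and Psi_B coincide on the common stabiliser of [A] and [B].\<close>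

definition agree :: "'a mat \<Rightarrow> 'a mat \<Rightarrow> bool" where
  "agree A B \<longleftrightarrow> (\<forall>u\<in>U. dot A u = A \<longrightarrow> dot B u = B \<longrightarrow> co A u = co B u)"

lemma kappa_one:
  fixes X :: "'a mat"
  assumes "X \<in> carrier_mat N N"
  shows "kappa X (1\<^sub>m N) = (\<Sum>i<N. X $$ (i, i))"
proof -
  have "kappa X (1\<^sub>m N) = (\<Sum>i<N. \<Sum>j<N. if j = i then X $$ (i, j) else 0)"
    unfolding kappa_sum[OF assms one_carrier_mat] by (intro sum.cong refl) auto
  then show ?thesis by (simp add: sum.delta)
qed

text \<open>By the recursion for Y, A Y^t is 2 A X^t + (A X^t) Y^t. The last term is a lower times a strictly lower triangular
  matrix, so on and above the diagonal Y may be replaced by 2 X.\<close>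

lemma cayley_stabiliser:
  assumes A: "A \<in> V" and X: "X \<in> skew_upper ty n"
    and AX: "\<And>i j. i < j \<Longrightarrow> j < N \<Longrightarrow> (A * transpose_mat X) $$ (i, j) = 0"
    and Y: "Y \<in> carrier_mat N N" "1\<^sub>m N + Y \<in> UT" "Y = 2 \<cdot>\<^sub>m X + Y * X"
  shows "dot A (minv (1\<^sub>m N + Y)) = A"
    and "co A (minv (1\<^sub>m N + Y)) = \<theta> (- (2 * kappa A X))"
proof -
  have c: "A \<in> carrier_mat N N" "X \<in> carrier_mat N N"
    using spV_mat[OF A] X by (auto simp: skew_upper_def)
  have Y_upper: "Y $$ (i, j) = 0" if "j \<le> i" "i < N" for i j
  proof -
    have "(1\<^sub>m N + Y) $$ (i, j) = of_bool (i = j)"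
      using Y(2) that by (cases "i = j") (auto simp: unitri_iff)
    then show ?thesis using Y(1) that by (auto split: if_splits)
  qed
  let ?M = "A * transpose_mat X"
  have Mc: "?M \<in> carrier_mat N N" using c by auto
  have "transpose_mat Y = 2 \<cdot>\<^sub>m transpose_mat X + transpose_mat X * transpose_mat Y"
    by (subst (1) Y(3), subst transpose_add[of _ N N]) (use c Y(1) in \<open>auto simp: transpose_mult[of _ N N _ N]\<close>)
  then have "A * transpose_mat Y = A * (2 \<cdot>\<^sub>m transpose_mat X + transpose_mat X * transpose_mat Y)"
    by (rule arg_cong)
  also have "\<dots> = 2 \<cdot>\<^sub>m ?M + ?M * transpose_mat Y"
    using c Y(1) by (simp add: mult_add_distrib_mat[of _ N N _ N] mult_smult_distrib[of _ N N _ N]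
        assoc_mult_mat[of _ N N _ N _ N])
  finally have "A * transpose_mat Y = 2 \<cdot>\<^sub>m ?M + ?M * transpose_mat Y" .
  moreover have "(?M * transpose_mat Y) $$ (i, j) = 0" if "i \<le> j" "j < N" for i j
  proof -
    have "?M $$ (i, k) * transpose_mat Y $$ (k, j) = 0" if "k < N" for k
      using AX[of i k] Y_upper[of k j] that \<open>i \<le> j\<close> \<open>j < N\<close> Y(1)
      by (cases "i < k") auto
    then have "(\<Sum>k<N. ?M $$ (i, k) * transpose_mat Y $$ (k, j)) = 0"
      by (intro sum.neutral ballI) (simp only: lessThan_iff)
    then show ?thesis using that Mc Y(1) by (simp add: times_entry[where N = N])
  qed
  ultimately have AY: "(A * transpose_mat Y) $$ (i, j) = 2 * ?M $$ (i, j)" if "i \<le> j" "j < N" for i j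
    using that c Y(1) by simp
  have inv: "minv (minv (1\<^sub>m N + Y)) = 1\<^sub>m N + Y" by (rule unitri_inv_inv[OF Y(2)])
  have Ah: "A * inv_transp N (minv (1\<^sub>m N + Y)) = A + A * transpose_mat Y"
    unfolding inv_transp_def inv using c Y(1)
    by (simp add: transpose_add[of _ N N] mult_add_distrib_mat[of _ N N _ N])
  have "upper_eq N (A + A * transpose_mat Y) A"
    using AY AX c Y(1) by (auto simp: upper_eq_def)
  then have "proj P (A + A * transpose_mat Y) = proj P A"
    using c Y(1) by (intro proj_upper_cong) auto
  then show "dot A (minv (1\<^sub>m N + Y)) = A"
    using A by (simp add: dot_def Ah proj_id spV_def)
  have diag: "kappa A Z = (\<Sum>i<N. (A * transpose_mat Z) $$ (i, i))" if "Z \<in> carrier_mat N N" for Z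
    using kappa_times_right[OF c(1) one_carrier_mat that] that c by (simp add: kappa_one)
  have "kappa A (1\<^sub>m N + Y) = (\<Sum>i<N. A $$ (i, i) + (A * transpose_mat Y) $$ (i, i))"
    using c Y(1) by (simp add: diag transpose_add[of _ N N] mult_add_distrib_mat[of _ N N _ N])
  also have "\<dots> = (\<Sum>i<N. 2 * ?M $$ (i, i))"
    by (intro sum.cong refl) (simp add: AY spV_upper[OF A])
  also have "\<dots> = 2 * kappa A X" using c by (simp add: diag sum_distrib_left)
  finally show "co A (minv (1\<^sub>m N + Y)) = \<theta> (- (2 * kappa A X))" by (simp add: co_def inv)
qed

text \<open>Replacing X by t X for all scalars t turns equality of the character values into equality of their
  arguments.\<close>

lemma agree_linearised:
  assumes "A \<in> V" "B \<in> V" "agree A B" and X: "X \<in> skew_upper ty n"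
    and AX: "\<And>i j. i < j \<Longrightarrow> j < N \<Longrightarrow> (A * transpose_mat X) $$ (i, j) = 0"
    and BX: "\<And>i j. i < j \<Longrightarrow> j < N \<Longrightarrow> (B * transpose_mat X) $$ (i, j) = 0"
  shows "kappa A X = kappa B X"
proof -
  have Xc: "X \<in> carrier_mat N N" using X by (simp add: skew_upper_def)
  have "\<theta> (t * (2 * (kappa A X - kappa B X))) = 1" for t
  proof -
    let ?X = "t \<cdot>\<^sub>m X"
    have tX: "?X \<in> skew_upper ty n" by (rule skew_upper_smult[OF X])
    obtain Y where Y: "Y \<in> carrier_mat N N" "1\<^sub>m N + Y \<in> isometries ty n" "Y = 2 \<cdot>\<^sub>m ?X + Y * ?X"
      using cayley[OF tX] .
    let ?u = "minv (1\<^sub>m N + Y)"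
    have YU: "1\<^sub>m N + Y \<in> U" using isometries_subset_grpU[OF two] Y(2) by blast
    have YT: "1\<^sub>m N + Y \<in> UT" by (rule grpU_unitri[OF YU])
    have "transpose_mat ?X = t \<cdot>\<^sub>m transpose_mat X" by (rule eq_matI) auto
    then have tr: "D * transpose_mat ?X = t \<cdot>\<^sub>m (D * transpose_mat X)" if "D \<in> carrier_mat N N" for D
      using that Xc mult_smult_distrib[of D N N "transpose_mat X" N t] by simp
    have kap: "kappa D ?X = t * kappa D X" if "D \<in> carrier_mat N N" for D
      using that Xc by (simp add: kappa_sum[where N = N] sum_distrib_left mult_ac)
    note A = cayley_stabiliser[OF assms(1) tX _ Y(1) YT Y(3)]
    note B = cayley_stabiliser[OF assms(2) tX _ Y(1) YT Y(3)]
    have "dot A ?u = A" "co A ?u = \<theta> (- (2 * (t * kappa A X)))"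
      using A AX spV_mat[OF assms(1)] Xc by (simp_all add: tr kap)
    moreover have "dot B ?u = B" "co B ?u = \<theta> (- (2 * (t * kappa B X)))"
      using B BX spV_mat[OF assms(2)] Xc by (simp_all add: tr kap)
    moreover have "?u \<in> U" by (rule grpU_inv[OF YU])
    ultimately have "\<theta> (- (2 * (t * kappa A X))) = \<theta> (- (2 * (t * kappa B X)))"
      using assms(3) by (metis agree_def)
    moreover have "t * (2 * (kappa A X - kappa B X)) = - (2 * (t * kappa B X)) - - (2 * (t * kappa A X))"
      by (simp add: algebra_simps)
    ultimately show ?thesis by (metis theta_diff theta_uminus theta_nonzero right_inverse)
  qed
  then have "2 * (kappa A X - kappa B X) = 0" by (rule theta_trivial_imp_zero)
  then show ?thesis using two by simp
qed

end

context orbit_modules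
begin

lemma kappa_times_lower:
  fixes A X K :: "'a mat"
  assumes "K \<in> carrier_mat N N" "A \<in> carrier_mat N N" "X \<in> carrier_mat N N"
  shows "kappa (K * A) X = (\<Sum>j<N. \<Sum>i<N. K $$ (j, i) * (A * transpose_mat X) $$ (i, j))"
proof -
  have "kappa (K * A) X = kappa (K * A * transpose_mat X) (1\<^sub>m N)"
    using kappa_times_right[of "K * A" N "1\<^sub>m N" X] assms by simp
  also have "\<dots> = kappa (K * (A * transpose_mat X)) (1\<^sub>m N)"
    using assms assoc_mult_mat[of K N N A N "transpose_mat X" N] by simp
  also have "\<dots> = (\<Sum>j<N. \<Sum>i<N. K $$ (j, i) * (A * transpose_mat X) $$ (i, j))"
    using assms by (simp add: kappa_one times_entry[where N = N and X = K])
  finally show ?thesis .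
qed

lemma kappa_matrix_unit:
  fixes M :: "'a mat"
  assumes "M \<in> carrier_mat N N" "i < N" "j < N"
  shows "kappa M (matrix_unit N (Suc i) (Suc j)) = M $$ (i, j)"
proof -
  have "kappa M (matrix_unit N (Suc i) (Suc j)) =
      (\<Sum>r<N. \<Sum>c<N. if c = j then (if r = i then M $$ (r, c) else 0) else 0)"
    unfolding kappa_sum[OF assms(1) matrix_unit_carrier]
    by (intro sum.cong refl) (auto simp: matrix_unit_entry)
  then show ?thesis using assms by (simp add: sum.delta)
qed

text \<open>The functional X \<mapsto> tr(A^t X) - tr(B^t X) vanishes where the entries of A X^t and B X^t above the diagonal do, so it
  is a combination of these entries; the coefficients are the entries of C1 and C2 below the diagonal. Testing
  the resulting identity on E - E^* for matrix units E yields the skew parts.\<close>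

lemma agree_skew_parts:
  assumes "A \<in> V" "B \<in> V" "agree A B"
  obtains C1 C2 where "C1 \<in> lower_unitri N" "C2 \<in> lower_unitri N"
    "upper_eq N (C1 * A - flip ty n (C1 * A)) (C2 * B - flip ty n (C2 * B))"
proof -
  have c: "A \<in> carrier_mat N N" "B \<in> carrier_mat N N" using assms by (auto intro: spV_mat)
  define I where "I = {(i, j). i < j \<and> j < N}"
  have fin: "finite I" by (rule finite_subset[of _ "{..<N} \<times> {..<N}"]) (auto simp: I_def)
  define \<phi> where "\<phi> = (\<lambda>(D :: 'a mat, p) X. (D * transpose_mat X) $$ p)"
  define F where "F = Pair A ` I \<union> Pair B ` I"
  let ?W = "skew_upper ty n :: 'a mat set"
  let ?comb = "\<lambda>a X Y :: 'a mat. X + a \<cdot>\<^sub>m Y"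
  have Wc: "X \<in> carrier_mat N N" if "X \<in> ?W" for X using that by (simp add: skew_upper_def)
  have kappa_lin: "kappa D (?comb a X Y) = kappa D X + a * kappa D Y"
    if "D \<in> carrier_mat N N" "X \<in> carrier_mat N N" "Y \<in> carrier_mat N N" for D X Y and a :: 'a
    using that
    by (simp add: kappa_sum[where N = N] sum.distrib sum_distrib_left distrib_left mult_ac)
  have "\<exists>c. \<forall>X\<in>?W. kappa A X - kappa B X = (\<Sum>s\<in>F. c s * \<phi> s X)"
  proof (rule functional_combination[where comb = ?comb])
    show "finite F" using fin by (simp add: F_def)
  next
    fix s a and X Y :: "'a mat" assume s: "s \<in> F" and XY: "X \<in> ?W" "Y \<in> ?W"
    obtain D i j where D: "s = (D, i, j)" "D \<in> carrier_mat N N" "i < N" "j < N"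
      using s c by (auto simp: F_def I_def)
    have "D * transpose_mat (X + a \<cdot>\<^sub>m Y) = D * transpose_mat X + a \<cdot>\<^sub>m (D * transpose_mat Y)"
    proof -
      have "transpose_mat (X + a \<cdot>\<^sub>m Y) = transpose_mat X + a \<cdot>\<^sub>m transpose_mat Y"
        by (rule eq_matI) (use Wc[OF XY(1)] Wc[OF XY(2)] in auto)
      then show ?thesis using D(2) Wc[OF XY(1)] Wc[OF XY(2)]
        by (simp add: mult_add_distrib_mat[of _ N N _ N] mult_smult_distrib[of _ N N _ N])
    qed
    then show "\<phi> s (X + a \<cdot>\<^sub>m Y) = \<phi> s X + a * \<phi> s Y"
      using D Wc[OF XY(1)] Wc[OF XY(2)] by (simp add: \<phi>_def)
  next
    fix X assume X: "X \<in> ?W" and "\<And>s. s \<in> F \<Longrightarrow> \<phi> s X = 0"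
    then have z: "\<phi> (A, p) X = 0" "\<phi> (B, p) X = 0" if "p \<in> I" for p
      using that by (auto simp: F_def)
    have "kappa A X = kappa B X"
      using z by (intro agree_linearised[OF assms X]) (auto simp: \<phi>_def I_def)
    then show "kappa A X - kappa B X = 0" by simp
  next
    fix a and X Y :: "'a mat" assume XY: "X \<in> ?W" "Y \<in> ?W"
    show "kappa A (X + a \<cdot>\<^sub>m Y) - kappa B (X + a \<cdot>\<^sub>m Y) =
        kappa A X - kappa B X + a * (kappa A Y - kappa B Y)"
      using Wc[OF XY(1)] Wc[OF XY(2)] c by (simp add: kappa_lin algebra_simps)
  qed (rule skew_upper_comb)
  then obtain co where co: "\<And>X. X \<in> ?W \<Longrightarrow> kappa A X - kappa B X = (\<Sum>s\<in>F. co s * \<phi> s X)" by blast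
  \<comment> \<open>When A = B the two families of functionals coincide, and the coefficients count once.\<close>
  define a b where "a = (\<lambda>p. co (A, p))" and "b = (\<lambda>p. if A = B then 0 else co (B, p))"
  have split: "kappa A X - kappa B X = (\<Sum>p\<in>I. a p * \<phi> (A, p) X) + (\<Sum>p\<in>I. b p * \<phi> (B, p) X)"
    if "X \<in> ?W" for X
  proof (cases "A = B")
    case True
    then show ?thesis using co[OF that]
      by (simp add: F_def a_def b_def sum.reindex inj_on_def)
  next
    case False
    then have "Pair A ` I \<inter> Pair B ` I = {}" by auto
    then show ?thesis using co[OF that] False fin
      by (simp add: F_def a_def b_def sum.union_disjoint sum.reindex inj_on_def)
  qed
  define K where "K = (\<lambda>a' :: nat \<times> nat \<Rightarrow> 'a. mat N N (\<lambda>(j, i). if i < j then a' (i, j) else of_bool (i = j)))"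
  have K: "K a' \<in> lower_unitri N" for a' by (auto simp: lower_unitri_iff K_def)
  have kappa_K: "kappa (K a' * D) X = kappa D X + (\<Sum>p\<in>I. a' p * \<phi> (D, p) X)"
    if "D \<in> carrier_mat N N" "X \<in> carrier_mat N N" for a' D X
  proof -
    let ?t = "\<lambda>i j. (D * transpose_mat X) $$ (i, j)"
    have "kappa (K a' * D) X =
        (\<Sum>j<N. \<Sum>i<N. (if i = j then ?t i j else 0) + (if i < j then a' (i, j) * ?t i j else 0))"
      unfolding kappa_times_lower[OF lower_unitri_mat[OF K] that]
      by (intro sum.cong refl) (auto simp: K_def)
    also have "\<dots> = (\<Sum>j<N. ?t j j) + (\<Sum>j<N. \<Sum>i<N. if i < j then a' (i, j) * ?t i j else 0)"
      by (simp add: sum.distrib)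
    also have "(\<Sum>j<N. ?t j j) = kappa D X"
      using that kappa_times_right[OF that(1) one_carrier_mat that(2)] by (simp add: kappa_one)
    also have "(\<Sum>j<N. \<Sum>i<N. if i < j then a' (i, j) * ?t i j else 0)
        = (\<Sum>i<N. \<Sum>j<N. if i < j then a' (i, j) * ?t i j else 0)" by (rule sum.swap)
    also have "\<dots> = (\<Sum>p\<in>{..<N} \<times> {..<N}. if p \<in> I then a' p * \<phi> (D, p) X else 0)"
      unfolding sum.cartesian_product by (intro sum.cong refl) (auto simp: I_def \<phi>_def split: if_splits)
    also have "\<dots> = (\<Sum>p\<in>I. a' p * \<phi> (D, p) X)"
      by (rule sum.mono_neutral_cong_right) (auto simp: I_def split: if_splits)
    finally show ?thesis .
  qed
  define C1 C2 where "C1 = K (\<lambda>p. - a p)" and "C2 = K b"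
  have Cc: "C1 * A \<in> carrier_mat N N" "C2 * B \<in> carrier_mat N N"
    unfolding C1_def C2_def
    by (rule mult_carrier_mat[OF lower_unitri_mat[OF K]], rule c)+
  have eq: "kappa (C1 * A) X = kappa (C2 * B) X" if "X \<in> ?W" for X
    using split[OF that] kappa_K[OF c(1) Wc[OF that]] kappa_K[OF c(2) Wc[OF that]]
    by (simp add: C1_def C2_def sum_negf algebra_simps)
  have "upper_eq N (C1 * A - flip ty n (C1 * A)) (C2 * B - flip ty n (C2 * B))"
    unfolding upper_eq_def
  proof (intro allI impI)
    fix i j assume ij: "i < j" "j < N"
    let ?E = "matrix_unit N (Suc i) (Suc j) :: 'a mat"
    let ?X = "?E + (- 1) \<cdot>\<^sub>m flip ty n ?E"
    have flipE: "flip ty n ?E = (form_sign ty n i * form_sign ty n j) \<cdot>\<^sub>m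
        matrix_unit N (Suc (N - Suc j)) (Suc (N - Suc i))"
      using ij by (simp add: flip_matrix_unit)
    have X: "?X \<in> ?W"
    proof -
      have "flip ty n ?X = flip ty n ?E + (- 1) \<cdot>\<^sub>m flip ty n (flip ty n ?E)"
        by (rule eq_matI) (auto simp: flip_entry algebra_simps)
      also have "\<dots> = - ?X"
        by (rule eq_matI) (auto simp: flip_flip)
      finally have "flip ty n ?X = - ?X" .
      moreover have "?X $$ (r, c) = 0" if "c \<le> r" "r < N" for r c
        using that ij by (auto simp: flipE matrix_unit_entry)
      ultimately show ?thesis by (auto simp: skew_upper_def)
    qed
    have *: "kappa M ?X = (M - flip ty n M) $$ (i, j)" if M: "M \<in> carrier_mat N N" for M
    proof -
      have "kappa M (flip ty n ?E) = flip ty n M $$ (i, j)"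
      proof -
        have "kappa M (s \<cdot>\<^sub>m E') = s * kappa M E'" if "E' \<in> carrier_mat N N" for s :: 'a and E'
          using M that by (simp add: kappa_sum[where N = N] sum_distrib_left mult_ac)
        then show ?thesis using M ij by (simp add: flipE kappa_matrix_unit flip_entry)
      qed
      then show ?thesis using M ij
        by (simp add: kappa_lin[OF M matrix_unit_carrier flip_carrier] kappa_matrix_unit)
    qed
    show "(C1 * A - flip ty n (C1 * A)) $$ (i, j) = (C2 * B - flip ty n (C2 * B)) $$ (i, j)"
      using eq[OF X] *[OF Cc(1)] *[OF Cc(2)] by simp
  qed
  then show ?thesis using that[of C1 C2] K by (simp add: C1_def C2_def)
qed

end

section \<open>Uniqueness of monomial normal forms\<close>

definition upper_monomial :: "nat \<Rightarrow> 'a::zero mat \<Rightarrow> bool" where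
  "upper_monomial N E \<longleftrightarrow> E \<in> carrier_mat N N \<and>
     (\<forall>i<N. \<forall>j<N. E $$ (i, j) \<noteq> 0 \<longrightarrow>
        i < j \<and> (\<forall>k<N. E $$ (i, k) \<noteq> 0 \<longrightarrow> k = j) \<and> (\<forall>k<N. E $$ (k, j) \<noteq> 0 \<longrightarrow> k = i))"

lemma monomial_times_entry:
  assumes "upper_monomial N E" "X \<in> carrier_mat N N" "i < N" "m < N" "E $$ (i, m) \<noteq> 0" "j < N"
  shows "(E * X) $$ (i, j) = E $$ (i, m) * X $$ (m, j)"
proof -
  have E: "E $$ (i, k) = 0" if "k < N" "k \<noteq> m" for k
    using assms(1,3-5) that unfolding upper_monomial_def by blast
  have "(E * X) $$ (i, j) = (\<Sum>k<N. E $$ (i, k) * X $$ (k, j))"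
    using assms by (intro times_entry) (auto simp: upper_monomial_def)
  also have "\<dots> = (\<Sum>k<N. if k = m then E $$ (i, k) * X $$ (k, j) else 0)"
    by (intro sum.cong refl) (simp add: E)
  finally have "(E * X) $$ (i, j) = (\<Sum>k<N. if k = m then E $$ (i, k) * X $$ (k, j) else 0)" .
  then show ?thesis using assms(4) by simp
qed

lemma times_monomial_entry:
  assumes "upper_monomial N E" "X \<in> carrier_mat N N" "j < N" "m < N" "E $$ (m, j) \<noteq> 0" "i < N"
  shows "(X * E) $$ (i, j) = X $$ (i, m) * E $$ (m, j)"
proof -
  have E: "E $$ (k, j) = 0" if "k < N" "k \<noteq> m" for k
    using assms(1,3-5) that unfolding upper_monomial_def by blast
  have "(X * E) $$ (i, j) = (\<Sum>k<N. X $$ (i, k) * E $$ (k, j))"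
    using assms by (intro times_entry) (auto simp: upper_monomial_def)
  also have "\<dots> = (\<Sum>k<N. if k = m then X $$ (i, k) * E $$ (k, j) else 0)"
    by (intro sum.cong refl) (simp add: E)
  finally have "(X * E) $$ (i, j) = (\<Sum>k<N. if k = m then X $$ (i, k) * E $$ (k, j) else 0)" .
  then show ?thesis using assms(4) by simp
qed

lemma times_entry_nonzero:
  assumes "(X * Y) $$ (i, j) \<noteq> 0" "X \<in> carrier_mat N N" "Y \<in> carrier_mat N N" "i < N" "j < N"
  obtains k where "k < N" "X $$ (i, k) \<noteq> 0" "Y $$ (k, j) \<noteq> (0 :: 'a::field)"
proof -
  have "\<exists>k<N. X $$ (i, k) * Y $$ (k, j) \<noteq> 0"
  proof (rule ccontr)
    assume "\<not> ?thesis"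
    then have "(\<Sum>k<N. X $$ (i, k) * Y $$ (k, j)) = 0" by (intro sum.neutral) auto
    then have "(X * Y) $$ (i, j) = 0" using assms(2-5) by (simp add: times_entry[where N = N])
    then show False using assms(1) by simp
  qed
  then show ?thesis using that by auto
qed

text \<open>At a nonzero entry (i, k) of E2 the right hand side is nonzero, which forces a nonzero entry (j, k) of E1 with
  j \<le> i. If j < i, then the right hand side is nonzero at (j, k), so row j of E2 is nonzero; by induction its entry
  is the one of E1, in column k, where E2 already has the entry in row i.\<close>

lemma monomial_upper_eq_entry:
  fixes E1 E2 :: "'a::field mat"
  assumes E: "upper_monomial N E1" "upper_monomial N E2"
    and M: "M \<in> lower_unitri N" and Q: "Q \<in> lower_unitri N"
    and eq: "upper_eq N (M * E1) (E2 * Q)"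
    and "i < N" "k < N" "E2 $$ (i, k) \<noteq> 0"
  shows "E1 $$ (i, k) = E2 $$ (i, k)"
  using assms(6-)
proof (induction i arbitrary: k rule: less_induct)
  case (less i k)
  have c: "E1 \<in> carrier_mat N N" "E2 \<in> carrier_mat N N" "M \<in> carrier_mat N N" "Q \<in> carrier_mat N N"
    using E M Q by (auto simp: upper_monomial_def intro: lower_unitri_mat)
  have "i < k" using E(2) less.prems by (auto simp: upper_monomial_def)
  have E2: "(E2 * Q) $$ (i, k) = E2 $$ (i, k)"
    using monomial_times_entry[OF E(2) c(4) less.prems(1,2,3,2)] Q less.prems by (simp add: lower_unitri_iff)
  then have "(M * E1) $$ (i, k) \<noteq> 0"
    using eq less.prems \<open>i < k\<close> by (simp add: upper_eq_def)
  then obtain j where j: "j < N" "M $$ (i, j) \<noteq> 0" "E1 $$ (j, k) \<noteq> 0"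
    using times_entry_nonzero c less.prems by blast
  have E1: "(M * E1) $$ (j, k) = E1 $$ (j, k)"
    using times_monomial_entry[OF E(1) c(3) less.prems(2) j(1,3,1)] M j by (simp add: lower_unitri_iff)
  have "j < k" using E(1) j less.prems by (auto simp: upper_monomial_def)
  have eq_jk: "(E2 * Q) $$ (j, k) = E1 $$ (j, k)"
    using eq E1 \<open>j < k\<close> less.prems(2) by (simp add: upper_eq_def)
  have "j \<le> i" using lower_unitri_nonzeroD[OF M j(2,1)] .
  then consider "j < i" | "j = i" by linarith
  then show ?case
  proof cases
    case 1
    have "(E2 * Q) $$ (j, k) \<noteq> 0" using eq_jk j by simp
    then obtain l where l: "l < N" "E2 $$ (j, l) \<noteq> 0"
      using times_entry_nonzero c less.prems(2) j(1) by blast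
    then have "E1 $$ (j, l) \<noteq> 0" using less.IH[OF 1 j(1)] by simp
    then have "l = k" using E(1) j l less.prems by (auto simp: upper_monomial_def)
    then have "j = i" using E(2) l less.prems j(1) unfolding upper_monomial_def by metis
    then show ?thesis using 1 by simp
  next
    case 2
    then show ?thesis using eq_jk E2 by simp
  qed
qed

text \<open>Inverting M and Q exchanges the roles of E1 and E2, so their nonzero entries determine each other.\<close>

lemma monomial_unique:
  fixes E1 E2 :: "'a::{field, finite} mat"
  assumes E: "upper_monomial N E1" "upper_monomial N E2"
    and M: "M \<in> lower_unitri N" and Q: "Q \<in> lower_unitri N"
    and eq: "upper_eq N (M * E1) (E2 * Q)"
  shows "E1 = E2"
proof -
  have c: "E1 \<in> carrier_mat N N" "E2 \<in> carrier_mat N N" "M \<in> carrier_mat N N" "Q \<in> carrier_mat N N"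
    using E M Q by (auto simp: upper_monomial_def intro: lower_unitri_mat)
  obtain M' where M': "M' \<in> lower_unitri N" "M' * M = 1\<^sub>m N" using lower_unitri_inverse[OF M] by metis
  obtain Q' where Q': "Q' \<in> lower_unitri N" "Q * Q' = 1\<^sub>m N" using lower_unitri_inverse[OF Q] by metis
  have c': "M' \<in> carrier_mat N N" "Q' \<in> carrier_mat N N" using M' Q' by (auto intro: lower_unitri_mat)
  have "upper_eq N (M' * (M * E1) * Q') (M' * (E2 * Q) * Q')"
    using eq M' Q' c c' by (intro upper_eq_times_left upper_eq_times_right) auto
  moreover have "M' * (M * E1) = E1"
    using c c' M'(2) assoc_mult_mat[of M' N N M N E1 N] by simp
  moreover have "M' * (E2 * Q) * Q' = M' * E2"
    using c c' Q'(2) assoc_mult_mat[of M' N N "E2 * Q" N Q' N] assoc_mult_mat[of E2 N N Q N Q' N] by simp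
  ultimately have eq': "upper_eq N (M' * E2) (E1 * Q')" by (simp add: upper_eq_sym)
  show ?thesis
  proof (rule eq_matI)
    fix i j assume "i < dim_row E2" "j < dim_col E2"
    then have "i < N" "j < N" using c by auto
    then show "E1 $$ (i, j) = E2 $$ (i, j)"
      using monomial_upper_eq_entry[OF E M Q eq] monomial_upper_eq_entry[OF E(2,1) M'(1) Q'(1) eq']
      by metis
  qed (use c in auto)
qed

section \<open>Main separated matrices\<close>

lemma main_Suc:
  assumes "A \<in> carrier_mat (mdim ty n) (mdim ty n)"
  shows "(Suc r, Suc c) \<in> main ty n A \<longleftrightarrow> (Suc r, Suc c) \<in> pos_P ty n \<and> A $$ (r, c) \<noteq> 0
    \<and> (\<forall>k. c < k \<longrightarrow> k < mdim ty n \<longrightarrow> A $$ (r, k) = 0)"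
proof -
  have "(\<forall>k. Suc c < k \<and> k \<le> mdim ty n \<longrightarrow> A $$ (r, k - 1) = 0) \<longleftrightarrow>
      (\<forall>k. c < k \<longrightarrow> k < mdim ty n \<longrightarrow> A $$ (r, k) = 0)"
  proof (intro iffI allI impI)
    fix k assume *: "\<forall>k. Suc c < k \<and> k \<le> mdim ty n \<longrightarrow> A $$ (r, k - 1) = 0" "c < k" "k < mdim ty n"
    then show "A $$ (r, k) = 0" using *(1)[rule_format, of "Suc k"] by simp
  next
    fix k assume *: "\<forall>k. c < k \<longrightarrow> k < mdim ty n \<longrightarrow> A $$ (r, k) = 0" "Suc c < k \<and> k \<le> mdim ty n"
    then show "A $$ (r, k - 1) = 0" by (cases k) auto
  qed
  then show ?thesis by (simp add: main_def entry_def)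
qed

lemma verge_entry:
  assumes "A \<in> carrier_mat (mdim ty n) (mdim ty n)" "r < mdim ty n" "c < mdim ty n"
  shows "verge ty n A $$ (r, c) = (if (Suc r, Suc c) \<in> main ty n A then A $$ (r, c) else 0)"
  unfolding verge_def using assms by (simp add: proj_entry)

lemma verge_carrier:
  "A \<in> carrier_mat (mdim ty n) (mdim ty n) \<Longrightarrow> verge ty n A \<in> carrier_mat (mdim ty n) (mdim ty n)"
  by (simp add: verge_def proj_carrier)

lemma verge_nonzero_iff:
  assumes "A \<in> carrier_mat (mdim ty n) (mdim ty n)" "r < mdim ty n" "c < mdim ty n"
  shows "verge ty n A $$ (r, c) \<noteq> 0 \<longleftrightarrow> (Suc r, Suc c) \<in> main ty n A"
  using assms by (simp add: verge_entry main_Suc)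

lemma main_subset_P: "main ty n A \<subseteq> pos_P ty n"
  by (auto simp: main_def)

lemma pos_P_elim:
  assumes "(i, j) \<in> pos_P ty n"
  obtains r c where "i = Suc r" "j = Suc c" "r < mdim ty n" "c < mdim ty n"
proof -
  obtain r c where rc: "i = Suc r" "j = Suc c"
    using assms by (cases i; cases j) (auto simp: pos_P_def pos_P0_def pos_Gamma_def split: if_splits)
  then have "r < mdim ty n" "c < mdim ty n" using assms by (auto simp: pos_P_Suc)
  then show ?thesis using that rc by blast
qed

lemma main_eqI:
  assumes A: "A \<in> carrier_mat (mdim ty n) (mdim ty n)" and B: "B \<in> carrier_mat (mdim ty n) (mdim ty n)"
    and "verge ty n A = verge ty n B"
  shows "main ty n A = main ty n B"
proof -
  have *: "(i, j) \<in> main ty n A \<longleftrightarrow> (i, j) \<in> main ty n B" if P: "(i, j) \<in> pos_P ty n" for i j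
  proof -
    obtain r c where rc: "i = Suc r" "j = Suc c" "r < mdim ty n" "c < mdim ty n"
      using P by (rule pos_P_elim)
    show ?thesis
      using verge_nonzero_iff[OF A rc(3,4)] verge_nonzero_iff[OF B rc(3,4)] assms(3) rc(1,2) by simp
  qed
  show ?thesis
  proof (rule Set.set_eqI)
    fix p :: "nat \<times> nat"
    show "p \<in> main ty n A \<longleftrightarrow> p \<in> main ty n B"
    proof (cases "p \<in> pos_P ty n")
      case True
      then show ?thesis using *[of "fst p" "snd p"] by simp
    next
      case False
      then have "p \<notin> main ty n A" "p \<notin> main ty n B"
        using subsetD[OF main_subset_P[of ty n A]] subsetD[OF main_subset_P[of ty n B]] by metis+
      then show ?thesis by simp
    qed
  qed
qed

lemma limb_cong: "main ty n A = main ty n B \<Longrightarrow> limb ty n A = limb ty n B"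
  by (simp only: limb_def limb0_def rmain_def)

lemma main_separated_cong:
  "main ty n A = main ty n B \<Longrightarrow> main_separated ty n A \<longleftrightarrow> main_separated ty n B"
  using limb_cong[of ty n A B] by (simp add: main_separated_def)

text \<open>The support condition holds for all of V in types B and D; in type C it is the additional assumption of the
  theorem.\<close>

definition separated :: "lie_type \<Rightarrow> nat \<Rightarrow> 'a::zero mat \<Rightarrow> bool" where
  "separated ty n A \<longleftrightarrow> A \<in> mats_on (mdim ty n) (pos_P0 ty n) \<and> main_separated ty n A"

lemma separated_mat: "separated ty n A \<Longrightarrow> A \<in> carrier_mat (mdim ty n) (mdim ty n)"
  by (simp add: separated_def mats_on_iff)

context
  fixes ty :: lie_type and n :: nat and A :: "'a::field mat"
  assumes sep: "separated ty n A"
begin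

private abbreviation (input) "N \<equiv> mdim ty n"
private abbreviation (input) "D \<equiv> verge ty n A"

lemma verge_nonzeroD:
  assumes "D $$ (r, c) \<noteq> 0" "r < N" "c < N"
  shows "D $$ (r, c) = A $$ (r, c)" "c < k \<Longrightarrow> k < N \<Longrightarrow> A $$ (r, k) = 0"
    "r < c" "r + c + 2 \<le> N"
proof -
  have Ac: "A \<in> carrier_mat N N" by (rule separated_mat[OF sep])
  have m: "(Suc r, Suc c) \<in> main ty n A" using assms verge_nonzero_iff[OF Ac] by blast
  then show "D $$ (r, c) = A $$ (r, c)" "c < k \<Longrightarrow> k < N \<Longrightarrow> A $$ (r, k) = 0"
    using assms Ac by (auto simp: verge_entry main_Suc)
  have "A $$ (r, c) \<noteq> 0" using m Ac by (simp add: main_Suc)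
  then have "(Suc r, Suc c) \<in> pos_P0 ty n" using sep assms by (auto simp: separated_def mats_on_iff)
  then show "r < c" "r + c + 2 \<le> N" by (auto simp: pos_P0_Suc)
qed

lemma row_nonzero:
  assumes "A $$ (r, c) \<noteq> 0" "r < N" "c < N"
  shows "\<exists>m<N. D $$ (r, m) \<noteq> 0"
proof -
  have Ac: "A \<in> carrier_mat N N" by (rule separated_mat[OF sep])
  define m where "m = Max {k. k < N \<and> A $$ (r, k) \<noteq> 0}"
  have fin: "finite {k. k < N \<and> A $$ (r, k) \<noteq> 0}" by simp
  have "m \<in> {k. k < N \<and> A $$ (r, k) \<noteq> 0}"
    unfolding m_def by (rule Max_in[OF fin]) (use assms in blast)
  then have m: "m < N" "A $$ (r, m) \<noteq> 0" by auto
  have "A $$ (r, k) = 0" if "m < k" "k < N" for k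
  proof (rule ccontr)
    assume "A $$ (r, k) \<noteq> 0"
    then have "k \<le> m" unfolding m_def by (intro Max_ge[OF fin]) (use that in simp)
    then show False using that(1) by simp
  qed
  moreover have "(Suc r, Suc m) \<in> pos_P ty n"
    using sep m assms by (auto simp: separated_def mats_on_iff pos_P0_Suc pos_P_Suc)
  ultimately have "(Suc r, Suc m) \<in> main ty n A" using m Ac by (simp add: main_Suc)
  then show ?thesis using m assms verge_nonzero_iff[OF Ac] by blast
qed

lemma verge_row_unique:
  assumes "D $$ (r, c) \<noteq> 0" "D $$ (r, c') \<noteq> 0" "r < N" "c < N" "c' < N"
  shows "c = c'"
proof (rule ccontr)
  assume "c \<noteq> c'"
  then consider "c < c'" | "c' < c" by linarith
  then show False
    using verge_nonzeroD(1,2)[OF assms(1,3,4)] verge_nonzeroD(1,2)[OF assms(2,3,5)] assms by cases auto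
qed

text \<open>Legs: two main conditions in one column would put the lower one into the leg of the
  upper one.\<close>

lemma verge_column_unique:
  assumes "D $$ (r, c) \<noteq> 0" "D $$ (r', c) \<noteq> 0" "r < N" "r' < N" "c < N"
  shows "r = r'"
proof -
  have Ac: "A \<in> carrier_mat N N" by (rule separated_mat[OF sep])
  have *: False if "r < r'" "D $$ (r, c) \<noteq> 0" "D $$ (r', c) \<noteq> 0" "r < N" "r' < N" for r r'
  proof -
    have m: "(Suc r, Suc c) \<in> main ty n A" "(Suc r', Suc c) \<in> main ty n A"
      using that assms(5) verge_nonzero_iff[OF Ac] by blast+
    have "(Suc r', Suc c) \<in> pos_P0 ty n"
      using verge_nonzeroD(3,4)[OF that(3,5) assms(5)] by (simp add: pos_P0_Suc)
    then have "(Suc r', Suc c) \<in> leg ty n (Suc r) (Suc c)" using that(1) by (auto simp: leg_def)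
    then have "(Suc r', Suc c) \<in> limb ty n A" using m(1) by (auto simp: limb_def limb0_def)
    then show False using m(2) sep by (auto simp: separated_def main_separated_def)
  qed
  show ?thesis using *[of r r'] *[of r' r] assms by (cases r r' rule: linorder_cases) auto
qed

text \<open>Arms: a main condition in the row mirror to c would lie in the arm of the one in column c.\<close>

lemma verge_mirror_row:
  assumes "D $$ (r, c) \<noteq> 0" "r < N" "c < N" "k < N"
  shows "D $$ (N - Suc c, k) = 0"
proof (rule ccontr)
  assume k: "D $$ (N - Suc c, k) \<noteq> 0"
  have Ac: "A \<in> carrier_mat N N" by (rule separated_mat[OF sep])
  have m: "(Suc r, Suc c) \<in> main ty n A" "(Suc (N - Suc c), Suc k) \<in> main ty n A"
    using k assms verge_nonzero_iff[OF Ac] by auto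
  have "(Suc (N - Suc c), Suc k) \<in> pos_P0 ty n"
    using verge_nonzeroD(3,4)[OF k _ assms(4)] assms(3) by (simp add: pos_P0_Suc)
  moreover have "bar ty n (Suc c) = Suc (N - Suc c)" using assms(3) by (simp add: bar_def)
  ultimately have "(Suc (N - Suc c), Suc k) \<in> arm ty n (Suc r) (Suc c)" by (auto simp: arm_def)
  then have "(Suc (N - Suc c), Suc k) \<in> limb ty n A" using m(1) by (auto simp: limb_def limb0_def)
  then show False using m(2) sep by (auto simp: separated_def main_separated_def)
qed

lemma verge_mat: "D \<in> carrier_mat N N"
  by (rule verge_carrier[OF separated_mat[OF sep]])

lemma skew_verge_entry:
  "i < N \<Longrightarrow> j < N \<Longrightarrow> (D - flip ty n D) $$ (i, j) =
     D $$ (i, j) - form_sign ty n i * form_sign ty n j * D $$ (N - Suc j, N - Suc i)"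
  using verge_mat by (simp add: flip_entry)

lemma skew_verge_nonzero:
  assumes "(D - flip ty n D) $$ (i, j) \<noteq> 0" "i < N" "j < N"
  shows "D $$ (i, j) \<noteq> 0 \<or> D $$ (N - Suc j, N - Suc i) \<noteq> 0"
  using assms(1) unfolding skew_verge_entry[OF assms(2,3)] by auto

text \<open>Nonzero entries of D and of its flip never share a row or column, since the nonzero rows of D are not mirror to its
  nonzero columns.\<close>

lemma monomial_skew_verge: "upper_monomial N (D - flip ty n D)"
proof -
  let ?E = "D - flip ty n D"
  have mirror: "N - Suc (N - Suc i) = i" if "i < N" for i using that by simp
  have "i < j \<and> (\<forall>k<N. ?E $$ (i, k) \<noteq> 0 \<longrightarrow> k = j) \<and> (\<forall>k<N. ?E $$ (k, j) \<noteq> 0 \<longrightarrow> k = i)"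
    if ij: "i < N" "j < N" "?E $$ (i, j) \<noteq> 0" for i j
  proof -
    let ?i = "N - Suc i" and ?j = "N - Suc j"
    have lt: "?i < N" "?j < N" using ij by auto
    consider (up) "D $$ (i, j) \<noteq> 0" | (low) "D $$ (?j, ?i) \<noteq> 0"
      using skew_verge_nonzero[OF ij(3,1,2)] by blast
    then show ?thesis
    proof cases
      case up
      show ?thesis
      proof (intro conjI allI impI)
        show "i < j" using verge_nonzeroD(3)[OF up ij(1,2)] .
      next
        fix k assume k: "k < N" "?E $$ (i, k) \<noteq> 0"
        then have "D $$ (i, k) \<noteq> 0 \<or> D $$ (N - Suc k, ?i) \<noteq> 0" using skew_verge_nonzero ij by blast
        moreover have "D $$ (N - Suc k, ?i) = 0"
          using verge_mirror_row[of "N - Suc k" ?i j] up ij k by (auto simp: mirror)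
        ultimately show "k = j" using verge_row_unique[OF _ up ij(1) k(1) ij(2)] by simp
      next
        fix k assume k: "k < N" "?E $$ (k, j) \<noteq> 0"
        then have "D $$ (k, j) \<noteq> 0 \<or> D $$ (?j, N - Suc k) \<noteq> 0" using skew_verge_nonzero ij by blast
        moreover have "D $$ (?j, N - Suc k) = 0" using verge_mirror_row[OF up ij(1,2)] k by simp
        ultimately show "k = i" using verge_column_unique[OF _ up k(1) ij(1,2)] by simp
      qed
    next
      case low
      show ?thesis
      proof (intro conjI allI impI)
        show "i < j" using verge_nonzeroD(3)[OF low lt(2,1)] by simp
      next
        fix k assume k: "k < N" "?E $$ (i, k) \<noteq> 0"
        then have "D $$ (i, k) \<noteq> 0 \<or> D $$ (N - Suc k, ?i) \<noteq> 0" using skew_verge_nonzero ij by blast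
        moreover have "D $$ (i, k) = 0" using verge_mirror_row[OF low lt(2,1) k(1)] ij by (simp add: mirror)
        ultimately have "N - Suc k = ?j" using verge_column_unique[OF _ low _ lt(2,1)] k by simp
        then show "k = j" using k ij by linarith
      next
        fix k assume k: "k < N" "?E $$ (k, j) \<noteq> 0"
        then have "D $$ (k, j) \<noteq> 0 \<or> D $$ (?j, N - Suc k) \<noteq> 0" using skew_verge_nonzero ij by blast
        moreover have "D $$ (k, j) = 0"
          using verge_mirror_row[of k j ?i] low ij k by auto
        ultimately have "N - Suc k = ?i" using verge_row_unique[OF _ low lt(2) _ lt(1)] k by simp
        then show "k = i" using k ij by linarith
      qed
    qed
  qed
  then show ?thesis using verge_mat by (simp add: upper_monomial_def minus_carrier_mat)
qed

text \<open>The supports of D and of its flip lie on different sides of the antidiagonal.\<close>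

lemma skew_verge_determines_verge:
  assumes "i < N" "j < N"
  shows "D $$ (i, j) = (if i + j + 2 \<le> N then (D - flip ty n D) $$ (i, j) else 0)"
proof -
  have "D $$ (N - Suc j, N - Suc i) = 0" if "i + j + 2 \<le> N"
    using verge_nonzeroD(4)[of "N - Suc j" "N - Suc i"] assms that by force
  then show ?thesis using verge_nonzeroD(4)[of i j] assms
    unfolding skew_verge_entry[OF assms] by auto
qed

end

lemma sum_single_term:
  fixes f :: "nat \<Rightarrow> 'a::field"
  assumes "m < N" "\<And>k. k < N \<Longrightarrow> k \<noteq> m \<Longrightarrow> f k = 0"
  shows "(\<Sum>k<N. f k) = f m"
proof -
  have "(\<Sum>k<N. f k) = (\<Sum>k<N. if k = m then f k else 0)"
    by (intro sum.cong refl) (simp add: assms(2))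
  then show ?thesis using assms(1) by simp
qed

text \<open>The row factor of A = D L: row c of L is the normalised row of A whose main condition lies
  in column c.\<close>

lemma verge_factor:
  fixes A :: "'a::field mat"
  assumes sep: "separated ty n A"
  obtains L where "L \<in> lower_unitri (mdim ty n)" "A = verge ty n A * L"
proof -
  let ?N = "mdim ty n" and ?D = "verge ty n A"
  have Ac: "A \<in> carrier_mat ?N ?N" and Dc: "?D \<in> carrier_mat ?N ?N"
    using separated_mat[OF sep] verge_carrier by auto
  define row where "row c = (SOME r. r < ?N \<and> ?D $$ (r, c) \<noteq> 0)" for c
  define L where "L = mat ?N ?N (\<lambda>(c, y). if \<exists>r<?N. ?D $$ (r, c) \<noteq> 0
    then A $$ (row c, y) / ?D $$ (row c, c) else of_bool (c = y))"
  have row: "row c = r" if "?D $$ (r, c) \<noteq> 0" "r < ?N" "c < ?N" for r c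
  proof -
    have "row c < ?N \<and> ?D $$ (row c, c) \<noteq> 0" unfolding row_def by (rule someI[of _ r]) (use that in simp)
    then show ?thesis using verge_column_unique[OF sep] that by blast
  qed
  have Lc: "L \<in> carrier_mat ?N ?N" by (simp add: L_def)
  have L_row: "L $$ (c, y) = A $$ (r, y) / ?D $$ (r, c)"
    if "?D $$ (r, c) \<noteq> 0" "r < ?N" "c < ?N" "y < ?N" for r c y
    using that row[OF that(1-3)] by (auto simp: L_def)
  have L_triv: "L $$ (c, y) = of_bool (c = y)"
    if "\<And>r. r < ?N \<Longrightarrow> ?D $$ (r, c) = 0" "c < ?N" "y < ?N" for c y
    using that by (auto simp: L_def)
  have "L \<in> lower_unitri ?N"
    unfolding lower_unitri_iff
  proof (intro conjI allI impI Lc)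
    fix i assume "i < ?N"
    show "L $$ (i, i) = 1"
    proof (cases "\<exists>r<?N. ?D $$ (r, i) \<noteq> 0")
      case True
      then obtain r where r: "r < ?N" "?D $$ (r, i) \<noteq> 0" by blast
      show ?thesis using L_row[OF r(2,1) \<open>i < ?N\<close> \<open>i < ?N\<close>]
          verge_nonzeroD(1)[OF sep r(2,1) \<open>i < ?N\<close>] r(2) by simp
    qed (use L_triv \<open>i < ?N\<close> in auto)
  next
    fix i j assume ij: "i < j" "j < ?N"
    then have "i < ?N" by simp
    show "L $$ (i, j) = 0"
    proof (cases "\<exists>r<?N. ?D $$ (r, i) \<noteq> 0")
      case True
      then obtain r where r: "r < ?N" "?D $$ (r, i) \<noteq> 0" by blast
      show ?thesis using L_row[OF r(2,1) \<open>i < ?N\<close> ij(2)]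
          verge_nonzeroD(2)[OF sep r(2,1) \<open>i < ?N\<close> ij] by simp
    qed (use L_triv ij \<open>i < ?N\<close> in auto)
  qed
  moreover have "A = ?D * L"
  proof (rule eq_matI)
    fix r y assume "r < dim_row (?D * L)" "y < dim_col (?D * L)"
    then have ry: "r < ?N" "y < ?N" using Dc Lc by auto
    show "A $$ (r, y) = (?D * L) $$ (r, y)"
    proof (cases "\<exists>c<?N. ?D $$ (r, c) \<noteq> 0")
      case True
      then obtain c where c: "c < ?N" "?D $$ (r, c) \<noteq> 0" by blast
      have "?D $$ (r, k) = 0" if "k < ?N" "k \<noteq> c" for k
        using verge_row_unique[OF sep _ c(2) ry(1) that(1) c(1)] that(2) by blast
      then have "(?D * L) $$ (r, y) = ?D $$ (r, c) * L $$ (c, y)"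
        unfolding times_entry[OF Dc Lc ry] by (intro sum_single_term[OF c(1)]) simp
      then show ?thesis using L_row[OF c(2) ry(1) c(1) ry(2)] c by simp
    next
      case False
      then have "A $$ (r, y) = 0" using row_nonzero[OF sep] ry by blast
      then show ?thesis using False unfolding times_entry[OF Dc Lc ry] by simp
    qed
  qed (use Ac Dc Lc in auto)
  ultimately show ?thesis using that by blast
qed

text \<open>For A = D L and lower unitriangular C, the skew part of C A = C D L has the normal form
  D - D^*, where ^* is the flip. The matrix G effecting this collects the columns of C that meet
  rows of D and the columns of L^* mirror to the columns of D; main separation says exactly that
  these columns do not interfere.\<close>

lemma skew_part_normal_form:
  fixes A C :: "'a::field mat"
  assumes sep: "separated ty n A" and C: "C \<in> lower_unitri (mdim ty n)"
  obtains G where "G \<in> lower_unitri (mdim ty n)" "A = verge ty n A * flip ty n G"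
    "C * A - flip ty n (C * A) = G * (verge ty n A - flip ty n (verge ty n A)) * flip ty n G"
proof -
  let ?N = "mdim ty n" and ?D = "verge ty n A"
  obtain L where L: "L \<in> lower_unitri ?N" "A = ?D * L" using verge_factor[OF sep] .
  have c: "A \<in> carrier_mat ?N ?N" "?D \<in> carrier_mat ?N ?N" "C \<in> carrier_mat ?N ?N" "L \<in> carrier_mat ?N ?N"
    using separated_mat[OF sep] verge_carrier C L by (auto intro: lower_unitri_mat)
  define G where "G = mat ?N ?N (\<lambda>(x, k). if \<exists>y<?N. ?D $$ (k, y) \<noteq> 0 then C $$ (x, k)
    else if \<exists>r<?N. ?D $$ (r, ?N - Suc k) \<noteq> 0 then flip ty n L $$ (x, k) else of_bool (x = k))"
  have Gc: "G \<in> carrier_mat ?N ?N" by (simp add: G_def)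
  have G: "G \<in> lower_unitri ?N"
    using C flip_lower_unitri[OF L(1)] unfolding lower_unitri_iff by (auto simp: G_def)
  have G_col: "G $$ (x, r) = C $$ (x, r)" if "?D $$ (r, y) \<noteq> 0" "r < ?N" "y < ?N" "x < ?N" for x r y
    using that by (auto simp: G_def)
  have G_row: "flip ty n G $$ (y, x) = L $$ (y, x)"
    if "?D $$ (r, y) \<noteq> 0" "r < ?N" "y < ?N" "x < ?N" for x r y
  proof -
    have "?N - Suc (?N - Suc y) = y" "?N - Suc (?N - Suc x) = x" using that by auto
    moreover have "\<not> (\<exists>k<?N. ?D $$ (?N - Suc y, k) \<noteq> 0)" using verge_mirror_row[OF sep that(1-3)] by blast
    ultimately have "G $$ (?N - Suc x, ?N - Suc y) = flip ty n L $$ (?N - Suc x, ?N - Suc y)"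
      using that by (auto simp: G_def)
    then have "flip ty n G $$ (y, x) = flip ty n (flip ty n L) $$ (y, x)"
      using that by (simp add: flip_entry[of y ty n x])
    then show ?thesis using c by (simp add: flip_flip)
  qed
  have A_eq: "A = ?D * flip ty n G"
  proof (rule eq_matI)
    fix i j assume "i < dim_row (?D * flip ty n G)" "j < dim_col (?D * flip ty n G)"
    then have ij: "i < ?N" "j < ?N" using c by auto
    have "?D $$ (i, k) * L $$ (k, j) = ?D $$ (i, k) * flip ty n G $$ (k, j)" if "k < ?N" for k
      using G_row[of i k j] that ij by (cases "?D $$ (i, k) = 0") auto
    then have "(\<Sum>k<?N. ?D $$ (i, k) * L $$ (k, j)) = (\<Sum>k<?N. ?D $$ (i, k) * flip ty n G $$ (k, j))"
      by (intro sum.cong refl) (simp only: lessThan_iff)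
    then show "A $$ (i, j) = (?D * flip ty n G) $$ (i, j)"
      using ij by (subst L(2)) (simp add: times_entry[OF c(2,4)] times_entry[OF c(2) flip_carrier])
  qed (use c in auto)
  have GD: "G * ?D = C * ?D"
  proof (rule eq_matI)
    fix i j assume "i < dim_row (C * ?D)" "j < dim_col (C * ?D)"
    then have ij: "i < ?N" "j < ?N" using c by auto
    have "G $$ (i, k) * ?D $$ (k, j) = C $$ (i, k) * ?D $$ (k, j)" if "k < ?N" for k
      using G_col[of k j i] that ij by (cases "?D $$ (k, j) = 0") auto
    then have "(\<Sum>k<?N. G $$ (i, k) * ?D $$ (k, j)) = (\<Sum>k<?N. C $$ (i, k) * ?D $$ (k, j))"
      by (intro sum.cong refl) (simp only: lessThan_iff)
    then show "(G * ?D) $$ (i, j) = (C * ?D) $$ (i, j)"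
      using ij by (simp add: times_entry[OF c(3,2)] times_entry[OF Gc c(2)])
  qed (use c Gc in auto)
  have CA: "C * A = G * ?D * flip ty n G"
    unfolding GD by (subst A_eq) (use c in \<open>simp add: assoc_mult_mat[of _ ?N ?N _ ?N _ ?N]\<close>)
  have "flip ty n (C * A) = G * flip ty n ?D * flip ty n G"
    unfolding CA using c Gc
    by (simp add: flip_times[OF mult_carrier_mat[OF Gc c(2)] flip_carrier] flip_times[OF Gc c(2)] flip_flip[OF Gc]
        assoc_mult_mat[OF Gc flip_carrier flip_carrier])
  then have "C * A - flip ty n (C * A) = G * (?D - flip ty n ?D) * flip ty n G"
    unfolding CA using c Gc
    by (simp add: mult_minus_distrib_mat[OF Gc c(2) flip_carrier]
        minus_mult_distrib_mat[OF mult_carrier_mat[OF Gc c(2)] mult_carrier_mat[OF Gc flip_carrier] flip_carrier])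
  then show ?thesis using that G A_eq by blast
qed

section \<open>Comparison of normal forms\<close>

lemma cancel_left:
  assumes "X * Y = 1\<^sub>m N" "X \<in> carrier_mat N N" "Y \<in> carrier_mat N N" "Z \<in> carrier_mat N N"
  shows "X * (Y * Z) = (Z :: 'a::semiring_1 mat)"
  using assms by (simp flip: assoc_mult_mat[of X N N Y N Z N])

text \<open>Q is the quotient of the adjoints of H and G; dividing the congruence by G, by its adjoint, and finally by the
  adjoint of Q leaves a row operation on D1 and a column operation on D2.\<close>

lemma normal_form_comparison:
  fixes D1 D2 G H :: "'a::{field, finite} mat"
  assumes D: "D1 \<in> carrier_mat (mdim ty n) (mdim ty n)" "D2 \<in> carrier_mat (mdim ty n) (mdim ty n)"
    and G: "G \<in> lower_unitri (mdim ty n)" and H: "H \<in> lower_unitri (mdim ty n)"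
    and eq: "upper_eq (mdim ty n) (G * D1 * flip ty n G) (H * D2 * flip ty n H)"
  obtains M Q where "M \<in> lower_unitri (mdim ty n)" "Q \<in> lower_unitri (mdim ty n)"
    "flip ty n H = Q * flip ty n G" "upper_eq (mdim ty n) (M * D1) (D2 * Q)"
proof -
  let ?N = "mdim ty n" and ?flip = "flip ty n :: 'a mat \<Rightarrow> 'a mat"
  obtain F where F: "F \<in> lower_unitri ?N" "?flip G * F = 1\<^sub>m ?N" "F * ?flip G = 1\<^sub>m ?N"
    using lower_unitri_inverse[OF flip_lower_unitri[OF G]] by metis
  define Q where "Q = ?flip H * F"
  have Q: "Q \<in> lower_unitri ?N" unfolding Q_def by (intro lower_unitri_times flip_lower_unitri H F)
  obtain M where M: "M \<in> lower_unitri ?N" "M * ?flip Q = 1\<^sub>m ?N"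
    using lower_unitri_inverse[OF flip_lower_unitri[OF Q]] by metis
  have c: "G \<in> carrier_mat ?N ?N" "H \<in> carrier_mat ?N ?N" "F \<in> carrier_mat ?N ?N"
    "Q \<in> carrier_mat ?N ?N" "M \<in> carrier_mat ?N ?N"
    using G H F(1) Q M(1) by (auto intro: lower_unitri_mat)
  note assoc = assoc_mult_mat[of _ ?N ?N _ ?N _ ?N]
  have flipQ: "?flip Q = ?flip F * H"
    unfolding Q_def using c by (simp add: flip_times flip_flip)
  have FG: "?flip F * G = 1\<^sub>m ?N"
  proof -
    have "?flip F * G = ?flip (?flip G * F)" using c by (simp add: flip_times flip_flip)
    then show ?thesis using F(2) by (simp add: flip_one)
  qed
  have "upper_eq ?N (M * (?flip F * (G * D1 * ?flip G) * F)) (M * (?flip F * (H * D2 * ?flip H) * F))"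
    using eq M(1) flip_lower_unitri[OF F(1)] F(1) c D
    by (intro upper_eq_times_left upper_eq_times_right) (auto simp: mult_carrier_mat[of _ ?N ?N])
  moreover have "?flip F * (G * D1 * ?flip G) * F = D1"
    using c D F(2) cancel_left[OF FG flip_carrier c(1)] by (simp add: assoc)
  moreover have "M * (?flip F * (H * D2 * ?flip H) * F) = D2 * Q"
  proof -
    have "?flip F * (H * D2 * ?flip H) * F = ?flip Q * (D2 * Q)"
      unfolding flipQ unfolding Q_def
      using c D mult_carrier_mat[OF D(2) mult_carrier_mat[OF flip_carrier c(3), of H]]
      by (simp add: assoc)
    then show ?thesis using cancel_left[OF M(2) c(5) flip_carrier] D c by simp
  qed
  moreover have "?flip H = Q * ?flip G"
    unfolding Q_def using c F(3) by (simp add: assoc)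
  ultimately show ?thesis using that[OF M(1) Q] by simp
qed

lemma posI_Suc:
  fixes A :: "'a::field mat"
  assumes "A \<in> carrier_mat (mdim ty n) (mdim ty n)" "i < j" "j < mdim ty n"
    and "c < d" "d < mdim ty n" "verge ty n A $$ (i, c) \<noteq> 0" "verge ty n A $$ (j, d) \<noteq> 0"
  shows "(Suc i, Suc j) \<in> posI ty n A"
proof -
  have "(Suc i, Suc c) \<in> main ty n A" "(Suc j, Suc d) \<in> main ty n A"
    using assms verge_nonzero_iff[OF assms(1)] by simp_all
  then have "\<exists>a b. (Suc i, a) \<in> main ty n A \<and> (Suc j, b) \<in> main ty n A \<and> a < b"
    using assms(4) by (intro exI[of _ "Suc c"] exI[of _ "Suc d"]) simp
  then show ?thesis using assms(2,3) by (simp add: posI_def pos_T_Suc)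
qed

text \<open>With D the common verge, A = D G^* and B = D Q G^*. Comparing M (D - D^*) with (D - D^*) Q at (j, k) shows that
  entries of D Q above the diagonal occur only in columns k of main conditions (i, k) with i \<le> j; this
  is what makes D Q divisible by D on the right. Since Q is lower triangular, the main condition of row i does not
  lie to the right of that of row j.\<close>

lemma verge_and_rows:
  fixes A B :: "'a::{field, finite} mat"
  assumes sepA: "separated ty n A" and sepB: "separated ty n B"
    and C: "C1 \<in> lower_unitri (mdim ty n)" "C2 \<in> lower_unitri (mdim ty n)"
    and eq: "upper_eq (mdim ty n) (C1 * A - flip ty n (C1 * A)) (C2 * B - flip ty n (C2 * B))"
  shows "verge ty n A = verge ty n B"
    and "\<exists>q\<in>lower_unitri (mdim ty n). upper_eq (mdim ty n) B (q * A) \<and>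
      (\<forall>i<mdim ty n. \<forall>j<mdim ty n. q $$ (j, i) \<noteq> 0 \<longrightarrow> i = j \<or> (Suc i, Suc j) \<in> posI ty n A)"
proof -
  let ?N = "mdim ty n"
  define D where "D = verge ty n A"
  define E where "E = D - flip ty n D"
  obtain G where G: "G \<in> lower_unitri ?N" "A = D * flip ty n G"
    "C1 * A - flip ty n (C1 * A) = G * E * flip ty n G"
    using skew_part_normal_form[OF sepA C(1)] unfolding D_def E_def .
  obtain H where H: "H \<in> lower_unitri ?N" "B = verge ty n B * flip ty n H"
    "C2 * B - flip ty n (C2 * B) = H * (verge ty n B - flip ty n (verge ty n B)) * flip ty n H"
    using skew_part_normal_form[OF sepB C(2)] .
  have mono: "upper_monomial ?N E" "upper_monomial ?N (verge ty n B - flip ty n (verge ty n B))"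
    unfolding E_def D_def by (rule monomial_skew_verge[OF sepA], rule monomial_skew_verge[OF sepB])
  have Ec: "E \<in> carrier_mat ?N ?N" using mono by (simp add: upper_monomial_def)
  obtain M Q where M: "M \<in> lower_unitri ?N" and Q: "Q \<in> lower_unitri ?N"
    and HQ: "flip ty n H = Q * flip ty n G"
    and MQ: "upper_eq ?N (M * E) ((verge ty n B - flip ty n (verge ty n B)) * Q)"
    using normal_form_comparison[OF Ec _ G(1) H(1), of "verge ty n B - flip ty n (verge ty n B)"]
      eq mono(2) unfolding G(3) H(3) upper_monomial_def by blast
  have EE: "E = verge ty n B - flip ty n (verge ty n B)"
    by (rule monomial_unique[OF mono M Q MQ])
  have Dc: "D \<in> carrier_mat ?N ?N" unfolding D_def by (rule verge_mat[OF sepA])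
  have "D = verge ty n B"
  proof (rule eq_matI)
    fix i j assume "i < dim_row (verge ty n B)" "j < dim_col (verge ty n B)"
    then have ij: "i < ?N" "j < ?N" using verge_mat[OF sepB] by auto
    have "D $$ (i, j) = (if i + j + 2 \<le> ?N then E $$ (i, j) else 0)"
      unfolding D_def E_def by (rule skew_verge_determines_verge[OF sepA ij])
    also have "\<dots> = verge ty n B $$ (i, j)"
      unfolding EE by (rule skew_verge_determines_verge[OF sepB ij, symmetric])
    finally show "D $$ (i, j) = verge ty n B $$ (i, j)" .
  qed (use Dc verge_mat[OF sepB] in auto)
  then show "verge ty n A = verge ty n B" by (simp add: D_def)
  note H(2)[folded \<open>D = verge ty n B\<close>] and MQ[folded EE]
  have c: "Q \<in> carrier_mat ?N ?N" "M \<in> carrier_mat ?N ?N" "A \<in> carrier_mat ?N ?N"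
    using Q M separated_mat[OF sepA] by (auto intro: lower_unitri_mat)
  \<comment> \<open>the rows allowed by the normal form\<close>
  have nested: "\<exists>i\<le>j. i < ?N \<and> D $$ (i, k) \<noteq> 0"
    if jm: "D $$ (j, m) \<noteq> 0" "j < ?N" "m < ?N" and k: "Q $$ (m, k) \<noteq> 0" "j < k" "k < ?N" for j m k
  proof -
    have jm2: "j + m + 2 \<le> ?N" using verge_nonzeroD(4)[OF sepA] jm unfolding D_def by blast
    have "k \<le> m" using lower_unitri_nonzeroD[OF Q k(1,3)] .
    have "D $$ (?N - Suc m, ?N - Suc j) = 0"
      using verge_nonzeroD(4)[OF sepA, of "?N - Suc m" "?N - Suc j"] jm(2,3) jm2
      unfolding D_def by force
    then have "E $$ (j, m) = D $$ (j, m)"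
      using jm skew_verge_entry[OF sepA jm(2,3)] unfolding E_def D_def by simp
    then have Ejm: "E $$ (j, m) \<noteq> 0" using jm by simp
    have "(E * Q) $$ (j, k) = E $$ (j, m) * Q $$ (m, k)"
      by (rule monomial_times_entry[OF mono(1) c(1) jm(2,3) Ejm k(3)])
    then have "(M * E) $$ (j, k) \<noteq> 0"
      using MQ[folded EE] k Ejm by (simp add: upper_eq_def)
    then obtain i where i: "i < ?N" "M $$ (j, i) \<noteq> 0" "E $$ (i, k) \<noteq> 0"
      using times_entry_nonzero[OF _ c(2) Ec jm(2) k(3)] by blast
    have "i \<le> j" using lower_unitri_nonzeroD[OF M i(2,1)] .
    \<comment> \<open>the entry (i, k) comes from the verge itself: i and k are too small for the flip\<close>
    have "D $$ (?N - Suc k, ?N - Suc i) = 0"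
    proof (rule ccontr)
      assume "D $$ (?N - Suc k, ?N - Suc i) \<noteq> 0"
      then have "?N - Suc k + (?N - Suc i) + 2 \<le> ?N"
        using verge_nonzeroD(4)[OF sepA, of "?N - Suc k" "?N - Suc i"] i k unfolding D_def by simp
      then show False using \<open>i \<le> j\<close> \<open>k \<le> m\<close> jm2 by linarith
    qed
    then have "D $$ (i, k) \<noteq> 0"
      using skew_verge_nonzero[OF sepA i(3)[unfolded E_def D_def] i(1) k(3)] unfolding D_def by blast
    then show ?thesis using \<open>i \<le> j\<close> i(1) by blast
  qed
  \<comment> \<open>q solves q D = D Q above the diagonal; the pseudoinverse of D divides by its nonzero entries\<close>
  define mc where "mc i = (SOME m. m < ?N \<and> D $$ (i, m) \<noteq> 0)" for i
  have mc: "mc i = m" if "D $$ (i, m) \<noteq> 0" "i < ?N" "m < ?N" for i m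
  proof -
    have "mc i < ?N \<and> D $$ (i, mc i) \<noteq> 0" unfolding mc_def by (rule someI[of _ m]) (use that in simp)
    then show ?thesis using verge_row_unique[OF sepA] that unfolding D_def by blast
  qed
  define q where "q = mat ?N ?N (\<lambda>(j, i). if i = j then 1 else
    if (\<exists>k<?N. D $$ (i, k) \<noteq> 0 \<and> j < k) then (D * Q) $$ (j, mc i) / D $$ (i, mc i) else 0)"
  have qc: "q \<in> carrier_mat ?N ?N" by (simp add: q_def)
  have DQ: "\<exists>m<?N. D $$ (j, m) \<noteq> 0 \<and> Q $$ (m, k) \<noteq> 0" if "(D * Q) $$ (j, k) \<noteq> 0" "j < ?N" "k < ?N" for j k
    using times_entry_nonzero[OF that(1) Dc c(1) that(2,3)] by blast
  have q_pattern: "i = j \<or> i < j \<and> (Suc i, Suc j) \<in> posI ty n A"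
    if q0: "q $$ (j, i) \<noteq> 0" "i < ?N" "j < ?N" for i j
  proof (cases "i = j")
    case False
    then obtain k where k: "k < ?N" "D $$ (i, k) \<noteq> 0" "j < k" "(D * Q) $$ (j, mc i) \<noteq> 0"
      using q0 by (auto simp: q_def split: if_splits)
    then have "(D * Q) $$ (j, k) \<noteq> 0" using mc[OF k(2) q0(2) k(1)] by simp
    then obtain m where m: "m < ?N" "D $$ (j, m) \<noteq> 0" "Q $$ (m, k) \<noteq> 0" using DQ q0 k by blast
    obtain i' where "i' \<le> j" "i' < ?N" "D $$ (i', k) \<noteq> 0"
      using nested[OF m(2) q0(3) m(1) m(3) k(3,1)] by blast
    then have "i \<le> j" using verge_column_unique[OF sepA _ _ _ q0(2) k(1), of i'] k(2)
      unfolding D_def by blast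
    moreover have "k \<le> m" using lower_unitri_nonzeroD[OF Q m(3) k(1)] .
    moreover have "k \<noteq> m"
      using verge_column_unique[OF sepA _ _ q0(2,3) k(1)] k(2) m(2) False unfolding D_def by blast
    ultimately show ?thesis
      using posI_Suc[OF c(3), of i j k m] k(2) m(1,2) q0(3) False unfolding D_def by simp
  qed simp
  have "q \<in> lower_unitri ?N"
    unfolding lower_unitri_iff
  proof (intro conjI allI impI qc)
    fix i j assume "i < j" "j < ?N"
    then show "q $$ (i, j) = 0" using q_pattern[of i j] by auto
  qed (simp add: q_def)
  moreover have "upper_eq ?N B (q * A)"
    unfolding upper_eq_def
  proof (intro allI impI)
    fix j y assume jy: "j < y" "y < ?N"
    then have "j < ?N" by simp
    have qD: "(q * D) $$ (j, k) = (D * Q) $$ (j, k)" if k: "j < k" "k < ?N" for k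
    proof (cases "\<exists>i<?N. D $$ (i, k) \<noteq> 0")
      case True
      then obtain i where i: "i < ?N" "D $$ (i, k) \<noteq> 0" by blast
      have "(q * D) $$ (j, k) = q $$ (j, i) * D $$ (i, k)"
        unfolding times_entry[OF qc Dc \<open>j < ?N\<close> k(2)]
      proof (rule sum_single_term[OF i(1)])
        fix x assume "x < ?N" "x \<noteq> i"
        then have "D $$ (x, k) = 0"
          using verge_column_unique[OF sepA _ _ _ i(1) k(2), of x] i(2) unfolding D_def by blast
        then show "q $$ (j, x) * D $$ (x, k) = 0" by simp
      qed
      also have "\<dots> = (D * Q) $$ (j, k)"
      proof (cases "i = j")
        case False
        then show ?thesis using i k \<open>j < ?N\<close> mc[OF i(2,1) k(2)] by (auto simp: q_def)
      next
        case True
        have "D $$ (j, x) = 0" if "x < ?N" "x \<noteq> k" for x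
          using verge_row_unique[OF sepA _ _ \<open>j < ?N\<close> that(1) k(2)] that(2) i(2) True
          unfolding D_def by blast
        then have "(D * Q) $$ (j, k) = D $$ (j, k) * Q $$ (k, k)"
          unfolding times_entry[OF Dc c(1) \<open>j < ?N\<close> k(2)] by (intro sum_single_term[OF k(2)]) simp
        then show ?thesis using True Q k \<open>j < ?N\<close> by (simp add: q_def lower_unitri_iff)
      qed
      finally show ?thesis .
    next
      case False
      then have "(q * D) $$ (j, k) = 0" unfolding times_entry[OF qc Dc \<open>j < ?N\<close> k(2)] by simp
      moreover have "(D * Q) $$ (j, k) = 0"
        using DQ[OF _ \<open>j < ?N\<close> k(2)] nested[OF _ \<open>j < ?N\<close> _ _ k] False by blast
      ultimately show ?thesis by simp
    qed
    have "B = D * Q * flip ty n G"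
      using H(2)[folded \<open>D = verge ty n B\<close>] unfolding HQ
      by (simp add: assoc_mult_mat[OF Dc c(1) flip_carrier])
    then have "B $$ (j, y) = (\<Sum>k<?N. (D * Q) $$ (j, k) * flip ty n G $$ (k, y))"
      using times_entry[OF mult_carrier_mat[OF Dc c(1)] flip_carrier \<open>j < ?N\<close> jy(2)] by simp
    also have "\<dots> = (\<Sum>k<?N. (q * D) $$ (j, k) * flip ty n G $$ (k, y))"
    proof (intro sum.cong refl)
      fix k assume "k \<in> {..<?N}"
      then show "(D * Q) $$ (j, k) * flip ty n G $$ (k, y) = (q * D) $$ (j, k) * flip ty n G $$ (k, y)"
        using qD[of k] flip_lower_unitri[OF G(1)] jy by (cases "j < k") (auto simp: lower_unitri_iff)
    qed
    also have "\<dots> = (q * D * flip ty n G) $$ (j, y)"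
      using times_entry[OF mult_carrier_mat[OF qc Dc] flip_carrier \<open>j < ?N\<close> jy(2)] by simp
    also have "q * D * flip ty n G = q * A"
      by (subst G(2)) (rule assoc_mult_mat[OF qc Dc flip_carrier])
    finally show "B $$ (j, y) = (q * A) $$ (j, y)" .
  qed
  ultimately show "\<exists>q\<in>lower_unitri ?N. upper_eq ?N B (q * A) \<and>
      (\<forall>i<?N. \<forall>j<?N. q $$ (j, i) \<noteq> 0 \<longrightarrow> i = j \<or> (Suc i, Suc j) \<in> posI ty n A)"
    using q_pattern by blast
qed

section \<open>Pattern matrices in U\<close>

lemma posI_elim:
  fixes A :: "'a::field mat"
  assumes sep: "separated ty n A" and "p \<in> posI ty n A"
  obtains i j where "p = (Suc i, Suc j)" "i < j" "j + j + 3 \<le> mdim ty n"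
proof -
  obtain i' j' a b where p: "p = (i', j')" "(i', j') \<in> pos_T (mdim ty n)" "(j', b) \<in> main ty n A"
    using assms(2) by (auto simp: posI_def)
  obtain j c where j: "j' = Suc j" "b = Suc c" "j < mdim ty n" "c < mdim ty n"
    using p(3) main_subset_P by (blast elim: pos_P_elim)
  have "verge ty n A $$ (j, c) \<noteq> 0"
    using p(3) j verge_nonzero_iff[OF separated_mat[OF sep]] by simp
  then have "j < c" "j + c + 2 \<le> mdim ty n" using verge_nonzeroD(3,4)[OF sep] j by auto
  moreover obtain i where "i' = Suc i" "i < j" using p(2) j(1) by (cases i') (auto simp: pos_T_def)
  ultimately show ?thesis using that p(1) j(1) by simp
qed

lemma posI_subset_P:
  fixes A :: "'a::field mat"
  assumes "separated ty n A" shows "posI ty n A \<subseteq> pos_P ty n"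
proof
  fix p assume "p \<in> posI ty n A"
  then obtain i j where "p = (Suc i, Suc j)" "i < j" "j + j + 3 \<le> mdim ty n"
    using posI_elim[OF assms] by blast
  then show "p \<in> pos_P ty n" by (simp add: pos_P_Suc)
qed

text \<open>The sum of 1 and all q_ji e_ij is the product, over the columns j in decreasing order, of the sums of 1 and the
  q_ji e_ij in column j, hence a product of elementary matrices. Their counterparts in U have the same upper rows.\<close>

lemma pattern_realised:
  fixes A :: "'a::{field, finite} mat"
  assumes sep: "separated ty n A" and "S \<subseteq> posI ty n A"
  shows "\<exists>g\<in>U_I ty n A. \<forall>i j. i + i + 2 \<le> mdim ty n \<longrightarrow> j < mdim ty n \<longrightarrow>
    g $$ (i, j) = of_bool (i = j) + (if (Suc i, Suc j) \<in> S then q j i else (0 :: 'a))"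
proof -
  let ?N = "mdim ty n"
  have sub: "subgroup (U_I ty n A) (unitri ?N)"
    unfolding U_I_def by (rule subgroup_gen_subgroup[OF posI_subset_P[OF sep]])
  have "finite S"
    by (rule finite_subset[of _ "{..?N} \<times> {..?N}"]) (use assms(2) in \<open>auto simp: posI_def pos_T_def\<close>)
  then show ?thesis using assms(2)
  proof (induction S rule: finite_ranking_induct[where f = snd])
    case empty
    show ?case by (rule bexI[of _ "1\<^sub>m ?N"]) (use subgroup.one_closed[OF sub] in auto)
  next
    case (insert p S)
    show ?case
    proof (cases "p \<in> S")
      case True
      then show ?thesis using insert by (simp add: insert_absorb)
    next
      case False
      obtain g where g: "g \<in> U_I ty n A" and g_entry: "\<And>i j. i + i + 2 \<le> ?N \<Longrightarrow> j < ?N \<Longrightarrow>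
          g $$ (i, j) = of_bool (i = j) + (if (Suc i, Suc j) \<in> S then q j i else 0)"
        using insert.IH insert.prems by auto
      have gc: "g \<in> carrier_mat ?N ?N" by (rule unitri_mat[OF subgroup.mem_carrier[OF sub g]])
      obtain r c where rc: "p = (Suc r, Suc c)" "r < c" "c + c + 3 \<le> ?N"
        using posI_elim[OF sep] insert.prems by blast
      have pP: "(Suc r, Suc c) \<in> pos_P ty n" using rc by (simp add: pos_P_Suc)
      define x where "x = (root_elt ty n (Suc r) (Suc c) (q c r) :: 'a mat)"
      have x: "x \<in> U_I ty n A"
        unfolding x_def U_I_def by (rule root_elt_in_gen) (use insert.prems rc in simp)
      have xc: "x \<in> carrier_mat ?N ?N" by (simp add: x_def)
      have "(x * g) $$ (i, j) = of_bool (i = j) + (if (Suc i, Suc j) \<in> insert p S then q j i else 0)"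
        if i: "i + i + 2 \<le> ?N" and j: "j < ?N" for i j
      proof -
        have "i < ?N" using i by simp
        have quad: "root_quad ty n c \<beta> = 0" for \<beta> :: 'a
          using rc(3) by (auto simp: root_quad_def mdim_def)
        have "x $$ (i, k) = of_bool (k = i) + q c r * of_bool (i = r \<and> k = c)" if "k < ?N" for k
          using root_elt_entry[OF pP \<open>i < ?N\<close> that, of "q c r"] i rc(3)
          by (auto simp: x_def quad)
        then have "(x * g) $$ (i, j) = (\<Sum>k<?N. (if k = i then g $$ (k, j) else 0)
            + (if k = c then q c r * of_bool (i = r) * g $$ (k, j) else 0))"
          unfolding times_entry[OF xc gc \<open>i < ?N\<close> j] by (intro sum.cong refl) (auto simp: algebra_simps)
        also have "\<dots> = g $$ (i, j) + q c r * of_bool (i = r) * g $$ (c, j)"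
          using \<open>i < ?N\<close> rc(3) by (simp add: sum.distrib)
        also have "g $$ (c, j) = of_bool (c = j)"
        proof -
          \<comment> \<open>no position of S lies in row c, since the columns in S are at most c\<close>
          have "(Suc c, Suc j) \<notin> S"
          proof
            assume S: "(Suc c, Suc j) \<in> S"
            then have "Suc j \<le> Suc c" using insert.hyps rc(1) by fastforce
            moreover have "c < j" using posI_elim[OF sep, of "(Suc c, Suc j)"] S insert.prems by auto
            ultimately show False by simp
          qed
          then show ?thesis using g_entry[of c j] rc(3) j by simp
        qed
        finally show ?thesis using g_entry[OF i j] False rc by auto
      qed
      moreover have "x * g \<in> U_I ty n A" using subgroup.m_closed[OF sub x g] by simp
      ultimately show ?thesis by blast
    qed
  qed
qed

text \<open>B has nonzero rows only in the upper half, and there the elements found above have the prescribed entries.\<close>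

lemma pattern_left_action:
  fixes A B q :: "'a::{field, finite} mat"
  assumes sepA: "separated ty n A" and sepB: "separated ty n B"
    and q: "q \<in> lower_unitri (mdim ty n)"
    and pattern: "\<forall>i<mdim ty n. \<forall>j<mdim ty n. q $$ (j, i) \<noteq> 0 \<longrightarrow> i = j \<or> (Suc i, Suc j) \<in> posI ty n A"
  obtains g where "g \<in> U_I ty n A" "inv_transp (mdim ty n) g * B = q * B"
proof -
  let ?N = "mdim ty n"
  have sub: "subgroup (U_I ty n A) (unitri ?N)"
    unfolding U_I_def by (rule subgroup_gen_subgroup[OF posI_subset_P[OF sepA]])
  obtain h where h: "h \<in> U_I ty n A" and h_entry: "\<And>i j. i + i + 2 \<le> ?N \<Longrightarrow> j < ?N \<Longrightarrow>
      h $$ (i, j) = of_bool (i = j) + (if (Suc i, Suc j) \<in> posI ty n A then q $$ (j, i) else 0)"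
    using pattern_realised[OF sepA order_refl, of "\<lambda>j i. q $$ (j, i)"] by blast
  have hU: "h \<in> carrier (unitri ?N)" by (rule subgroup.mem_carrier[OF sub h])
  have c: "h \<in> carrier_mat ?N ?N" "B \<in> carrier_mat ?N ?N" "q \<in> carrier_mat ?N ?N"
    using unitri_mat[OF hU] separated_mat[OF sepB] lower_unitri_mat[OF q] by auto
  let ?g = "inv\<^bsub>unitri ?N\<^esub> h"
  have inv: "inv_transp ?N ?g = transpose_mat h" by (simp add: inv_transp_def unitri_inv_inv[OF hU])
  have "transpose_mat h * B = q * B"
  proof (rule eq_matI)
    fix j y assume "j < dim_row (q * B)" "y < dim_col (q * B)"
    then have jy: "j < ?N" "y < ?N" using c by auto
    have "transpose_mat h $$ (j, i) * B $$ (i, y) = q $$ (j, i) * B $$ (i, y)" if "i < ?N" for i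
    proof (cases "B $$ (i, y) = 0")
      case False
      then have "(Suc i, Suc y) \<in> pos_P0 ty n"
        using sepB that jy by (auto simp: separated_def mats_on_iff)
      then have "i + i + 2 \<le> ?N" by (auto simp: pos_P0_Suc)
      then have h_ij: "h $$ (i, j) = of_bool (i = j) + (if (Suc i, Suc j) \<in> posI ty n A then q $$ (j, i) else 0)"
        using h_entry jy by blast
      have "(Suc i, Suc i) \<notin> posI ty n A" by (auto simp: posI_def pos_T_def)
      then have "h $$ (i, j) = q $$ (j, i)"
        using h_ij pattern q that jy by (cases "i = j") (auto simp: lower_unitri_iff)
      then show ?thesis using c that jy by simp
    qed simp
    then have "(\<Sum>i<?N. transpose_mat h $$ (j, i) * B $$ (i, y)) = (\<Sum>i<?N. q $$ (j, i) * B $$ (i, y))"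
      by (intro sum.cong refl) (simp only: lessThan_iff)
    then show "(transpose_mat h * B) $$ (j, y) = (q * B) $$ (j, y)"
      using c jy by (simp add: times_entry[where N = ?N])
  qed (use c in auto)
  moreover have "?g \<in> U_I ty n A" by (rule subgroup.m_inv_closed[OF sub h])
  ultimately show ?thesis using that inv by metis
qed

text \<open>Both matrices are the common verge times a lower unitriangular matrix, so one is a right translate
  of the other under all unitriangular matrices.\<close>

lemma orbitT_subset:
  fixes A B :: "'a::{field, finite} mat"
  assumes sep: "separated ty n A" "separated ty n B" and verge: "verge ty n A = verge ty n B"
  shows "orbitT \<theta> ty n A \<subseteq> orbitT \<theta> ty n B"
proof
  let ?N = "mdim ty n" and ?D = "verge ty n A"
  fix \<chi> assume "\<chi> \<in> orbitT \<theta> ty n A"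
  then obtain g where g: "g \<in> carrier (unitri ?N)"
    and \<chi>: "\<chi> = lin_char \<theta> ?N (pos_T ?N) (proj (pos_T ?N) (A * inv_transp ?N g))"
    by (auto simp: orbitT_def char_dot_right_def)
  obtain L where L: "L \<in> lower_unitri ?N" "A = ?D * L" using verge_factor[OF sep(1)] .
  obtain K where K: "K \<in> lower_unitri ?N" "B = ?D * K" using verge_factor[OF sep(2)] unfolding verge .
  obtain K' where K': "K' \<in> lower_unitri ?N" "K * K' = 1\<^sub>m ?N" using lower_unitri_inverse[OF K(1)] by metis
  have gl: "inv_transp ?N g \<in> lower_unitri ?N"
    unfolding inv_transp_def by (intro lower_unitri_transpose unitri_inv_closed g)
  define R where "R = K' * (L * inv_transp ?N g)"
  have R: "R \<in> lower_unitri ?N" unfolding R_def by (intro lower_unitri_times K' L gl)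
  have c: "?D \<in> carrier_mat ?N ?N" "L \<in> carrier_mat ?N ?N" "K \<in> carrier_mat ?N ?N" "K' \<in> carrier_mat ?N ?N"
    "inv_transp ?N g \<in> carrier_mat ?N ?N" "R \<in> carrier_mat ?N ?N"
    using verge_mat[OF sep(1)] L(1) K(1) K'(1) gl R by (auto intro: lower_unitri_mat)
  have "K * R = L * inv_transp ?N g"
    unfolding R_def using c by (intro cancel_left[OF K'(2)]) auto
  then have BR: "B * R = A * inv_transp ?N g"
    by (subst K(2), subst L(2)) (use c in \<open>simp add: assoc_mult_mat[of _ ?N ?N _ ?N _ ?N]\<close>)
  define h where "h = inv\<^bsub>unitri ?N\<^esub> (transpose_mat R)"
  have RU: "transpose_mat R \<in> carrier (unitri ?N)" using R by (simp add: lower_unitri_def)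
  have "inv_transp ?N h = R" by (simp add: inv_transp_def h_def unitri_inv_inv[OF RU])
  then have "\<chi> = char_dot_right \<theta> ?N (pos_T ?N) B h" by (simp add: \<chi> char_dot_right_def BR)
  moreover have "h \<in> carrier (unitri ?N)" unfolding h_def by (rule unitri_inv_closed[OF RU])
  ultimately show "\<chi> \<in> orbitT \<theta> ty n B" unfolding orbitT_def by blast
qed

section \<open>Orbit modules as monomial modules\<close>

lemma lookup_cscale: "Poly_Mapping.lookup (cscale c v) k = c * Poly_Mapping.lookup v k"
  by (simp add: cscale_def map.rep_eq when_def)

lemma cscale_add: "cscale c (v + w) = cscale c v + cscale c w"
  by (rule poly_mapping_eqI) (simp add: lookup_cscale lookup_add distrib_left)

lemma cscale_single: "cscale c (Poly_Mapping.single k z) = Poly_Mapping.single k (c * z)"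
  by (rule poly_mapping_eqI) (simp add: lookup_cscale lookup_single when_def)

lemma cscale_zero [simp]: "cscale c 0 = 0"
  by (rule poly_mapping_eqI) (simp add: lookup_cscale)

lemma cscale_sum: "cscale c (\<Sum>x\<in>X. F x) = (\<Sum>x\<in>X. cscale c (F x))"
  by (induction X rule: infinite_finite_induct) (simp_all add: cscale_add)

lemma sum_singles: "(\<Sum>k\<in>Poly_Mapping.keys v. Poly_Mapping.single k (Poly_Mapping.lookup v k)) = v"
  by (rule poly_mapping_eqI)
    (auto simp: lookup_sum lookup_single when_def in_keys_iff sum.delta)

lemma cspan_add: "v \<in> cspan_of X \<Longrightarrow> w \<in> cspan_of X \<Longrightarrow> v + w \<in> cspan_of X"
  using Poly_Mapping.keys_add[of v w] by (auto simp: cspan_of_def)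

lemma cspan_zero [simp]: "0 \<in> cspan_of X"
  by (simp add: cspan_of_def)

lemma cspan_single: "k \<in> X \<Longrightarrow> Poly_Mapping.single k z \<in> cspan_of X"
  by (simp add: cspan_of_def)

lemma cspan_sum: "(\<And>x. x \<in> Y \<Longrightarrow> F x \<in> cspan_of X) \<Longrightarrow> (\<Sum>x\<in>Y. F x) \<in> cspan_of X"
  by (induction Y rule: infinite_finite_induct) (auto intro: cspan_add)

lemma cspan_cscale: "v \<in> cspan_of X \<Longrightarrow> cscale c v \<in> cspan_of X"
  by (auto simp: cspan_of_def in_keys_iff lookup_cscale)

lemma cspan_induct [consumes 1, case_names zero add single]:
  assumes "v \<in> cspan_of X" and "Q 0" and "\<And>v w. v \<in> cspan_of X \<Longrightarrow> w \<in> cspan_of X \<Longrightarrow> Q v \<Longrightarrow> Q w \<Longrightarrow> Q (v + w)"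
    and "\<And>k z. k \<in> X \<Longrightarrow> Q (Poly_Mapping.single k z)"
  shows "Q v"
proof -
  have "Q (\<Sum>k\<in>K. Poly_Mapping.single k (Poly_Mapping.lookup v k))" if "finite K" "K \<subseteq> X" for K
    using that by (induction K rule: finite_induct)
      (auto intro!: assms(2-4) cspan_single cspan_sum)
  then have "Q (\<Sum>k\<in>Poly_Mapping.keys v. Poly_Mapping.single k (Poly_Mapping.lookup v k))"
    using assms(1) by (simp add: cspan_of_def)
  then show ?thesis by (simp only: sum_singles)
qed

lemma alg_act_single:
  "alg_act \<theta> ty n v (Poly_Mapping.single u c) = cscale c (act \<theta> ty n v u)"
proof (cases "c = 0")
  case True
  then have "cscale c (act \<theta> ty n v u) = 0" by (intro poly_mapping_eqI) (simp add: lookup_cscale)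
  then show ?thesis using True by (simp add: alg_act_def)
qed (simp add: alg_act_def)

context orbit_modules
begin

abbreviation \<chi> :: "'a mat \<Rightarrow> 'a mat \<Rightarrow> complex" where "\<chi> \<equiv> charV \<theta> ty n"

definition orb :: "'a mat \<Rightarrow> 'a mat set" where
  "orb A = dot A ` U"

lemma orbitV_orb: "orbitV \<theta> ty n A = \<chi> ` orb A"
  by (auto simp: orbitV_def orb_def charV_right_dot)

lemma orb_subset_V: "A \<in> V \<Longrightarrow> orb A \<subseteq> V"
  by (auto simp: orb_def intro: dot_closed grpU_unitri)

lemma orb_self: "A \<in> V \<Longrightarrow> A \<in> orb A"
  unfolding orb_def using grpU_one dot_one by (metis imageI)

lemma finite_U: "finite U"
  by (rule finite_subset[OF _ finite_carrier_mat[of N]]) (auto intro: unitri_mat grpU_unitri)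

lemma finite_orb: "finite (orb A)"
  by (simp add: orb_def finite_U)

lemma dot_orb: "A \<in> V \<Longrightarrow> D \<in> orb A \<Longrightarrow> u \<in> U \<Longrightarrow> dot D u \<in> orb A"
  unfolding orb_def by (auto simp flip: dot_times simp: grpU_unitri intro!: imageI grpU_times)

lemma orb_eq:
  assumes "A \<in> V" "B \<in> orb A" shows "orb B = orb A"
proof -
  obtain u where u: "u \<in> U" "B = dot A u" using assms(2) by (auto simp: orb_def)
  have uT: "u \<in> UT" by (rule grpU_unitri[OF u(1)])
  have "orb B \<subseteq> orb A" using dot_orb[OF assms] by (auto simp: orb_def[of B])
  moreover have "dot A v \<in> orb B" if "v \<in> U" for v
  proof -
    have vT: "v \<in> UT" by (rule grpU_unitri[OF that])
    have "dot A v = dot B (minv u * v)"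
      using assms(1) uT vT dot_closed[OF assms(1) uT] by (simp add: u(2) dot_times dot_inv minv_closed)
    then show ?thesis using grpU_times[OF grpU_inv[OF u(1)] that] by (auto simp: orb_def)
  qed
  ultimately show ?thesis by (auto simp: orb_def[of A])
qed

lemma lookup_act:
  assumes "B \<in> V" "g \<in> UT"
  shows "Poly_Mapping.lookup (act \<theta> ty n v g) (\<chi> (dot B g)) = Poly_Mapping.lookup v (\<chi> B) * co B g"
proof -
  have inj: "dot D g = dot B g \<longleftrightarrow> D = B" if "D \<in> V" for D
    using dot_inv(1)[OF that assms(2)] dot_inv(1)[OF assms] by metis
  have "Poly_Mapping.lookup (act \<theta> ty n v g) (\<chi> (dot B g)) =
      (\<Sum>D\<in>V. if D = B then Poly_Mapping.lookup v (\<chi> D) * co D g else 0)"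
    unfolding act_def lookup_sum
    by (intro sum.cong refl)
      (simp add: charV_right_dot lookup_single when_def charV_eq_iff dot_closed assms inj theta_kappa)
  then show ?thesis using assms(1) by (simp add: finite_spV)
qed

lemma agree_sym: "agree A B \<Longrightarrow> agree B A"
  by (auto simp: agree_def)

text \<open>With y = u^-1 x u one has u y = x u, and evaluating the cocycle at this element in two ways gives the same scalar
  to y at [D].u and to x at [D].\<close>

lemma agree_translate:
  assumes A: "A \<in> V" and E: "E \<in> V" and u: "u \<in> U" and agree: "agree (dot A u) E"
  shows "agree A (dot E (minv u))"
  unfolding agree_def
proof (intro ballI impI)
  fix x assume x: "x \<in> U" "dot A x = A" "dot (dot E (minv u)) x = dot E (minv u)"
  define y where "y = minv u * (x * u)"
  have T: "u \<in> UT" "x \<in> UT" "minv u \<in> UT" using u x grpU_unitri grpU_inv by blast+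
  have yU: "y \<in> U" unfolding y_def by (intro grpU_times grpU_inv u x)
  have yT: "y \<in> UT" by (rule grpU_unitri[OF yU])
  have uy: "u * y = x * u"
    unfolding y_def using T
    by (intro cancel_left[OF unitri_r_inv]) (auto intro: unitri_mat unitri_times mult_carrier_mat)
  have conj: "dot (dot D u) y = dot D u \<and> co (dot D u) y = co D x" if D: "D \<in> V" "dot D x = D" for D
  proof
    have "dot (dot D u) y = dot D (x * u)" using D T yT by (simp flip: dot_times uy)
    then show "dot (dot D u) y = dot D u" using D T by (simp add: dot_times)
    have "co D u * co (dot D u) y = co D (x * u)" using D T yT by (simp flip: co_times uy)
    also have "\<dots> = co D u * co D x" using D T by (simp add: co_times)
    finally show "co (dot D u) y = co D x" by simp
  qed
  have "dot E (minv u) \<in> V" "dot (dot E (minv u)) u = E"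
    using E T by (auto intro: dot_closed simp: dot_inv)
  then show "co A x = co (dot E (minv u)) x"
    using conj[OF A x(2)] conj[of "dot E (minv u)"] x(3) agree yU by (metis agree_def)
qed

section \<open>Modules induced from equal characters of equal stabilisers\<close>

text \<open>Equality of the data from which the two orbit modules are induced.\<close>

definition same_datum :: "'a mat \<Rightarrow> 'a mat \<Rightarrow> bool" where
  "same_datum A B \<longleftrightarrow> A \<in> V \<and> B \<in> V \<and> (\<forall>u\<in>U. dot A u = A \<longleftrightarrow> dot B u = B) \<and> agree A B"

lemma same_datum_sym: "same_datum A B \<Longrightarrow> same_datum B A"
  using agree_sym by (auto simp: same_datum_def)

text \<open>Two elements translating [A] to the same character differ by an element of the common stabiliser, on which the two
  linear characters cancel.\<close>

lemma same_datum_translate: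
  assumes AB: "same_datum A B" and u: "u \<in> U" "v \<in> U" and eq: "dot A u = dot A v"
  shows "dot B u = dot B v" "co B u / co A u = co B v / co A v"
proof -
  have V: "A \<in> V" "B \<in> V" using AB by (auto simp: same_datum_def)
  have T: "u \<in> UT" "v \<in> UT" "minv v \<in> UT" using u grpU_unitri grpU_inv by blast+
  define s where "s = u * minv v"
  have s: "s \<in> U" unfolding s_def by (intro grpU_times grpU_inv u)
  have sT: "s \<in> UT" by (rule grpU_unitri[OF s])
  have sv: "s * v = u"
    unfolding s_def using T unitri_l_inv[OF T(2)]
    by (subst assoc_mult_mat[of _ N N _ N _ N]) (auto intro: unitri_mat simp: right_mult_one_mat[OF unitri_mat])
  have "dot A s = A" unfolding s_def using V T eq by (simp add: dot_times dot_inv)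
  then have st: "dot A s = A" "dot B s = B" "co A s = co B s"
    using AB s by (auto simp: same_datum_def agree_def)
  show "dot B u = dot B v" using dot_times[OF V(2) sT T(2)] st by (simp add: sv)
  show "co B u / co A u = co B v / co A v"
    using co_times[OF V(1) sT T(2)] co_times[OF V(2) sT T(2)] st by (simp add: sv)
qed

definition orbit_rep :: "'a mat \<Rightarrow> ('a mat \<Rightarrow> complex) \<Rightarrow> 'a mat" where
  "orbit_rep A c = (SOME u. u \<in> U \<and> \<chi> (dot A u) = c)"

text \<open>The map [A] u \<mapsto> [B] u. In the bases of characters it acquires the factor \<open>co B u / co A u\<close>, which by
  \<open>same_datum_translate\<close> depends only on [A].u, as does [B].u.\<close>

definition transfer :: "'a mat \<Rightarrow> 'a mat \<Rightarrow> (('a mat \<Rightarrow> complex) \<Rightarrow>\<^sub>0 complex) \<Rightarrow> (('a mat \<Rightarrow> complex) \<Rightarrow>\<^sub>0 complex)" where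
  "transfer A B v = (\<Sum>c\<in>orbitV \<theta> ty n A. Poly_Mapping.single (\<chi> (dot B (orbit_rep A c)))
     (Poly_Mapping.lookup v c * (co B (orbit_rep A c) / co A (orbit_rep A c))))"

lemma transfer_add: "transfer A B (v + w) = transfer A B v + transfer A B w"
  by (simp add: transfer_def lookup_add distrib_right add_divide_distrib single_add sum.distrib)

lemma transfer_zero: "transfer A B 0 = 0"
  by (simp add: transfer_def)

lemma transfer_sum: "transfer A B (\<Sum>x\<in>X. F x) = (\<Sum>x\<in>X. transfer A B (F x))"
  by (induction X rule: infinite_finite_induct) (simp_all add: transfer_add transfer_zero)

lemma transfer_cscale: "transfer A B (cscale c v) = cscale c (transfer A B v)"
  by (simp add: transfer_def cscale_sum cscale_single lookup_cscale mult_ac)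

lemma transfer_single:
  assumes AB: "same_datum A B" and u: "u \<in> U"
  shows "transfer A B (Poly_Mapping.single (\<chi> (dot A u)) z)
    = Poly_Mapping.single (\<chi> (dot B u)) (z * (co B u / co A u))"
proof -
  let ?c = "\<chi> (dot A u)" and ?r = "orbit_rep A (\<chi> (dot A u))"
  have V: "A \<in> V" "B \<in> V" using AB by (auto simp: same_datum_def)
  have r: "?r \<in> U" "\<chi> (dot A ?r) = ?c"
    using someI[of "\<lambda>v. v \<in> U \<and> \<chi> (dot A v) = ?c" u] u by (auto simp: orbit_rep_def)
  then have "dot A ?r = dot A u"
    using V u by (subst (asm) charV_eq_iff) (auto intro: dot_closed grpU_unitri)
  note eq = same_datum_translate[OF AB r(1) u this]
  have "?c \<in> orbitV \<theta> ty n A" using u by (auto simp: orbitV_orb orb_def)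
  moreover have "finite (orbitV \<theta> ty n A)" by (simp add: orbitV_orb finite_orb)
  moreover have "transfer A B (Poly_Mapping.single ?c z) = (\<Sum>c\<in>orbitV \<theta> ty n A.
      if c = ?c then Poly_Mapping.single (\<chi> (dot B ?r)) (z * (co B ?r / co A ?r)) else 0)"
    unfolding transfer_def by (intro sum.cong refl) (auto simp: lookup_single when_def)
  ultimately show ?thesis using eq by simp
qed

lemma orbitV_elim:
  assumes "c \<in> orbitV \<theta> ty n A" obtains u where "u \<in> U" "c = \<chi> (dot A u)"
  using assms by (auto simp: orbitV_orb orb_def)

lemma orbitV_mem: "u \<in> U \<Longrightarrow> \<chi> (dot A u) \<in> orbitV \<theta> ty n A"
  by (auto simp: orbitV_orb orb_def)

lemma act_orbit_module:
  assumes "A \<in> V" "w \<in> U" "v \<in> orbit_module \<theta> ty n A"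
  shows "act \<theta> ty n v w \<in> orbit_module \<theta> ty n A"
  using assms(3)
proof (induction rule: cspan_induct)
  case (single k z)
  then obtain u where u: "u \<in> U" "k = \<chi> (dot A u)" by (rule orbitV_elim)
  have T: "u \<in> UT" "w \<in> UT" using u assms grpU_unitri by blast+
  show ?case
    unfolding u(2) using assms T u
    by (simp add: act_single dot_closed) (simp flip: dot_times add: cspan_single orbitV_mem grpU_times)
qed (auto simp: act_zero act_add intro: cspan_add)

lemma alg_act_orbit_module:
  assumes "A \<in> V" "x \<in> cspan_of U" "v \<in> orbit_module \<theta> ty n A"
  shows "alg_act \<theta> ty n v x \<in> orbit_module \<theta> ty n A"
  unfolding alg_act_def
  by (intro cspan_sum cspan_cscale act_orbit_module) (use assms in \<open>auto simp: cspan_of_def\<close>)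

lemma transfer_orbit_module:
  assumes "same_datum A B" "v \<in> orbit_module \<theta> ty n A"
  shows "transfer A B v \<in> orbit_module \<theta> ty n B"
  using assms(2)
proof (induction rule: cspan_induct)
  case (single k z)
  then obtain u where u: "u \<in> U" "k = \<chi> (dot A u)" by (rule orbitV_elim)
  then show ?case using assms(1) by (simp add: transfer_single cspan_single orbitV_mem)
qed (auto simp: transfer_zero transfer_add intro: cspan_add)

lemma transfer_act:
  assumes AB: "same_datum A B" and w: "w \<in> U" and "v \<in> orbit_module \<theta> ty n A"
  shows "transfer A B (act \<theta> ty n v w) = act \<theta> ty n (transfer A B v) w"
  using assms(3)
proof (induction rule: cspan_induct)
  case (single k z)
  then obtain u where u: "u \<in> U" "k = \<chi> (dot A u)" by (rule orbitV_elim)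
  have V: "A \<in> V" "B \<in> V" using AB by (auto simp: same_datum_def)
  have T: "u \<in> UT" "w \<in> UT" using u w grpU_unitri by blast+
  have "transfer A B (act \<theta> ty n (Poly_Mapping.single k z) w)
      = Poly_Mapping.single (\<chi> (dot B (u * w))) (z * co (dot A u) w * (co B (u * w) / co A (u * w)))"
    unfolding u(2) using AB V T u(1) w
    by (simp add: act_single dot_closed flip: dot_times) (simp add: transfer_single grpU_times)
  also have "z * co (dot A u) w * (co B (u * w) / co A (u * w)) = z * (co B u / co A u) * co (dot B u) w"
    using V T by (simp add: co_times)
  also have "Poly_Mapping.single (\<chi> (dot B (u * w))) \<dots> = act \<theta> ty n (transfer A B (Poly_Mapping.single k z)) w"
    unfolding u(2) using AB V T u(1) by (simp add: transfer_single act_single dot_closed dot_times)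
  finally show ?case .
qed (simp_all add: transfer_zero transfer_add act_zero act_add)

lemma transfer_alg_act:
  assumes "same_datum A B" "x \<in> cspan_of U" "v \<in> orbit_module \<theta> ty n A"
  shows "transfer A B (alg_act \<theta> ty n v x) = alg_act \<theta> ty n (transfer A B v) x"
  unfolding alg_act_def transfer_sum
proof (intro sum.cong refl)
  fix u assume "u \<in> Poly_Mapping.keys x"
  then have "u \<in> U" using assms(2) by (auto simp: cspan_of_def)
  then show "transfer A B (cscale (Poly_Mapping.lookup x u) (act \<theta> ty n v u))
      = cscale (Poly_Mapping.lookup x u) (act \<theta> ty n (transfer A B v) u)"
    using assms by (simp add: transfer_cscale transfer_act)
qed

lemma transfer_inverse:
  assumes AB: "same_datum A B" and "v \<in> orbit_module \<theta> ty n A"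
  shows "transfer B A (transfer A B v) = v"
  using assms(2)
proof (induction rule: cspan_induct)
  case (single k z)
  then obtain u where u: "u \<in> U" "k = \<chi> (dot A u)" by (rule orbitV_elim)
  then show ?case
    using transfer_single[OF AB u(1)] transfer_single[OF same_datum_sym[OF AB] u(1)] by simp
qed (simp_all add: transfer_zero transfer_add)

lemma same_datum_iso:
  assumes AB: "same_datum A B"
  shows "iso_CU \<theta> ty n (orbit_module \<theta> ty n A) (orbit_module \<theta> ty n B)"
proof -
  let ?M = "orbit_module \<theta> ty n A" and ?M' = "orbit_module \<theta> ty n B"
  define f where "f = restrict (transfer A B) ?M"
  have V: "A \<in> V" using AB by (simp add: same_datum_def)
  have "f \<in> Hom_CU \<theta> ty n ?M ?M'"
    unfolding Hom_CU_def mem_Collect_eq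
  proof (intro conjI ballI)
    show "f \<in> ?M \<rightarrow>\<^sub>E ?M'" using transfer_orbit_module[OF AB] by (auto simp: f_def)
  qed (use AB V in \<open>simp_all add: f_def cspan_add transfer_add alg_act_orbit_module transfer_alg_act\<close>)
  moreover have "bij_betw f ?M ?M'"
  proof (rule bij_betw_byWitness[where f' = "transfer B A"])
    show "\<forall>v\<in>?M. transfer B A (f v) = v" using transfer_inverse[OF AB] by (simp add: f_def)
    show "\<forall>v\<in>?M'. f (transfer B A v) = v"
      using transfer_inverse[OF same_datum_sym[OF AB]] transfer_orbit_module[OF same_datum_sym[OF AB]]
      by (simp add: f_def)
    show "f ` ?M \<subseteq> ?M'" using transfer_orbit_module[OF AB] by (auto simp: f_def)
    show "transfer B A ` ?M' \<subseteq> ?M" using transfer_orbit_module[OF same_datum_sym[OF AB]] by auto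
  qed
  ultimately show ?thesis unfolding iso_CU_def by blast
qed

section \<open>Homomorphisms and inner products detect agreeing stabiliser characters\<close>

lemma zero_in_Hom: "(\<lambda>v\<in>orbit_module \<theta> ty n A. 0) \<in> Hom_CU \<theta> ty n (orbit_module \<theta> ty n A) (orbit_module \<theta> ty n C)"
  if "A \<in> V"
proof -
  have "alg_act \<theta> ty n 0 x = 0" for x by (simp add: alg_act_def act_zero)
  then show ?thesis using that by (simp add: Hom_CU_def cspan_add alg_act_orbit_module)
qed

text \<open>The orbit module is generated by [A], so a homomorphism is determined by the image of [A].\<close>

lemma Hom_generator_nonzero:
  assumes A: "A \<in> V" and f: "f \<in> Hom_CU \<theta> ty n (orbit_module \<theta> ty n A) M'"
    and zero: "f (Poly_Mapping.single (\<chi> A) 1) = 0" and v: "v \<in> orbit_module \<theta> ty n A"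
  shows "f v = 0"
proof -
  have f_add: "f (v + w) = f v + f w" if "v \<in> orbit_module \<theta> ty n A" "w \<in> orbit_module \<theta> ty n A" for v w
    using f that by (auto simp: Hom_CU_def)
  have gen: "Poly_Mapping.single (\<chi> A) 1 \<in> orbit_module \<theta> ty n A"
    using orbitV_mem[OF grpU_one, of A] A by (simp add: dot_one cspan_single)
  from v show ?thesis
  proof (induction rule: cspan_induct)
    case zero
    show ?case using f_add[of 0 0] by simp
  next
    case (add v w)
    then show ?case by (simp add: f_add)
  next
    case (single k z)
    then obtain u where u: "u \<in> U" "k = \<chi> (dot A u)" by (rule orbitV_elim)
    let ?x = "Poly_Mapping.single u (z / co A u)"
    have "Poly_Mapping.single k z = alg_act \<theta> ty n (Poly_Mapping.single (\<chi> A) 1) ?x"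
      using A u grpU_unitri[OF u(1)] by (simp add: alg_act_single act_single cscale_single)
    also have "f \<dots> = alg_act \<theta> ty n 0 ?x"
      using f gen cspan_single[OF u(1)] zero by (simp add: Hom_CU_def)
    also have "\<dots> = 0" by (simp add: alg_act_def act_zero)
    finally show ?case .
  qed
qed

text \<open>Let [B] occur in the image w of [A]. For u in the common stabiliser, w u is Psi_A(u) w, while u multiplies the
  coefficient of w at [B] by Psi_B(u).\<close>

lemma Hom_nonzero_agree:
  assumes A: "A \<in> V" and C: "C \<in> V"
    and hom: "Hom_CU \<theta> ty n (orbit_module \<theta> ty n A) (orbit_module \<theta> ty n C) \<noteq> {\<lambda>v\<in>orbit_module \<theta> ty n A. 0}"
  shows "\<exists>B\<in>orb C. agree A B"
proof -
  let ?M = "orbit_module \<theta> ty n A" and ?M' = "orbit_module \<theta> ty n C"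
  let ?a = "Poly_Mapping.single (\<chi> A) (1 :: complex)"
  obtain f where f: "f \<in> Hom_CU \<theta> ty n ?M ?M'" "f \<noteq> (\<lambda>v\<in>?M. 0)"
    using hom zero_in_Hom[OF A] by blast
  have gen: "?a \<in> ?M" using orbitV_mem[OF grpU_one, of A] A by (simp add: dot_one cspan_single)
  have hom_act: "f (alg_act \<theta> ty n v x) = alg_act \<theta> ty n (f v) x" if "v \<in> ?M" "x \<in> cspan_of U" for v x
    using f(1) that by (simp add: Hom_CU_def)
  define w where "w = f ?a"
  have "w \<noteq> 0"
  proof
    assume "w = 0"
    then have "f v = 0" if "v \<in> ?M" for v using Hom_generator_nonzero[OF A f(1) _ that] by (simp add: w_def)
    then have "f = (\<lambda>v\<in>?M. 0)"
      using f(1) by (intro extensionalityI[where A = ?M]) (auto simp: Hom_CU_def PiE_def)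
    then show False using f(2) by simp
  qed
  then obtain k where k: "Poly_Mapping.lookup w k \<noteq> 0" by (metis poly_mapping_eqI lookup_zero)
  have "w \<in> ?M'" using f(1) gen by (auto simp: w_def Hom_CU_def)
  then have "k \<in> orbitV \<theta> ty n C" using k by (auto simp: cspan_of_def in_keys_iff)
  then obtain B where B: "B \<in> orb C" "k = \<chi> B" by (auto simp: orbitV_orb)
  have BV: "B \<in> V" using B orb_subset_V[OF C] by blast
  have "agree A B"
    unfolding agree_def
  proof (intro ballI impI)
    fix u assume u: "u \<in> U" "dot A u = A" "dot B u = B"
    have uT: "u \<in> UT" by (rule grpU_unitri[OF u(1)])
    have oneT: "1\<^sub>m N \<in> UT" by (rule grpU_unitri[OF grpU_one])
    let ?x = "Poly_Mapping.single u 1" and ?y = "Poly_Mapping.single (1\<^sub>m N) (co A u)"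
    have "alg_act \<theta> ty n ?a ?x = alg_act \<theta> ty n ?a ?y"
      using A uT oneT u by (simp add: alg_act_single act_single cscale_single dot_one co_one)
    moreover have "f (alg_act \<theta> ty n ?a ?x) = alg_act \<theta> ty n w ?x" "f (alg_act \<theta> ty n ?a ?y) = alg_act \<theta> ty n w ?y"
      unfolding w_def by (rule hom_act[OF gen cspan_single[OF u(1)]], rule hom_act[OF gen cspan_single[OF grpU_one]])
    ultimately have "alg_act \<theta> ty n w ?x = alg_act \<theta> ty n w ?y" by simp
    then have "Poly_Mapping.lookup (alg_act \<theta> ty n w ?x) (\<chi> B) = Poly_Mapping.lookup (alg_act \<theta> ty n w ?y) (\<chi> B)"
      by simp
    then have "Poly_Mapping.lookup (act \<theta> ty n w u) (\<chi> B) = co A u * Poly_Mapping.lookup (act \<theta> ty n w (1\<^sub>m N)) (\<chi> B)"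
      by (simp add: alg_act_single lookup_cscale)
    moreover have "Poly_Mapping.lookup (act \<theta> ty n w u) (\<chi> B) = Poly_Mapping.lookup w k * co B u"
      using lookup_act[OF BV uT, of w] u(3) B(2) by simp
    moreover have "Poly_Mapping.lookup (act \<theta> ty n w (1\<^sub>m N)) (\<chi> B) = Poly_Mapping.lookup w k"
      using lookup_act[OF BV oneT, of w] B(2) BV by (simp add: dot_one co_one)
    ultimately show "co A u = co B u" using k by simp
  qed
  then show ?thesis using B by blast
qed

lemma orbit_character_sum:
  assumes A: "A \<in> V" and u: "u \<in> U"
  shows "orbit_character \<theta> ty n A u = (\<Sum>D\<in>orb A. if dot D u = D then co D u else 0)"
proof -
  have inj: "inj_on \<chi> (orb A)" using orb_subset_V[OF A] by (auto simp: inj_on_def charV_eq_iff subset_iff)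
  have "orbit_character \<theta> ty n A u =
      (\<Sum>D\<in>orb A. Poly_Mapping.lookup (act \<theta> ty n (Poly_Mapping.single (\<chi> D) 1) u) (\<chi> D))"
    unfolding orbit_character_def orbitV_orb by (simp add: sum.reindex[OF inj])
  also have "\<dots> = (\<Sum>D\<in>orb A. if dot D u = D then co D u else 0)"
  proof (intro sum.cong refl)
    fix D assume "D \<in> orb A"
    then have D: "D \<in> V" using orb_subset_V[OF A] by blast
    have uT: "u \<in> UT" by (rule grpU_unitri[OF u])
    show "Poly_Mapping.lookup (act \<theta> ty n (Poly_Mapping.single (\<chi> D) 1) u) (\<chi> D)
        = (if dot D u = D then co D u else 0)"
      using D uT by (simp add: act_single lookup_single when_def charV_eq_iff dot_closed)
  qed
  finally show ?thesis .
qed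

definition common_stab :: "'a mat \<Rightarrow> 'a mat \<Rightarrow> 'a mat set" where
  "common_stab D E = {u \<in> U. dot D u = D \<and> dot E u = E}"

lemma common_stab_times:
  assumes "D \<in> V" "E \<in> V" "s \<in> common_stab D E" "u \<in> common_stab D E"
  shows "s * u \<in> common_stab D E"
proof -
  have s: "s \<in> U" "dot D s = D" "dot E s = E" and u: "u \<in> U" "dot D u = D" "dot E u = E"
    using assms(3,4) by (auto simp: common_stab_def)
  have T: "s \<in> UT" "u \<in> UT" using s(1) u(1) grpU_unitri by blast+
  have "s * u \<in> U" by (rule grpU_times[OF s(1) u(1)])
  moreover have "dot D (s * u) = D" "dot E (s * u) = E"
    using dot_times[OF assms(1) T] dot_times[OF assms(2) T] s u by simp_all
  ultimately show ?thesis by (simp add: common_stab_def)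
qed

text \<open>Translation by an element at which the two characters differ multiplies the sum by a number other than 1.\<close>

lemma sum_common_stab:
  assumes D: "D \<in> V" and E: "E \<in> V"
  shows "(\<Sum>u\<in>common_stab D E. co D u * cnj (co E u)) = (if agree D E then of_nat (card (common_stab D E)) else 0)"
proof -
  let ?H = "common_stab D E" and ?l = "\<lambda>u. co D u * cnj (co E u)"
  have cnj: "cnj (co X u) = inverse (co X u)" for X u by (simp add: co_def cnj_theta)
  show ?thesis
  proof (cases "agree D E")
    case True
    then have "?l u = 1" if "u \<in> ?H" for u
      using that by (auto simp: common_stab_def agree_def cnj)
    then show ?thesis using True by simp
  next
    case False
    then obtain s where s: "s \<in> U" "dot D s = D" "dot E s = E" "co D s \<noteq> co E s" by (auto simp: agree_def)
    have sT: "s \<in> UT" by (rule grpU_unitri[OF s(1)])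
    have "bij_betw ((*) s) ?H ?H"
    proof (rule bij_betw_byWitness[where f' = "(*) (minv s)"])
      have c: "s \<in> carrier_mat N N" "minv s \<in> carrier_mat N N" using sT by (auto intro: unitri_mat minv_closed)
      have Hc: "u \<in> carrier_mat N N" "u \<in> UT" "u \<in> U" if "u \<in> ?H" for u
        using that by (auto simp: common_stab_def intro: unitri_mat grpU_unitri)
      show "\<forall>u\<in>?H. minv s * (s * u) = u" using Hc c by (blast intro: cancel_left[OF unitri_l_inv[OF sT]])
      show "\<forall>u\<in>?H. s * (minv s * u) = u" using Hc c by (blast intro: cancel_left[OF unitri_r_inv[OF sT]])
      have sH: "s \<in> ?H" using s by (simp add: common_stab_def)
      show "(*) s ` ?H \<subseteq> ?H" by (intro image_subsetI common_stab_times D E sH)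
      have "dot D (minv s) = D" "dot E (minv s) = E"
        using dot_inv(1)[OF D sT] dot_inv(1)[OF E sT] s by simp_all
      then have "minv s \<in> ?H" using grpU_inv[OF s(1)] by (simp add: common_stab_def)
      then show "(*) (minv s) ` ?H \<subseteq> ?H" by (intro image_subsetI common_stab_times D E)
    qed
    then have "(\<Sum>u\<in>?H. ?l u) = (\<Sum>u\<in>?H. ?l (s * u))"
      by (rule sum.reindex_bij_betw[symmetric])
    also have "\<dots> = (\<Sum>u\<in>?H. ?l s * ?l u)"
      using D E sT s by (intro sum.cong refl) (auto simp: common_stab_def co_times grpU_unitri)
    also have "\<dots> = ?l s * (\<Sum>u\<in>?H. ?l u)" by (rule sum_distrib_left[symmetric])
    finally have "(1 - ?l s) * (\<Sum>u\<in>?H. ?l u) = 0" by (simp add: algebra_simps)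
    moreover have "?l s \<noteq> 1" using s(4) by (simp add: cnj field_simps)
    ultimately show ?thesis using False by simp
  qed
qed

text \<open>The inner product is, up to the group order, the sum over pairs of basis vectors [D], [E] of the sums of the linear
  character Psi_D times the conjugate of Psi_E over the common stabilisers. None of these sums is negative.\<close>

lemma char_inner_zero_iff:
  assumes A: "A \<in> V" and C: "C \<in> V"
  shows "char_inner U (orbit_character \<theta> ty n A) (orbit_character \<theta> ty n C) = 0
    \<longleftrightarrow> \<not> (\<exists>D\<in>orb A. \<exists>E\<in>orb C. agree D E)"
proof -
  let ?n = "\<lambda>D E. if agree D E then card (common_stab D E) else 0"
  have "(\<Sum>u\<in>U. orbit_character \<theta> ty n A u * cnj (orbit_character \<theta> ty n C u)) =
      (\<Sum>u\<in>U. \<Sum>D\<in>orb A. \<Sum>E\<in>orb C. if dot D u = D \<and> dot E u = E then co D u * cnj (co E u) else 0)"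
  proof (intro sum.cong refl)
    fix u assume u: "u \<in> U"
    show "orbit_character \<theta> ty n A u * cnj (orbit_character \<theta> ty n C u) =
        (\<Sum>D\<in>orb A. \<Sum>E\<in>orb C. if dot D u = D \<and> dot E u = E then co D u * cnj (co E u) else 0)"
      unfolding orbit_character_sum[OF A u] orbit_character_sum[OF C u] cnj_sum sum_product
      by (intro sum.cong refl) auto
  qed
  also have "\<dots> = (\<Sum>D\<in>orb A. \<Sum>E\<in>orb C. \<Sum>u\<in>U. if dot D u = D \<and> dot E u = E then co D u * cnj (co E u) else 0)"
    by (subst sum.swap, rule sum.cong[OF refl], rule sum.swap)
  also have "\<dots> = (\<Sum>D\<in>orb A. \<Sum>E\<in>orb C. of_nat (?n D E))"
  proof (intro sum.cong refl)
    fix D E assume "D \<in> orb A" "E \<in> orb C"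
    then have DE: "D \<in> V" "E \<in> V" using orb_subset_V A C by blast+
    have "(\<Sum>u\<in>U. if dot D u = D \<and> dot E u = E then co D u * cnj (co E u) else 0)
        = (\<Sum>u\<in>common_stab D E. co D u * cnj (co E u))"
      unfolding common_stab_def by (rule sum.inter_filter[OF finite_U, symmetric])
    then show "(\<Sum>u\<in>U. if dot D u = D \<and> dot E u = E then co D u * cnj (co E u) else 0) = of_nat (?n D E)"
      using sum_common_stab[OF DE] by simp
  qed
  also have "\<dots> = of_nat (\<Sum>D\<in>orb A. \<Sum>E\<in>orb C. ?n D E)" by simp
  finally have S: "(\<Sum>u\<in>U. orbit_character \<theta> ty n A u * cnj (orbit_character \<theta> ty n C u)) =
      of_nat (\<Sum>D\<in>orb A. \<Sum>E\<in>orb C. ?n D E)" .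
  have "card U \<noteq> 0" using finite_U grpU_one by auto
  then have "char_inner U (orbit_character \<theta> ty n A) (orbit_character \<theta> ty n C) = 0
      \<longleftrightarrow> (\<Sum>D\<in>orb A. \<Sum>E\<in>orb C. ?n D E) = 0"
    unfolding char_inner_def S by (simp only: divide_eq_0_iff of_nat_eq_0_iff simp_thms)
  also have "\<dots> \<longleftrightarrow> (\<forall>D\<in>orb A. \<forall>E\<in>orb C. ?n D E = 0)" by (simp add: finite_orb)
  also have "\<dots> \<longleftrightarrow> \<not> (\<exists>D\<in>orb A. \<exists>E\<in>orb C. agree D E)"
  proof -
    have pos: "card (common_stab D E) \<noteq> 0" if "D \<in> orb A" "E \<in> orb C" for D E
    proof -
      have "D \<in> V" "E \<in> V" using that orb_subset_V A C by blast+
      then have "1\<^sub>m N \<in> common_stab D E" by (simp add: common_stab_def grpU_one dot_one)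
      moreover have "finite (common_stab D E)" by (simp add: common_stab_def finite_U)
      ultimately show ?thesis by auto
    qed
    show ?thesis
    proof
      assume z: "\<forall>D\<in>orb A. \<forall>E\<in>orb C. ?n D E = 0"
      show "\<not> (\<exists>D\<in>orb A. \<exists>E\<in>orb C. agree D E)"
      proof clarify
        fix D E assume DE: "D \<in> orb A" "E \<in> orb C" "agree D E"
        then have "card (common_stab D E) = 0" using z by force
        then show False using pos[OF DE(1,2)] by simp
      qed
    qed simp
  qed
  finally show ?thesis .
qed

text \<open>A pair of agreeing basis vectors is translated so that the first one becomes [A].\<close>

lemma inner_nonzero_agree:
  assumes A: "A \<in> V" and C: "C \<in> V"
    and "char_inner U (orbit_character \<theta> ty n A) (orbit_character \<theta> ty n C) \<noteq> 0"
  shows "\<exists>B\<in>orb C. agree A B"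
proof -
  obtain u E where u: "u \<in> U" and E: "E \<in> orb C" and "agree (dot A u) E"
    using assms(3) unfolding char_inner_zero_iff[OF A C] by (auto simp: orb_def)
  moreover have "E \<in> V" using E orb_subset_V[OF C] by blast
  ultimately have "agree A (dot E (minv u))" using agree_translate[OF A] by blast
  then show ?thesis using dot_orb[OF C E grpU_inv[OF u]] by blast
qed

section \<open>Consequences of agreeing stabiliser characters\<close>

text \<open>Right translation adds multiples of columns to columns further left, so it keeps the
  rightmost nonzero entry of every row.\<close>

lemma verge_dot_subset:
  assumes D: "D \<in> V" and g: "g \<in> UT" and rc: "r < N" "c < N" "(Suc r, Suc c) \<in> main ty n D"
  shows "(Suc r, Suc c) \<in> main ty n (dot D g)" "dot D g $$ (r, c) = D $$ (r, c)"
proof -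
  have c: "D \<in> carrier_mat N N" "inv_transp N g \<in> carrier_mat N N" "dot D g \<in> carrier_mat N N"
    using D g by (auto intro: spV_mat inv_transp_mat dot_closed)
  have m: "(Suc r, Suc c) \<in> P" "D $$ (r, c) \<noteq> 0" "\<And>k. c < k \<Longrightarrow> k < N \<Longrightarrow> D $$ (r, k) = 0"
    using rc(3) c(1) by (auto simp: main_Suc)
  have lower: "inv_transp N g \<in> lower_unitri N" by (rule inv_transp_lower[OF g])
  have entry: "dot D g $$ (r, y) = (if (Suc r, Suc y) \<in> P then \<Sum>k<N. D $$ (r, k) * inv_transp N g $$ (k, y) else 0)"
    if "y < N" for y
    unfolding dot_def using c that rc(1) by (simp add: proj_entry[OF mult_carrier_mat[OF c(1,2)]] times_entry[where N = N])
  have "(\<Sum>k<N. D $$ (r, k) * inv_transp N g $$ (k, c)) = D $$ (r, c) * inv_transp N g $$ (c, c)"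
  proof (rule sum_single_term[OF rc(2)])
    fix k assume "k < N" "k \<noteq> c"
    then show "D $$ (r, k) * inv_transp N g $$ (k, c) = 0"
      using m(3)[of k] lower rc(2) by (cases "c < k") (auto simp: lower_unitri_iff)
  qed
  then show same: "dot D g $$ (r, c) = D $$ (r, c)"
    using entry[OF rc(2)] m(1) lower rc(2) by (simp add: lower_unitri_iff)
  have "dot D g $$ (r, y) = 0" if y: "c < y" "y < N" for y
  proof -
    have "D $$ (r, k) * inv_transp N g $$ (k, y) = 0" if "k < N" for k
      using m(3)[of k] lower y that by (cases "c < k") (auto simp: lower_unitri_iff)
    then have "(\<Sum>k<N. D $$ (r, k) * inv_transp N g $$ (k, y)) = 0"
      by (intro sum.neutral ballI) (simp only: lessThan_iff)
    then show ?thesis using entry[OF y(2)] by simp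
  qed
  then show "(Suc r, Suc c) \<in> main ty n (dot D g)" using m same c(3) by (simp add: main_Suc)
qed

lemma verge_dot:
  assumes D: "D \<in> V" and g: "g \<in> UT"
  shows "verge ty n (dot D g) = verge ty n D"
proof -
  have D': "dot D g \<in> V" by (rule dot_closed[OF D g])
  have c: "D \<in> carrier_mat N N" "dot D g \<in> carrier_mat N N" using D D' by (auto intro: spV_mat)
  have undo: "dot (dot D g) (minv g) = D" by (rule dot_inv(1)[OF D g])
  show ?thesis
  proof (rule eq_matI)
    fix r k assume "r < dim_row (verge ty n D)" "k < dim_col (verge ty n D)"
    then have rk: "r < N" "k < N" using verge_carrier[OF c(1)] by auto
    have "(Suc r, Suc k) \<in> main ty n (dot D g) \<longleftrightarrow> (Suc r, Suc k) \<in> main ty n D"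
      using verge_dot_subset(1)[OF D g rk] verge_dot_subset(1)[OF D' minv_closed[OF g] rk] undo by auto
    then show "verge ty n (dot D g) $$ (r, k) = verge ty n D $$ (r, k)"
      using verge_dot_subset(2)[OF D g rk] rk c by (auto simp: verge_entry)
  qed (use verge_carrier[OF c(1)] verge_carrier[OF c(2)] in auto)
qed

lemma separated_dot:
  assumes D: "D \<in> V" "separated ty n D" and g: "g \<in> UT"
  shows "separated ty n (dot D g)"
proof -
  have c: "D \<in> carrier_mat N N" "inv_transp N g \<in> carrier_mat N N" "dot D g \<in> carrier_mat N N"
    using D(1) g by (auto intro: spV_mat inv_transp_mat dot_closed)
  have lower: "inv_transp N g \<in> lower_unitri N" by (rule inv_transp_lower[OF g])
  have "(Suc i, Suc j) \<in> pos_P0 ty n" if ij: "i < N" "j < N" "dot D g $$ (i, j) \<noteq> 0" for i j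
  proof -
    have *: "(Suc i, Suc j) \<in> P" "(D * inv_transp N g) $$ (i, j) \<noteq> 0"
      using ij proj_entry[OF mult_carrier_mat[OF c(1,2)] ij(1,2), of P] by (auto simp: dot_def split: if_splits)
    obtain k where k: "k < N" "D $$ (i, k) \<noteq> 0" "inv_transp N g $$ (k, j) \<noteq> 0"
      using times_entry_nonzero[OF *(2) c(1,2) ij(1,2)] .
    have "j \<le> k" using lower_unitri_nonzeroD[OF lower k(3) ij(2)] .
    moreover have "(Suc i, Suc k) \<in> pos_P0 ty n" using D(2) k ij by (auto simp: separated_def mats_on_iff)
    ultimately show ?thesis using *(1) by (auto simp: pos_P_Suc pos_P0_Suc)
  qed
  then have "dot D g \<in> mats_on N (pos_P0 ty n)" using c(3) by (auto simp: mats_on_iff)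
  moreover have "main_separated ty n (dot D g)"
    using D(2) main_separated_cong[OF main_eqI[OF c(3,1) verge_dot[OF D(1) g]]] by (simp add: separated_def)
  ultimately show ?thesis by (simp add: separated_def)
qed

lemma agree_verge_and_rows:
  assumes "A \<in> V" "B \<in> V" "separated ty n A" "separated ty n B" "agree A B"
  shows "verge ty n A = verge ty n B"
    and "\<exists>q\<in>lower_unitri N. upper_eq N B (q * A) \<and>
      (\<forall>i<N. \<forall>j<N. q $$ (j, i) \<noteq> 0 \<longrightarrow> i = j \<or> (Suc i, Suc j) \<in> posI ty n A)"
proof -
  obtain C1 C2 where "C1 \<in> lower_unitri N" "C2 \<in> lower_unitri N"
    "upper_eq N (C1 * A - flip ty n (C1 * A)) (C2 * B - flip ty n (C2 * B))"
    using agree_skew_parts[OF assms(1,2,5)] .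
  from verge_and_rows[OF assms(3,4) this]
  show "verge ty n A = verge ty n B"
    "\<exists>q\<in>lower_unitri N. upper_eq N B (q * A) \<and>
      (\<forall>i<N. \<forall>j<N. q $$ (j, i) \<noteq> 0 \<longrightarrow> i = j \<or> (Suc i, Suc j) \<in> posI ty n A)" .
qed

text \<open>Row and column operations commute, so a stabiliser only grows when A is replaced by q A.\<close>

lemma stabiliser_rows:
  assumes A: "A \<in> V" and B: "B \<in> V" and q: "q \<in> lower_unitri N" and eq: "upper_eq N B (q * A)"
    and u: "u \<in> UT" "dot A u = A"
  shows "dot B u = B"
proof -
  let ?L = "inv_transp N u"
  have L: "?L \<in> lower_unitri N" by (rule inv_transp_lower[OF u(1)])
  have c: "A \<in> carrier_mat N N" "B \<in> carrier_mat N N" "q \<in> carrier_mat N N" "?L \<in> carrier_mat N N"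
    using A B q L by (auto intro: spV_mat lower_unitri_mat)
  have "upper_eq N (B * ?L) (q * A * ?L)"
    using eq L c by (intro upper_eq_times_right) (auto intro: mult_carrier_mat)
  moreover have "q * A * ?L = q * (A * ?L)" using c by (intro assoc_mult_mat)
  moreover have "upper_eq N (q * (A * ?L)) (q * A)"
    using dot_upper_eq[OF A u(1)] u(2) q c by (intro upper_eq_times_left) (auto intro: mult_carrier_mat)
  ultimately have "upper_eq N (B * ?L) B" using eq unfolding upper_eq_def by simp
  then have "proj P (B * ?L) = proj P B" using c by (intro proj_upper_cong) auto
  then show ?thesis using B by (simp add: dot_def proj_id spV_def)
qed

lemma agree_same_datum:
  assumes "A \<in> V" "B \<in> V" "separated ty n A" "separated ty n B" "agree A B"
  shows "same_datum A B"
proof -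
  obtain q where q: "q \<in> lower_unitri N" "upper_eq N B (q * A)"
    using agree_verge_and_rows(2)[OF assms] by blast
  obtain q' where q': "q' \<in> lower_unitri N" "upper_eq N A (q' * B)"
    using agree_verge_and_rows(2)[OF assms(2,1,4,3) agree_sym[OF assms(5)]] by blast
  show ?thesis
    unfolding same_datum_def
    using assms stabiliser_rows[OF assms(1,2) q] stabiliser_rows[OF assms(2,1) q'] grpU_unitri by blast
qed

lemma stab_dot: "A \<in> V \<Longrightarrow> stab \<theta> ty n A = {u \<in> U. dot A u = A}"
  by (auto simp: stab_def charV_right_dot charV_eq_iff dot_closed grpU_unitri)

lemma Psi_co:
  assumes A: "A \<in> V" and u: "u \<in> U" "dot A u = A"
  shows "Psi \<theta> ty n A u = co A u"
proof -
  have "act \<theta> ty n (Poly_Mapping.single (\<chi> A) 1) u = Poly_Mapping.single (\<chi> A) (co A u)"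
    using A u grpU_unitri[OF u(1)] by (simp add: act_single)
  moreover have "Poly_Mapping.single (\<chi> A) (co A u) = Poly_Mapping.single (\<chi> A) c \<longleftrightarrow> c = co A u" for c
    by (metis lookup_single_eq)
  ultimately show ?thesis
    using A u by (simp add: Psi_def stab_dot cscale_single)
qed

lemma agree_conclusions:
  assumes A: "A \<in> V" "separated ty n A" and B: "B \<in> V" "separated ty n B" and agree: "agree A B"
  shows "\<forall>u\<in>stab2 \<theta> ty n A B. Psi \<theta> ty n A u = Psi \<theta> ty n B u"
    and "verge ty n A = verge ty n B"
    and "verge_class \<theta> ty n A = verge_class \<theta> ty n B"
    and "U_I ty n A = (U_I ty n B :: 'a mat set)"
    and "\<exists>g\<in>U_I ty n A. charV_left \<theta> ty n g B = charV \<theta> ty n A \<and>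
      orbit_moduleT \<theta> ty n A = orbit_moduleT \<theta> ty n B \<and> charT_left \<theta> ty n g B = charT \<theta> ty n A"
    and "iso_CU \<theta> ty n (orbit_module \<theta> ty n A) (orbit_module \<theta> ty n B)"
proof -
  have c: "A \<in> carrier_mat N N" "B \<in> carrier_mat N N" using A B by (auto intro: spV_mat)
  show "\<forall>u\<in>stab2 \<theta> ty n A B. Psi \<theta> ty n A u = Psi \<theta> ty n B u"
    using A B agree by (auto simp: stab2_def stab_dot Psi_co agree_def)
  show verge: "verge ty n A = verge ty n B"
    by (rule agree_verge_and_rows(1)[OF A(1) B(1) A(2) B(2) agree])
  then show "verge_class \<theta> ty n A = verge_class \<theta> ty n B" by (simp add: verge_class_def)
  have posI: "posI ty n A = posI ty n B"
    using main_eqI[OF c verge] by (simp only: posI_def)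
  then show "U_I ty n A = (U_I ty n B :: 'a mat set)" by (simp add: U_I_def)
  obtain q where q: "q \<in> lower_unitri N" "upper_eq N A (q * B)"
    and pattern: "\<forall>i<N. \<forall>j<N. q $$ (j, i) \<noteq> 0 \<longrightarrow> i = j \<or> (Suc i, Suc j) \<in> posI ty n A"
    using agree_verge_and_rows(2)[OF B(1) A(1) B(2) A(2) agree_sym[OF agree]] posI by auto
  obtain g where g: "g \<in> U_I ty n A" "inv_transp N g * B = q * B"
    using pattern_left_action[OF A(2) B(2) q(1) pattern] .
  have qB: "q * B \<in> carrier_mat N N" by (rule mult_carrier_mat[OF lower_unitri_mat[OF q(1)] c(2)])
  have "proj P (q * B) = A"
    using proj_upper_cong[OF q(2) c(1) qB] A(1) by (simp add: proj_id spV_def)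
  moreover have "proj (pos_T N) (q * B) = A"
  proof -
    have "A \<in> mats_on N (pos_T N)" using c A(1) by (auto simp: mats_on_iff pos_T_Suc not_less spV_upper)
    then show ?thesis using proj_T_cong[OF q(2) c(1) qB] by (simp add: proj_id)
  qed
  moreover have "orbitT \<theta> ty n A = orbitT \<theta> ty n B"
    using orbitT_subset[OF A(2) B(2) verge] orbitT_subset[OF B(2) A(2) verge[symmetric]] by blast
  ultimately show "\<exists>g\<in>U_I ty n A. charV_left \<theta> ty n g B = charV \<theta> ty n A \<and>
      orbit_moduleT \<theta> ty n A = orbit_moduleT \<theta> ty n B \<and> charT_left \<theta> ty n g B = charT \<theta> ty n A"
    using g by (intro bexI[of _ g]) (simp_all add: char_dot_left_def)
  show "iso_CU \<theta> ty n (orbit_module \<theta> ty n A) (orbit_module \<theta> ty n B)"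
    by (rule same_datum_iso[OF agree_same_datum[OF A(1) B(1) A(2) B(2) agree]])
qed

lemma iso_imp_Hom_nonzero:
  assumes A: "A \<in> V" and iso: "iso_CU \<theta> ty n (orbit_module \<theta> ty n A) M'"
  shows "Hom_CU \<theta> ty n (orbit_module \<theta> ty n A) M' \<noteq> {\<lambda>v\<in>orbit_module \<theta> ty n A. 0}"
proof
  let ?M = "orbit_module \<theta> ty n A" and ?a = "Poly_Mapping.single (\<chi> A) (1 :: complex)"
  assume "Hom_CU \<theta> ty n ?M M' = {\<lambda>v\<in>?M. 0}"
  then have "inj_on (\<lambda>v\<in>?M. 0 :: ('a mat \<Rightarrow> complex) \<Rightarrow>\<^sub>0 complex) ?M"
    using iso by (auto simp: iso_CU_def bij_betw_def)
  moreover have "?a \<in> ?M" using orbitV_mem[OF grpU_one, of A] A by (simp add: dot_one cspan_single)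
  ultimately have "?a = 0" by (auto simp: inj_on_def)
  then show False by (metis lookup_single_eq lookup_zero zero_neq_one)
qed

end

theorem corollary6p18:
  fixes ty :: lie_type and n p k :: nat
    and \<theta> :: "'a::{field, finite} \<Rightarrow> complex"
    and A C :: "'a mat"
  assumes "prime p" and "odd p" and "CARD('a) = p ^ k"
    and "n \<ge> 1"
    and "nontrivial_add_char \<theta>"
    and "A \<in> spV ty n" and "C \<in> spV ty n"
    and "main_separated ty n A" and "main_separated ty n C"
    and "ty = Lie_C \<Longrightarrow> supp A \<subseteq> pos_P0 ty n \<and> supp C \<subseteq> pos_P0 ty n"
  shows "(Hom_CU \<theta> ty n (orbit_module \<theta> ty n A) (orbit_module \<theta> ty n C)
            \<noteq> {\<lambda>v\<in>orbit_module \<theta> ty n A. 0} \<longrightarrow>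
          (\<exists>B\<in>spV ty n.
             charV \<theta> ty n B \<in> orbitV \<theta> ty n C \<and>
             (\<forall>u\<in>stab2 \<theta> ty n A B. Psi \<theta> ty n A u = Psi \<theta> ty n B u) \<and>
             verge ty n A = verge ty n B \<and>
             verge_class \<theta> ty n A = verge_class \<theta> ty n B \<and>
             U_I ty n A = (U_I ty n B :: 'a mat set) \<and>
             (\<exists>g\<in>U_I ty n A.
                charV_left \<theta> ty n g B = charV \<theta> ty n A \<and>
                orbit_moduleT \<theta> ty n A = orbit_moduleT \<theta> ty n B \<and>
                charT_left \<theta> ty n g B = charT \<theta> ty n A) \<and>
             iso_CU \<theta> ty n (orbit_module \<theta> ty n A) (orbit_module \<theta> ty n B)))
       \<and> (iso_CU \<theta> ty n (orbit_module \<theta> ty n A) (orbit_module \<theta> ty n C)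
            \<or> char_inner (grpU ty n) (orbit_character \<theta> ty n A) (orbit_character \<theta> ty n C) = 0)
       \<and> \<not> (iso_CU \<theta> ty n (orbit_module \<theta> ty n A) (orbit_module \<theta> ty n C)
            \<and> char_inner (grpU ty n) (orbit_character \<theta> ty n A) (orbit_character \<theta> ty n C) = 0)"
proof -
  interpret orbit_modules ty n \<theta>
    using assms(5) two_nonzero[OF assms(2,3)] by unfold_locales
  have A: "A \<in> V" and C: "C \<in> V" using assms by auto
  have sep: "separated ty n A" "separated ty n C"
  proof -
    have "supp A \<subseteq> pos_P0 ty n \<and> supp C \<subseteq> pos_P0 ty n"
    proof (cases "ty = Lie_C")
      case False
      then have "pos_P ty n = pos_P0 ty n" by (simp add: pos_P_def)
      then show ?thesis using A C by (simp add: spV_def mats_on_def)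
    qed (rule assms(10))
    then show "separated ty n A" "separated ty n C"
      using assms(8,9) spV_mat[OF A] spV_mat[OF C] by (auto simp: separated_def mats_on_def)
  qed
  have orbit: "B \<in> V" "separated ty n B" "charV \<theta> ty n B \<in> orbitV \<theta> ty n C"
    "orbitV \<theta> ty n B = orbitV \<theta> ty n C" if "B \<in> orb C" for B
  proof -
    show "B \<in> V" using that orb_subset_V[OF C] by blast
    show "separated ty n B" using that separated_dot[OF C sep(2)] by (auto simp: orb_def grpU_unitri)
    show "charV \<theta> ty n B \<in> orbitV \<theta> ty n C" "orbitV \<theta> ty n B = orbitV \<theta> ty n C"
      using that orb_eq[OF C that] by (auto simp: orbitV_orb)
  qed
  have iso: "iso_CU \<theta> ty n (orbit_module \<theta> ty n A) (orbit_module \<theta> ty n C)" if "B \<in> orb C" "agree A B" for B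
    using agree_conclusions(6)[OF A sep(1) orbit(1,2)[OF that(1)] that(2)] orbit(4)[OF that(1)] by simp
  have hom: "\<exists>B\<in>orb C. agree A B"
    if "Hom_CU \<theta> ty n (orbit_module \<theta> ty n A) (orbit_module \<theta> ty n C) \<noteq> {\<lambda>v\<in>orbit_module \<theta> ty n A. 0}"
    by (rule Hom_nonzero_agree[OF A C that])
  show ?thesis
  proof (intro conjI impI, goal_cases)
    case 1
    then obtain B where B: "B \<in> orb C" "agree A B" using hom by blast
    note conclusions = agree_conclusions[OF A sep(1) orbit(1,2)[OF B(1)] B(2)]
    show ?case
      by (rule bexI[OF _ orbit(1)[OF B(1)]]) (intro conjI conclusions orbit(3)[OF B(1)])
  next
    case 2
    show ?case using inner_nonzero_agree[OF A C] iso by blast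
  next
    case 3
    show ?case
      using iso_imp_Hom_nonzero[OF A] hom char_inner_zero_iff[OF A C] orb_self[OF A] by blast
  qed
qed

end
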